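(* Let $G$ be an abelian group, let $R$ be a $G$-graded algebra over a field $\mathbb F$ that is graded-simple and satisfies the descending chain condition on graded left ideals, and let $\varphi$ be a degree-preserving involution on $R$. Then there exist a graded-division algebra $D$ whose support $T$ is a subgroup of $G$, a degree-preserving involution $\varphi_0$ on $D$, integers $q\ge0$ and $s\ge0$ (not both zero), $\delta\in\{\pm1\}$, a $q$-tuple $\underline d=(d_1,\dots,d_q)$ of elements $0\ne d_i\in D_{t_i}$ satisfying $\varphi_0(d_i)=\delta d_i$, and a group homomorphism $\alpha:\widetilde G(T,q,s,\underline t)\to G$ with $\alpha|_T=\mathrm{id}_T$ such that ${}^\alpha\mathcal M(D,\varphi_0,q,s,\underline d,\delta)$ is isomorphic to $R$ as a $G$-graded algebra with involution.
   Context: All algebras are associative over an arbitrary field $\mathbb F$. A $G$-graded algebra $R$ is graded-simple if $R^2\ne0$ and its only graded two-sided ideals are $0$ and $R$. An involution is an $\mathbb F$-linear antiautomorphism of order at most 2; degree-preserving means it maps each homogeneous component to itself. A graded-division algebra is a unital graded algebra in which all nonzero homogeneous elements are invertible; $D^\times_{\mathrm{gr}}$ is the group of its nonzero homogeneous elements and its support $T=\{g: D_g\ne0\}$ is a group. Construction. Let $D$ be a graded-division algebra with abelian support $T$, $\varphi_0$ a degree-preserving involution on $D$, $q,s\ge0$ integers not both zero, $\delta\in\{\pm1\}$, $\underline d=(d_1,\dots,d_q)$ with $d_i\in D^\times_{\mathrm{gr}}$, $\varphi_0(d_i)=\delta d_i$, $t_i=\deg d_i$, $\underline t=(t_1,\dots,t_q)$,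 $k=q+2s$. The group $\widetilde G(T,q,s,\underline t)$ is the quotient of $F\times T$, with $F$ the free abelian group on symbols $\tilde g_1,\dots,\tilde g_k$, by the relations $$\tilde g_1^2t_1^{-1}=\dots=\tilde g_q^2t_q^{-1}=\tilde g_{q+1}\tilde g_{q+2}=\dots=\tilde g_{q+2s-1}\tilde g_{q+2s}$$ (no relations if $q+s=1$); $T$ embeds as a subgroup. The graded algebra with involution $\mathcal M(D,\varphi_0,q,s,\underline d,\delta)$ is $M_k(D)=M_k(\mathbb F)\otimes D$ with $\widetilde G(T,q,s,\underline t)$-grading $\deg(E_{ij}\otimes d)=\tilde g_i\tilde g_j^{-1}t$ for $0\ne d\in D_t$, and involution $X\mapsto\Phi^{-1}\varphi_0(X^T)\Phi$ ($\varphi_0$ applied entrywise), where $$\Phi=\mathrm{diag}\left(d_1,\dots,d_q,\begin{bmatrix}0&1\\ \delta&0\end{bmatrix},\dots,\begin{bmatrix}0&1\\ \delta&0\end{bmatrix}\right)$$ with $s$ blocks of size 2. For a homomorphism $\alpha:H\to G$ and an $H$-graded algebra $A$, ${}^\alpha A$ is $A$ with the $G$-grading whose component of degree $g$ is $\bigoplus_{h\in\alpha^{-1}(g)}A_h$. Isomorphisms of graded algebras with involution preserve degree and commute with the involutions. *)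

theory Defs
  imports "HOL-Algebra.Algebra"
begin

section \<open>Associative algebras, gradings and involutions\<close>

text \<open>
  HOL-Algebra's \<open>algebra\<close> is commutative and unital. Here an algebra is associative over a field,
  not necessarily commutative and not necessarily unital: the field \<open>one\<close> of the record \<open>A\<close> is
  unconstrained. A unital algebra is one that satisfies \<open>ring A\<close> in addition.
\<close>

locale assoc_algebra = field F + module F A for F (structure) and A (structure) +
  assumes a_mult_closed: "\<lbrakk>x \<in> carrier A; y \<in> carrier A\<rbrakk> \<Longrightarrow> x \<otimes>\<^bsub>A\<^esub> y \<in> carrier A"
    and a_mult_assoc: "\<lbrakk>x \<in> carrier A; y \<in> carrier A; z \<in> carrier A\<rbrakk> \<Longrightarrow>
      (x \<otimes>\<^bsub>A\<^esub> y) \<otimes>\<^bsub>A\<^esub> z = x \<otimes>\<^bsub>A\<^esub> (y \<otimes>\<^bsub>A\<^esub> z)"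
    and a_mult_distl: "\<lbrakk>x \<in> carrier A; y \<in> carrier A; z \<in> carrier A\<rbrakk> \<Longrightarrow>
      (x \<oplus>\<^bsub>A\<^esub> y) \<otimes>\<^bsub>A\<^esub> z = x \<otimes>\<^bsub>A\<^esub> z \<oplus>\<^bsub>A\<^esub> y \<otimes>\<^bsub>A\<^esub> z"
    and a_mult_distr: "\<lbrakk>x \<in> carrier A; y \<in> carrier A; z \<in> carrier A\<rbrakk> \<Longrightarrow>
      z \<otimes>\<^bsub>A\<^esub> (x \<oplus>\<^bsub>A\<^esub> y) = z \<otimes>\<^bsub>A\<^esub> x \<oplus>\<^bsub>A\<^esub> z \<otimes>\<^bsub>A\<^esub> y"
    and a_smult_mult_left: "\<lbrakk>a \<in> carrier F; x \<in> carrier A; y \<in> carrier A\<rbrakk> \<Longrightarrow>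
      (a \<odot>\<^bsub>A\<^esub> x) \<otimes>\<^bsub>A\<^esub> y = a \<odot>\<^bsub>A\<^esub> (x \<otimes>\<^bsub>A\<^esub> y)"
    and a_smult_mult_right: "\<lbrakk>a \<in> carrier F; x \<in> carrier A; y \<in> carrier A\<rbrakk> \<Longrightarrow>
      x \<otimes>\<^bsub>A\<^esub> (a \<odot>\<^bsub>A\<^esub> y) = a \<odot>\<^bsub>A\<^esub> (x \<otimes>\<^bsub>A\<^esub> y)"

definition lin_span where
  "lin_span F A S = \<Inter>{N. submodule N F A \<and> S \<subseteq> N}"

text \<open>
  A \<open>G\<close>-grading is a family \<open>\<Gamma>\<close> of subspaces indexed by the elements of \<open>carrier G\<close> (the values of \<open>\<Gamma>\<close>
  outside \<open>carrier G\<close> play no role).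
\<close>

locale graded_algebra = assoc_algebra F A + grp: group G
  for F (structure) and A (structure) and G (structure) +
  fixes \<Gamma>
  assumes component_subspace: "g \<in> carrier G \<Longrightarrow> submodule (\<Gamma> g) F A"
    and component_mult: "\<lbrakk>g \<in> carrier G; h \<in> carrier G; x \<in> \<Gamma> g; y \<in> \<Gamma> h\<rbrakk> \<Longrightarrow>
      x \<otimes>\<^bsub>A\<^esub> y \<in> \<Gamma> (g \<otimes>\<^bsub>G\<^esub> h)"
    and direct_decomposition: "x \<in> carrier A \<Longrightarrow>
      \<exists>!c. c \<in> (\<Pi>\<^sub>E g\<in>carrier G. \<Gamma> g) \<and> finite {g \<in> carrier G. c g \<noteq> \<zero>\<^bsub>A\<^esub>} \<and>
           x = (\<Oplus>\<^bsub>A\<^esub>g\<in>{g \<in> carrier G. c g \<noteq> \<zero>\<^bsub>A\<^esub>}. c g)"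

definition grading_support where
  "grading_support A G \<Gamma> = {g \<in> carrier G. \<Gamma> g \<noteq> {\<zero>\<^bsub>A\<^esub>}}"

text \<open>A subspace \<open>I\<close> is graded if it is the sum of the subspaces \<open>I \<inter> \<Gamma> g\<close>.\<close>

definition graded_subspace where
  "graded_subspace F A G \<Gamma> I \<longleftrightarrow>
     submodule I F A \<and> I = lin_span F A (\<Union>g\<in>carrier G. I \<inter> \<Gamma> g)"

definition graded_left_ideal where
  "graded_left_ideal F A G \<Gamma> I \<longleftrightarrow>
     graded_subspace F A G \<Gamma> I \<and> (\<forall>a\<in>carrier A. \<forall>x\<in>I. a \<otimes>\<^bsub>A\<^esub> x \<in> I)"

definition graded_ideal where
  "graded_ideal F A G \<Gamma> I \<longleftrightarrow>
     graded_subspace F A G \<Gamma> I \<and> (\<forall>a\<in>carrier A. \<forall>x\<in>I. a \<otimes>\<^bsub>A\<^esub> x \<in> I \<and> x \<otimes>\<^bsub>A\<^esub> a \<in> I)"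

definition graded_simple where
  "graded_simple F A G \<Gamma> \<longleftrightarrow>
     (\<exists>x\<in>carrier A. \<exists>y\<in>carrier A. x \<otimes>\<^bsub>A\<^esub> y \<noteq> \<zero>\<^bsub>A\<^esub>) \<and>
     (\<forall>I. graded_ideal F A G \<Gamma> I \<longrightarrow> I = {\<zero>\<^bsub>A\<^esub>} \<or> I = carrier A)"

definition dcc_graded_left_ideals where
  "dcc_graded_left_ideals F A G \<Gamma> \<longleftrightarrow>
     (\<forall>I :: nat \<Rightarrow> _ set. (\<forall>n. graded_left_ideal F A G \<Gamma> (I n)) \<and> (\<forall>n. I (Suc n) \<subseteq> I n) \<longrightarrow>
        (\<exists>N. \<forall>n\<ge>N. I n = I N))"

definition graded_division_algebra where
  "graded_division_algebra F D G \<Gamma> \<longleftrightarrow>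
     graded_algebra F D G \<Gamma> \<and> ring D \<and> \<one>\<^bsub>D\<^esub> \<noteq> \<zero>\<^bsub>D\<^esub> \<and>
     (\<forall>g\<in>carrier G. \<forall>x\<in>\<Gamma> g. x \<noteq> \<zero>\<^bsub>D\<^esub> \<longrightarrow> x \<in> Units D)"

definition involution where
  "involution F A \<phi> \<longleftrightarrow>
     (\<forall>x\<in>carrier A. \<phi> x \<in> carrier A) \<and>
     (\<forall>x\<in>carrier A. \<forall>y\<in>carrier A. \<phi> (x \<oplus>\<^bsub>A\<^esub> y) = \<phi> x \<oplus>\<^bsub>A\<^esub> \<phi> y) \<and>
     (\<forall>a\<in>carrier F. \<forall>x\<in>carrier A. \<phi> (a \<odot>\<^bsub>A\<^esub> x) = a \<odot>\<^bsub>A\<^esub> \<phi> x) \<and>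
     (\<forall>x\<in>carrier A. \<forall>y\<in>carrier A. \<phi> (x \<otimes>\<^bsub>A\<^esub> y) = \<phi> y \<otimes>\<^bsub>A\<^esub> \<phi> x) \<and>
     (\<forall>x\<in>carrier A. \<phi> (\<phi> x) = x)"

definition degree_preserving where
  "degree_preserving G \<Gamma> \<phi> \<longleftrightarrow> (\<forall>g\<in>carrier G. \<phi> ` \<Gamma> g \<subseteq> \<Gamma> g)"

text \<open>
  The grading of \<open>\<^sup>\<alpha>A\<close>, for a homomorphism \<open>\<alpha>\<close> defined on the group \<open>H\<close>. The component of degree \<open>g\<close>
  is the sum, hence the span of the union, of the components of degree in the fibre over \<open>g\<close>.
\<close>

definition push_grading where
  "push_grading F A H \<alpha> \<Gamma> g = lin_span F A (\<Union>h\<in>{h \<in> carrier H. \<alpha> h = g}. \<Gamma> h)"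

text \<open>
  The library's \<open>ring_iso\<close> is not used, as it would constrain the field \<open>one\<close> of \<open>B\<close>.
\<close>

definition graded_involution_iso where
  "graded_involution_iso F G A \<Gamma> \<phi> B \<Delta> \<psi> f \<longleftrightarrow>
     bij_betw f (carrier A) (carrier B) \<and>
     (\<forall>x\<in>carrier A. \<forall>y\<in>carrier A. f (x \<oplus>\<^bsub>A\<^esub> y) = f x \<oplus>\<^bsub>B\<^esub> f y) \<and>
     (\<forall>a\<in>carrier F. \<forall>x\<in>carrier A. f (a \<odot>\<^bsub>A\<^esub> x) = a \<odot>\<^bsub>B\<^esub> f x) \<and>
     (\<forall>x\<in>carrier A. \<forall>y\<in>carrier A. f (x \<otimes>\<^bsub>A\<^esub> y) = f x \<otimes>\<^bsub>B\<^esub> f y) \<and>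
     (\<forall>g\<in>carrier G. f ` \<Gamma> g = \<Delta> g) \<and>
     (\<forall>x\<in>carrier A. f (\<phi> x) = \<psi> (f x))"


section \<open>The grading group of the construction\<close>

text \<open>
  All indices are 1-based. \<open>T\<close> is a group record, and \<open>t i\<close> is used for \<open>1 \<le> i \<le> q\<close>.
  Equating all the \<open>relators\<close> amounts to factoring out their pairwise quotients; this gives no
  relation if \<open>q + s = 1\<close>.
\<close>

definition ambient where
  "ambient T q s = free_Abelian_group {1..q + 2 * s :: nat} \<times>\<times> T"

definition amb_gen :: "('g, 'm) monoid_scheme \<Rightarrow> nat \<Rightarrow> (nat \<Rightarrow>\<^sub>0 int) \<times> 'g" where
  "amb_gen T i = (frag_of i, \<one>\<^bsub>T\<^esub>)"

definition amb_emb :: "'g \<Rightarrow> (nat \<Rightarrow>\<^sub>0 int) \<times> 'g" where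
  "amb_emb u = (0, u)"

definition relators where
  "relators T q s t =
     {amb_gen T i [^]\<^bsub>ambient T q s\<^esub> (2::nat) \<otimes>\<^bsub>ambient T q s\<^esub> inv\<^bsub>ambient T q s\<^esub> amb_emb (t i) |i.
        i \<in> {1..q}} \<union>
     {amb_gen T (q + 2 * m - 1) \<otimes>\<^bsub>ambient T q s\<^esub> amb_gen T (q + 2 * m) |m. m \<in> {1..s}}"

definition relation_subgroup where
  "relation_subgroup T q s t =
     generate (ambient T q s)
       {a \<otimes>\<^bsub>ambient T q s\<^esub> inv\<^bsub>ambient T q s\<^esub> b |a b. a \<in> relators T q s t \<and> b \<in> relators T q s t}"

definition tilde_group where
  "tilde_group T q s t = ambient T q s Mod relation_subgroup T q s t"

definition tilde_gen where
  "tilde_gen T q s t i = relation_subgroup T q s t #>\<^bsub>ambient T q s\<^esub> amb_gen T i"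

definition tilde_emb where
  "tilde_emb T q s t u = relation_subgroup T q s t #>\<^bsub>ambient T q s\<^esub> amb_emb u"


section \<open>The graded algebra with involution \<open>M(D, \<phi>\<^sub>0, q, s, d, \<delta>)\<close>\<close>

text \<open>The algebra of \<open>k \<times> k\<close> matrices over \<open>D\<close>, a matrix being a function of the pair \<open>(i, j)\<close> of indices.\<close>

definition matrix_algebra ::
    "nat \<Rightarrow> ('f, 'a, 'm) module_scheme \<Rightarrow> ('f, nat \<times> nat \<Rightarrow> 'a) module" where
  "matrix_algebra k D =
     \<lparr>carrier = ({1..k} \<times> {1..k}) \<rightarrow>\<^sub>E carrier D,
      monoid.mult = (\<lambda>A B. \<lambda>(i, j)\<in>{1..k} \<times> {1..k}. \<Oplus>\<^bsub>D\<^esub>l\<in>{1..k}. A (i, l) \<otimes>\<^bsub>D\<^esub> B (l, j)),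
      monoid.one = (\<lambda>(i, j)\<in>{1..k} \<times> {1..k}. if i = j then \<one>\<^bsub>D\<^esub> else \<zero>\<^bsub>D\<^esub>),
      ring.zero = (\<lambda>(i, j)\<in>{1..k} \<times> {1..k}. \<zero>\<^bsub>D\<^esub>),
      ring.add = (\<lambda>A B. \<lambda>(i, j)\<in>{1..k} \<times> {1..k}. A (i, j) \<oplus>\<^bsub>D\<^esub> B (i, j)),
      module.smult = (\<lambda>a A. \<lambda>(i, j)\<in>{1..k} \<times> {1..k}. a \<odot>\<^bsub>D\<^esub> A (i, j))\<rparr>"

text \<open>The matrix \<open>E\<^sub>i\<^sub>j \<otimes> x\<close>.\<close>

definition matrix_unit where
  "matrix_unit k D i j x = (\<lambda>p\<in>{1..k} \<times> {1..k}. if p = (i, j) then x else \<zero>\<^bsub>D\<^esub>)"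

definition model_grading where
  "model_grading F D T \<Gamma> q s t h =
     lin_span F (matrix_algebra (q + 2 * s) D)
       {matrix_unit (q + 2 * s) D i j x |i j u x.
          i \<in> {1..q + 2 * s} \<and> j \<in> {1..q + 2 * s} \<and> u \<in> carrier T \<and> x \<in> \<Gamma> u \<and> x \<noteq> \<zero>\<^bsub>D\<^esub> \<and>
          h = tilde_gen T q s t i \<otimes>\<^bsub>tilde_group T q s t\<^esub>
                inv\<^bsub>tilde_group T q s t\<^esub> tilde_gen T q s t j \<otimes>\<^bsub>tilde_group T q s t\<^esub>
                tilde_emb T q s t u}"

definition model_form where
  "model_form D q s d \<delta> =
     (\<lambda>(i, j)\<in>{1..q + 2 * s} \<times> {1..q + 2 * s}.
        if i = j \<and> i \<le> q then d i
        else if (\<exists>m\<in>{1..s}. i = q + 2 * m - 1 \<and> j = q + 2 * m) then \<one>\<^bsub>D\<^esub>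
        else if (\<exists>m\<in>{1..s}. i = q + 2 * m \<and> j = q + 2 * m - 1) then \<delta> \<odot>\<^bsub>D\<^esub> \<one>\<^bsub>D\<^esub>
        else \<zero>\<^bsub>D\<^esub>)"

definition entrywise_transpose where
  "entrywise_transpose k \<phi> A = (\<lambda>(i, j)\<in>{1..k} \<times> {1..k}. \<phi> (A (j, i)))"

definition model_involution where
  "model_involution D \<phi>\<^sub>0 q s d \<delta> A =
     (let M = matrix_algebra (q + 2 * s) D; \<Phi> = model_form D q s d \<delta> in
      inv\<^bsub>M\<^esub> \<Phi> \<otimes>\<^bsub>M\<^esub> entrywise_transpose (q + 2 * s) \<phi>\<^sub>0 A \<otimes>\<^bsub>M\<^esub> \<Phi>)"

end

theory Submission
  imports Defs
begin

text \<open>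
  Let \<open>e\<close> be a homogeneous idempotent generating a minimal graded left ideal and \<open>D = e R e\<close>, a graded-division
  algebra. Since \<open>R\<close> is graded-prime, \<open>\<phi>(e) R e\<close> contains a nonzero homogeneous \<open>c\<close>, and passing to
  \<open>c + \<phi>(c)\<close> if this is nonzero one may assume \<open>\<phi>(c) = \<delta> c\<close> with \<open>\<delta> = \<plusminus>1\<close>. With \<open>c' c = e\<close> and
  \<open>c c' = \<phi>(e)\<close>, the map \<open>\<phi>\<^sub>0(x) = c' \<phi>(x) c\<close> is an involution of \<open>D\<close>, and
  \<open>B(x, y) = c' \<phi>(x) y\<close> is a \<open>\<delta>\<close>-hermitian nondegenerate homogeneous form on the right \<open>D\<close>-module \<open>R e\<close>.

  Gram-Schmidt on homogeneous elements of \<open>R e\<close> yields first \<open>u\<^sub>1, \<dots>, u\<^sub>q\<close> with \<open>B(u\<^sub>i, u\<^sub>i) \<noteq> 0\<close> and, once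
  the form is alternating on the homogeneous elements of the orthogonal complement, hyperbolic pairs. The chain
  condition on the left annihilators of the \<open>u\<^sub>i\<close> bounds the process. If \<open>v\<^sub>i\<close> is the dual family, then
  \<open>\<Sum>\<^sub>i u\<^sub>i v\<^sub>i\<close> is a unit element of \<open>R\<close>, and \<open>r \<mapsto> (v\<^sub>i r u\<^sub>j)\<close> is the isomorphism onto the matrix
  algebra; \<open>\<alpha>\<close> sends the generator with index \<open>i\<close> to the degree of \<open>u\<^sub>i\<close>.
\<close>

section \<open>Homogeneous components\<close>

text \<open>Neither a unit of \<open>R\<close> nor finiteness of \<open>R e\<close> over
  \<open>D\<close> is given, and the characteristic may be 2. So no ranks are counted. Instead,
  \<open>B(x, -)\<close> is itself left multiplication by an element of \<open>R\<close>. This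
  element kills the vectors already chosen but not the new ones, hence the left annihilators fall
  strictly; the unit appears only once the basis is complete. Characteristic 2 is why vectors with
  nonzero \<open>B(x, x)\<close> are exhausted before any pair is formed. Afterwards every
  homogeneous vector of the complement is isotropic, so a partner \<open>z\<close> with
  \<open>B(x, z) = e\<close> needs no correction, and nothing is ever divided by 2. The relations of
  the grading group say that \<open>B\<close> is homogeneous of degree inverse to \<gamma>, the
  degree of \<open>c\<close>. A value \<open>B(u_i, u_i)\<close> of degree \<open>t_i\<close> forces
  \<open>g_i^2 t_i^-1\<close> = \<gamma>, and the value \<open>e\<close> on a hyperbolic pair forces
  the product of its two degrees to be \<gamma>. Thus \<gamma> is the common image of all relators.
  The matrix \<Phi> is also the matrix of an element of \<open>R\<close>, so both its inverse and
  the involution of the model are computed inside \<open>R\<close>.\<close>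

lemma subset_lin_span: "S \<subseteq> lin_span F A S"
  unfolding lin_span_def by blast

lemma lin_span_subset: "submodule N F A \<Longrightarrow> S \<subseteq> N \<Longrightarrow> lin_span F A S \<subseteq> N"
  unfolding lin_span_def by blast

section \<open>Arithmetic in an algebra that need not have a unit\<close>

context assoc_algebra
begin

abbreviation a_mult (infixl "\<bullet>" 70) where "x \<bullet> y \<equiv> x \<otimes>\<^bsub>A\<^esub> y"

declare a_mult_closed [simp, intro]

lemma a_mult_zero_left [simp]:
  assumes "x \<in> carrier A" shows "\<zero>\<^bsub>A\<^esub> \<bullet> x = \<zero>\<^bsub>A\<^esub>"
proof -
  have "\<zero>\<^bsub>A\<^esub> \<bullet> x \<oplus>\<^bsub>A\<^esub> \<zero>\<^bsub>A\<^esub> \<bullet> x = \<zero>\<^bsub>A\<^esub> \<bullet> x"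
    using a_mult_distl[of "\<zero>\<^bsub>A\<^esub>" "\<zero>\<^bsub>A\<^esub>" x] assms by simp
  then show ?thesis using assms by (metis M.add.r_cancel_one' M.zero_closed a_mult_closed)
qed

lemma a_mult_zero_right [simp]:
  assumes "x \<in> carrier A" shows "x \<bullet> \<zero>\<^bsub>A\<^esub> = \<zero>\<^bsub>A\<^esub>"
proof -
  have "x \<bullet> \<zero>\<^bsub>A\<^esub> \<oplus>\<^bsub>A\<^esub> x \<bullet> \<zero>\<^bsub>A\<^esub> = x \<bullet> \<zero>\<^bsub>A\<^esub>"
    using a_mult_distr[of "\<zero>\<^bsub>A\<^esub>" "\<zero>\<^bsub>A\<^esub>" x] assms by simp
  then show ?thesis using assms by (metis M.add.r_cancel_one' M.zero_closed a_mult_closed)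
qed

lemma a_mult_minus_left:
  assumes "x \<in> carrier A" "y \<in> carrier A" shows "(\<ominus>\<^bsub>A\<^esub> x) \<bullet> y = \<ominus>\<^bsub>A\<^esub> (x \<bullet> y)"
  using a_mult_distl[of "\<ominus>\<^bsub>A\<^esub> x" x y] assms
  by (metis M.a_inv_closed M.l_neg M.minus_equality a_mult_closed a_mult_zero_left)

lemma a_mult_minus_right:
  assumes "x \<in> carrier A" "y \<in> carrier A" shows "x \<bullet> (\<ominus>\<^bsub>A\<^esub> y) = \<ominus>\<^bsub>A\<^esub> (x \<bullet> y)"
  using a_mult_distr[of "\<ominus>\<^bsub>A\<^esub> y" y x] assms
  by (metis M.a_inv_closed M.l_neg M.minus_equality a_mult_closed a_mult_zero_right)

lemma a_mult_diff_left:
  assumes "x \<in> carrier A" "y \<in> carrier A" "z \<in> carrier A"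
  shows "(x \<ominus>\<^bsub>A\<^esub> y) \<bullet> z = x \<bullet> z \<ominus>\<^bsub>A\<^esub> y \<bullet> z"
  using assms by (simp add: a_minus_def a_mult_distl a_mult_minus_left)

lemma a_mult_diff_right:
  assumes "x \<in> carrier A" "y \<in> carrier A" "z \<in> carrier A"
  shows "z \<bullet> (x \<ominus>\<^bsub>A\<^esub> y) = z \<bullet> x \<ominus>\<^bsub>A\<^esub> z \<bullet> y"
  using assms by (simp add: a_minus_def a_mult_distr a_mult_minus_right)

lemma diff_eq_zero_iff:
  assumes "x \<in> carrier A" "y \<in> carrier A"
  shows "x \<ominus>\<^bsub>A\<^esub> y = \<zero>\<^bsub>A\<^esub> \<longleftrightarrow> x = y"
  using assms by (metis M.a_inv_closed M.minus_equality M.minus_minus M.r_neg a_minus_def)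

lemma a_mult_finsum_left:
  assumes "f \<in> I \<rightarrow> carrier A" "x \<in> carrier A"
  shows "(\<Oplus>\<^bsub>A\<^esub>i\<in>I. f i) \<bullet> x = (\<Oplus>\<^bsub>A\<^esub>i\<in>I. f i \<bullet> x)"
  using assms(1)
proof (induction I rule: infinite_finite_induct)
  case (infinite I) then show ?case using assms(2) by simp
next
  case empty then show ?case using assms(2) by simp
next
  case (insert i I)
  then have "f i \<in> carrier A" "f \<in> I \<rightarrow> carrier A" "(\<lambda>i. f i \<bullet> x) \<in> I \<rightarrow> carrier A"
    using assms(2) by auto
  then show ?case using insert assms(2) by (simp add: a_mult_distl)
qed

lemma a_mult_finsum_right:
  assumes "f \<in> I \<rightarrow> carrier A" "x \<in> carrier A"
  shows "x \<bullet> (\<Oplus>\<^bsub>A\<^esub>i\<in>I. f i) = (\<Oplus>\<^bsub>A\<^esub>i\<in>I. x \<bullet> f i)"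
  using assms(1)
proof (induction I rule: infinite_finite_induct)
  case (infinite I) then show ?case using assms(2) by simp
next
  case empty then show ?case using assms(2) by simp
next
  case (insert i I)
  then have "f i \<in> carrier A" "f \<in> I \<rightarrow> carrier A" "(\<lambda>i. x \<bullet> f i) \<in> I \<rightarrow> carrier A"
    using assms(2) by auto
  then show ?case using insert assms(2) by (simp add: a_mult_distr)
qed

lemma finsum_single:
  assumes "finite I" "i \<in> I" "x \<in> carrier A"
  shows "(\<Oplus>\<^bsub>A\<^esub>j\<in>I. if j = i then x else \<zero>\<^bsub>A\<^esub>) = x"
  using M.add.finprod_singleton[of i I "\<lambda>_. x"] assms by (simp add: eq_commute[of i])

lemma finsum_in_submodule:
  assumes "submodule N F A" "\<And>i. i \<in> I \<Longrightarrow> f i \<in> N"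
  shows "(\<Oplus>\<^bsub>A\<^esub>i\<in>I. f i) \<in> N"
  using assms(2)
proof (induction I rule: infinite_finite_induct)
  case (infinite I)
  then show ?case using submodule.axioms(1)[OF assms(1)] subgroup.one_closed by fastforce
next
  case empty
  then show ?case using submodule.axioms(1)[OF assms(1)] subgroup.one_closed by fastforce
next
  case (insert i I)
  have N: "N \<subseteq> carrier A" using submoduleE[OF assms(1)] by auto
  then show ?case using insert submoduleE(5)[OF assms(1)] by (simp add: Pi_def subset_iff)
qed

lemma submodule_zero: "submodule N F A \<Longrightarrow> \<zero>\<^bsub>A\<^esub> \<in> N"
  using submodule.axioms(1) subgroup.one_closed by fastforce

text \<open>Lets sums in the corner algebra be computed in \<open>A\<close>. The field
  \<open>one\<close> may change as well, since \<open>finsum\<close> sees only the additive monoid;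
  infinite index sets give zero on both sides.\<close>

lemma finsum_change_carrier:
  assumes "abelian_monoid (A\<lparr>carrier := S, one := u\<rparr>)" "S \<subseteq> carrier A" "f \<in> I \<rightarrow> S"
  shows "finsum (A\<lparr>carrier := S, one := u\<rparr>) f I = finsum A f I"
proof -
  interpret S: abelian_monoid "A\<lparr>carrier := S, one := u\<rparr>" by fact
  show ?thesis using assms(3)
  proof (induction I rule: infinite_finite_induct)
    case (infinite I) then show ?case using S.finsum_infinite M.finsum_infinite by simp
  next
    case empty then show ?case using S.finsum_empty by simp
  next
    case (insert i I)
    then have "f i \<in> S" "f \<in> I \<rightarrow> S" by auto
    then have "f i \<in> carrier A" "f \<in> I \<rightarrow> carrier A" using assms(2) by auto
    then show ?case using insert \<open>f i \<in> S\<close> \<open>f \<in> I \<rightarrow> S\<close> S.finsum_insert[of I i f] by simp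
  qed
qed

end

section \<open>Projections onto the homogeneous components\<close>

context graded_algebra
begin

lemma component_closed: "g \<in> carrier G \<Longrightarrow> x \<in> \<Gamma> g \<Longrightarrow> x \<in> carrier A"
  using component_subspace submoduleE(1) by blast

lemma component_zero: "g \<in> carrier G \<Longrightarrow> \<zero>\<^bsub>A\<^esub> \<in> \<Gamma> g"
  using component_subspace submodule_zero by blast

lemma component_add: "g \<in> carrier G \<Longrightarrow> x \<in> \<Gamma> g \<Longrightarrow> y \<in> \<Gamma> g \<Longrightarrow> x \<oplus>\<^bsub>A\<^esub> y \<in> \<Gamma> g"
  using component_subspace submoduleE(5) by blast

lemma component_uminus: "g \<in> carrier G \<Longrightarrow> x \<in> \<Gamma> g \<Longrightarrow> \<ominus>\<^bsub>A\<^esub> x \<in> \<Gamma> g"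
  using component_subspace submoduleE(3) by blast

lemma component_diff: "g \<in> carrier G \<Longrightarrow> x \<in> \<Gamma> g \<Longrightarrow> y \<in> \<Gamma> g \<Longrightarrow> x \<ominus>\<^bsub>A\<^esub> y \<in> \<Gamma> g"
  by (simp add: a_minus_def component_add component_uminus)

lemma component_smult: "g \<in> carrier G \<Longrightarrow> x \<in> \<Gamma> g \<Longrightarrow> a \<in> carrier F \<Longrightarrow> a \<odot>\<^bsub>A\<^esub> x \<in> \<Gamma> g"
  using component_subspace submoduleE(4) by blast

definition hcomp where
  "hcomp x = (THE c. c \<in> (\<Pi>\<^sub>E g\<in>carrier G. \<Gamma> g) \<and> finite {g \<in> carrier G. c g \<noteq> \<zero>\<^bsub>A\<^esub>} \<and>
           x = (\<Oplus>\<^bsub>A\<^esub>g\<in>{g \<in> carrier G. c g \<noteq> \<zero>\<^bsub>A\<^esub>}. c g))"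

lemma hcomp_props:
  assumes "x \<in> carrier A"
  shows "hcomp x \<in> (\<Pi>\<^sub>E g\<in>carrier G. \<Gamma> g)" "finite {g \<in> carrier G. hcomp x g \<noteq> \<zero>\<^bsub>A\<^esub>}"
    "(\<Oplus>\<^bsub>A\<^esub>g\<in>{g \<in> carrier G. hcomp x g \<noteq> \<zero>\<^bsub>A\<^esub>}. hcomp x g) = x"
  using theI'[OF direct_decomposition[OF assms]] unfolding hcomp_def by auto

lemma hcomp_in: "x \<in> carrier A \<Longrightarrow> g \<in> carrier G \<Longrightarrow> hcomp x g \<in> \<Gamma> g"
  using hcomp_props(1) by blast

lemma hcomp_closed: "x \<in> carrier A \<Longrightarrow> g \<in> carrier G \<Longrightarrow> hcomp x g \<in> carrier A"
  using hcomp_in component_closed by blast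

text \<open>Any finite decomposition will do, zero summands included, whereas
  \<open>direct_decomposition\<close> asks for the exact support. The rules below for zero, sums,
  multiples and products with a homogeneous element come from exhibiting such a
  decomposition.\<close>

lemma hcomp_unique:
  assumes "finite S" "S \<subseteq> carrier G" "\<And>g. g \<in> S \<Longrightarrow> c g \<in> \<Gamma> g" "x = (\<Oplus>\<^bsub>A\<^esub>g\<in>S. c g)" "g \<in> carrier G"
  shows "hcomp x g = (if g \<in> S then c g else \<zero>\<^bsub>A\<^esub>)"
proof -
  define c' where "c' = (\<lambda>g\<in>carrier G. if g \<in> S then c g else \<zero>\<^bsub>A\<^esub>)"
  have sub: "{g \<in> carrier G. c' g \<noteq> \<zero>\<^bsub>A\<^esub>} \<subseteq> S" by (auto simp: c'_def split: if_splits)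
  have cS: "c \<in> S \<rightarrow> carrier A" using assms(2,3) component_closed by blast
  have 1: "c' \<in> (\<Pi>\<^sub>E g\<in>carrier G. \<Gamma> g)" using assms(3) component_zero by (auto simp: c'_def)
  have 2: "finite {g \<in> carrier G. c' g \<noteq> \<zero>\<^bsub>A\<^esub>}" using sub assms(1) finite_subset by blast
  have "(\<Oplus>\<^bsub>A\<^esub>g\<in>{g \<in> carrier G. c' g \<noteq> \<zero>\<^bsub>A\<^esub>}. c' g) = (\<Oplus>\<^bsub>A\<^esub>g\<in>S. c g)"
    using assms(1,2) sub cS
    by (intro M.add.finprod_mono_neutral_cong_left) (auto simp: c'_def)
  then have 3: "x = (\<Oplus>\<^bsub>A\<^esub>g\<in>{g \<in> carrier G. c' g \<noteq> \<zero>\<^bsub>A\<^esub>}. c' g)" using assms(4) by simp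
  have "x \<in> carrier A" using assms(4) cS by simp
  then have "hcomp x = c'" using 1 2 3 direct_decomposition[of x] unfolding hcomp_def
    by (intro the1_equality) blast+
  then show ?thesis using assms(5) by (simp add: c'_def)
qed

lemma hcomp_sum:
  assumes "x \<in> carrier A" "finite S" "S \<subseteq> carrier G" "{g \<in> carrier G. hcomp x g \<noteq> \<zero>\<^bsub>A\<^esub>} \<subseteq> S"
  shows "(\<Oplus>\<^bsub>A\<^esub>g\<in>S. hcomp x g) = x"
proof -
  have "(\<Oplus>\<^bsub>A\<^esub>g\<in>{g \<in> carrier G. hcomp x g \<noteq> \<zero>\<^bsub>A\<^esub>}. hcomp x g) = (\<Oplus>\<^bsub>A\<^esub>g\<in>S. hcomp x g)"
    using assms hcomp_closed by (intro M.add.finprod_mono_neutral_cong_left) auto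
  then show ?thesis using hcomp_props(3)[OF assms(1)] by simp
qed

lemma hcomp_zero [simp]: "g \<in> carrier G \<Longrightarrow> hcomp \<zero>\<^bsub>A\<^esub> g = \<zero>\<^bsub>A\<^esub>"
  using hcomp_unique[of "{}" "\<lambda>_. \<zero>\<^bsub>A\<^esub>" "\<zero>\<^bsub>A\<^esub>" g] by simp

lemma hcomp_homogeneous:
  assumes "g \<in> carrier G" "x \<in> \<Gamma> g" "h \<in> carrier G"
  shows "hcomp x h = (if h = g then x else \<zero>\<^bsub>A\<^esub>)"
  using hcomp_unique[of "{g}" "\<lambda>_. x" x h] assms component_closed by simp

lemma hcomp_add:
  assumes "x \<in> carrier A" "y \<in> carrier A" "g \<in> carrier G"
  shows "hcomp (x \<oplus>\<^bsub>A\<^esub> y) g = hcomp x g \<oplus>\<^bsub>A\<^esub> hcomp y g"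
proof -
  define S where "S = {g \<in> carrier G. hcomp x g \<noteq> \<zero>\<^bsub>A\<^esub>} \<union> {g \<in> carrier G. hcomp y g \<noteq> \<zero>\<^bsub>A\<^esub>}"
  have S: "finite S" "S \<subseteq> carrier G" using assms hcomp_props(2) by (auto simp: S_def)
  have "(\<Oplus>\<^bsub>A\<^esub>g\<in>S. hcomp x g \<oplus>\<^bsub>A\<^esub> hcomp y g) = (\<Oplus>\<^bsub>A\<^esub>g\<in>S. hcomp x g) \<oplus>\<^bsub>A\<^esub> (\<Oplus>\<^bsub>A\<^esub>g\<in>S. hcomp y g)"
    using S assms hcomp_closed by (intro M.finsum_addf) auto
  also have "\<dots> = x \<oplus>\<^bsub>A\<^esub> y" using S assms by (subst (1 2) hcomp_sum) (auto simp: S_def)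
  finally have "hcomp (x \<oplus>\<^bsub>A\<^esub> y) g = (if g \<in> S then hcomp x g \<oplus>\<^bsub>A\<^esub> hcomp y g else \<zero>\<^bsub>A\<^esub>)"
    using S assms hcomp_in component_add
    by (intro hcomp_unique) auto
  then show ?thesis using assms by (auto simp: S_def)
qed

lemma hcomp_smult:
  assumes "x \<in> carrier A" "a \<in> carrier F" "g \<in> carrier G"
  shows "hcomp (a \<odot>\<^bsub>A\<^esub> x) g = a \<odot>\<^bsub>A\<^esub> hcomp x g"
proof -
  define S where "S = {g \<in> carrier G. hcomp x g \<noteq> \<zero>\<^bsub>A\<^esub>}"
  have S: "finite S" "S \<subseteq> carrier G" using assms hcomp_props(2) by (auto simp: S_def)
  have "a \<odot>\<^bsub>A\<^esub> (\<Oplus>\<^bsub>A\<^esub>g\<in>S. hcomp x g) = (\<Oplus>\<^bsub>A\<^esub>g\<in>S. a \<odot>\<^bsub>A\<^esub> hcomp x g)"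
    using S assms hcomp_closed by (intro finsum_smult_ldistr) auto
  also have "(\<Oplus>\<^bsub>A\<^esub>g\<in>S. hcomp x g) = x" using S assms by (subst hcomp_sum) (auto simp: S_def)
  finally have "hcomp (a \<odot>\<^bsub>A\<^esub> x) g = (if g \<in> S then a \<odot>\<^bsub>A\<^esub> hcomp x g else \<zero>\<^bsub>A\<^esub>)"
    using S assms hcomp_in component_smult
    by (intro hcomp_unique) auto
  then show ?thesis using assms by (auto simp: S_def)
qed

text \<open>Multiplication by an element of degree \<open>h\<close> translates degrees by
  \<open>h\<close>. So the decomposition of \<open>x\<close>, multiplied by \<open>a\<close> and
  reindexed along the translation, decomposes the product.\<close>

lemma hcomp_mult_left:
  assumes "x \<in> carrier A" "h \<in> carrier G" "a \<in> \<Gamma> h" "g \<in> carrier G"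
  shows "hcomp (a \<bullet> x) (h \<otimes>\<^bsub>G\<^esub> g) = a \<bullet> hcomp x g"
proof -
  define S where "S = {g \<in> carrier G. hcomp x g \<noteq> \<zero>\<^bsub>A\<^esub>}"
  have S: "finite S" "S \<subseteq> carrier G" using assms hcomp_props(2) by (auto simp: S_def)
  have a: "a \<in> carrier A" using assms component_closed by blast
  \<comment> \<open>Indexed by the degree \<open>k\<close> of the product, so the matching component
    of \<open>x\<close> sits in degree \<open>h\<close> inverse times \<open>k\<close>.\<close>
  let ?f = "\<lambda>k. a \<bullet> hcomp x (inv\<^bsub>G\<^esub> h \<otimes>\<^bsub>G\<^esub> k)"
  have cancel: "inv\<^bsub>G\<^esub> h \<otimes>\<^bsub>G\<^esub> (h \<otimes>\<^bsub>G\<^esub> k) = k" if "k \<in> carrier G" for k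
    using that assms by (simp add: grp.m_assoc[symmetric])
  have inj: "inj_on ((\<otimes>\<^bsub>G\<^esub>) h) S" using S assms by (auto simp: inj_on_def subset_iff)
  have "a \<bullet> (\<Oplus>\<^bsub>A\<^esub>g\<in>S. hcomp x g) = (\<Oplus>\<^bsub>A\<^esub>g\<in>S. a \<bullet> hcomp x g)"
    using S assms hcomp_closed a by (intro a_mult_finsum_right) auto
  also have "(\<Oplus>\<^bsub>A\<^esub>g\<in>S. hcomp x g) = x" using S assms by (subst hcomp_sum) (auto simp: S_def)
  also have "(\<Oplus>\<^bsub>A\<^esub>g\<in>S. a \<bullet> hcomp x g) = (\<Oplus>\<^bsub>A\<^esub>g\<in>S. ?f (h \<otimes>\<^bsub>G\<^esub> g))"
    using S assms a hcomp_closed cancel by (intro M.finsum_cong') (auto simp: subset_iff)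
  also have "\<dots> = (\<Oplus>\<^bsub>A\<^esub>k\<in>(\<otimes>\<^bsub>G\<^esub>) h ` S. ?f k)"
    using inj S assms a hcomp_closed by (intro M.finsum_reindex[symmetric]) auto
  finally have eq: "a \<bullet> x = (\<Oplus>\<^bsub>A\<^esub>k\<in>(\<otimes>\<^bsub>G\<^esub>) h ` S. ?f k)" .
  have "hcomp (a \<bullet> x) (h \<otimes>\<^bsub>G\<^esub> g) = (if h \<otimes>\<^bsub>G\<^esub> g \<in> (\<otimes>\<^bsub>G\<^esub>) h ` S then ?f (h \<otimes>\<^bsub>G\<^esub> g) else \<zero>\<^bsub>A\<^esub>)"
    using S assms eq
    by (intro hcomp_unique) (auto simp: cancel subset_iff intro!: component_mult hcomp_in)
  moreover have "h \<otimes>\<^bsub>G\<^esub> g \<in> (\<otimes>\<^bsub>G\<^esub>) h ` S \<longleftrightarrow> g \<in> S" using S assms by auto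
  ultimately show ?thesis using assms a cancel by (auto simp: S_def)
qed

lemma hcomp_mult_right:
  assumes "x \<in> carrier A" "h \<in> carrier G" "a \<in> \<Gamma> h" "g \<in> carrier G"
  shows "hcomp (x \<bullet> a) (g \<otimes>\<^bsub>G\<^esub> h) = hcomp x g \<bullet> a"
proof -
  define S where "S = {g \<in> carrier G. hcomp x g \<noteq> \<zero>\<^bsub>A\<^esub>}"
  have S: "finite S" "S \<subseteq> carrier G" using assms hcomp_props(2) by (auto simp: S_def)
  have a: "a \<in> carrier A" using assms component_closed by blast
  let ?f = "\<lambda>k. hcomp x (k \<otimes>\<^bsub>G\<^esub> inv\<^bsub>G\<^esub> h) \<bullet> a"
  have cancel: "(k \<otimes>\<^bsub>G\<^esub> h) \<otimes>\<^bsub>G\<^esub> inv\<^bsub>G\<^esub> h = k" if "k \<in> carrier G" for k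
    using that assms by (simp add: grp.m_assoc)
  have inj: "inj_on (\<lambda>k. k \<otimes>\<^bsub>G\<^esub> h) S" using S assms by (auto simp: inj_on_def subset_iff)
  have "(\<Oplus>\<^bsub>A\<^esub>g\<in>S. hcomp x g) \<bullet> a = (\<Oplus>\<^bsub>A\<^esub>g\<in>S. hcomp x g \<bullet> a)"
    using S assms hcomp_closed a by (intro a_mult_finsum_left) auto
  also have "(\<Oplus>\<^bsub>A\<^esub>g\<in>S. hcomp x g) = x" using S assms by (subst hcomp_sum) (auto simp: S_def)
  also have "(\<Oplus>\<^bsub>A\<^esub>g\<in>S. hcomp x g \<bullet> a) = (\<Oplus>\<^bsub>A\<^esub>g\<in>S. ?f (g \<otimes>\<^bsub>G\<^esub> h))"
    using S assms a hcomp_closed cancel by (intro M.finsum_cong') (auto simp: subset_iff)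
  also have "\<dots> = (\<Oplus>\<^bsub>A\<^esub>k\<in>(\<lambda>k. k \<otimes>\<^bsub>G\<^esub> h) ` S. ?f k)"
    using inj S assms a hcomp_closed by (intro M.finsum_reindex[symmetric]) auto
  finally have eq: "x \<bullet> a = (\<Oplus>\<^bsub>A\<^esub>k\<in>(\<lambda>k. k \<otimes>\<^bsub>G\<^esub> h) ` S. ?f k)" .
  have "hcomp (x \<bullet> a) (g \<otimes>\<^bsub>G\<^esub> h) = (if g \<otimes>\<^bsub>G\<^esub> h \<in> (\<lambda>k. k \<otimes>\<^bsub>G\<^esub> h) ` S then ?f (g \<otimes>\<^bsub>G\<^esub> h) else \<zero>\<^bsub>A\<^esub>)"
    using S assms eq
    by (intro hcomp_unique) (auto simp: cancel subset_iff intro!: component_mult hcomp_in)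
  moreover have "g \<otimes>\<^bsub>G\<^esub> h \<in> (\<lambda>k. k \<otimes>\<^bsub>G\<^esub> h) ` S \<longleftrightarrow> g \<in> S" using S assms by auto
  ultimately show ?thesis using assms a cancel by (auto simp: S_def)
qed

text \<open>Reduces a linear condition on all of \<open>A\<close> to homogeneous elements, where
  \<open>hcomp_mult_left\<close> and \<open>hcomp_mult_right\<close> apply.\<close>

lemma mem_submodule_if_homogeneous:
  assumes "submodule N F A" "\<And>g x. g \<in> carrier G \<Longrightarrow> x \<in> \<Gamma> g \<Longrightarrow> x \<in> N" "x \<in> carrier A"
  shows "x \<in> N"
proof -
  have "(\<Oplus>\<^bsub>A\<^esub>g\<in>{g \<in> carrier G. hcomp x g \<noteq> \<zero>\<^bsub>A\<^esub>}. hcomp x g) \<in> N"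
    using assms hcomp_in by (intro finsum_in_submodule) auto
  then show ?thesis using hcomp_props(3)[OF assms(3)] by simp
qed

lemma exists_hcomp_nonzero:
  assumes "x \<in> carrier A" "x \<noteq> \<zero>\<^bsub>A\<^esub>"
  obtains g where "g \<in> carrier G" "hcomp x g \<noteq> \<zero>\<^bsub>A\<^esub>"
proof (rule ccontr)
  assume "\<not> thesis"
  then have "{g \<in> carrier G. hcomp x g \<noteq> \<zero>\<^bsub>A\<^esub>} = {}" using that by blast
  then show False using hcomp_props(3)[OF assms(1)] assms(2) by (metis M.finsum_empty)
qed

text \<open>Replaces the span in the definition by a closure condition that can be tested on single
  elements.\<close>

lemma graded_subspace_iff:
  "graded_subspace F A G \<Gamma> I \<longleftrightarrow> submodule I F A \<and> (\<forall>x\<in>I. \<forall>g\<in>carrier G. hcomp x g \<in> I)"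
proof
  assume I: "graded_subspace F A G \<Gamma> I"
  then have sub: "submodule I F A" and eq: "I = lin_span F A (\<Union>g\<in>carrier G. I \<inter> \<Gamma> g)"
    unfolding graded_subspace_def by auto
  \<comment> \<open>The elements of \<open>I\<close> all of whose components stay in
    \<open>I\<close> form a subspace containing the generators of the span, hence all of
    \<open>I\<close>.\<close>
  let ?N = "{x \<in> I. \<forall>g\<in>carrier G. hcomp x g \<in> I}"
  have c: "I \<subseteq> carrier A" using submoduleE(1)[OF sub] .
  have um: "\<ominus>\<^bsub>A\<^esub> x = (\<ominus>\<^bsub>F\<^esub> \<one>\<^bsub>F\<^esub>) \<odot>\<^bsub>A\<^esub> x" if "x \<in> carrier A" for x
    using that by (simp add: smult_l_minus)
  have "submodule ?N F A"
  proof (rule submoduleI)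
    show "?N \<subseteq> carrier A" using c by auto
    show "\<zero>\<^bsub>A\<^esub> \<in> ?N" using submodule_zero[OF sub] by simp
    show "x \<oplus>\<^bsub>A\<^esub> y \<in> ?N" if "x \<in> ?N" "y \<in> ?N" for x y
      using that c submoduleE(5)[OF sub] by (auto simp: hcomp_add subset_iff)
    show sm: "a \<odot>\<^bsub>A\<^esub> x \<in> ?N" if "a \<in> carrier F" "x \<in> ?N" for a x
      using that c submoduleE(4)[OF sub] by (auto simp: hcomp_smult subset_iff)
    show "\<ominus>\<^bsub>A\<^esub> x \<in> ?N" if "x \<in> ?N" for x
    proof -
      have "x \<in> carrier A" using that c by blast
      then show ?thesis using sm[OF _ that, of "\<ominus>\<^bsub>F\<^esub> \<one>\<^bsub>F\<^esub>"] um[of x] by simp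
    qed
  qed
  moreover have "(\<Union>g\<in>carrier G. I \<inter> \<Gamma> g) \<subseteq> ?N"
  proof (rule subsetI, elim UN_E IntE, intro CollectI)
    fix x g assume "x \<in> I" "g \<in> carrier G" "x \<in> \<Gamma> g"
    moreover have "hcomp x h = x \<or> hcomp x h = \<zero>\<^bsub>A\<^esub>" if "h \<in> carrier G" for h
      using hcomp_homogeneous[OF \<open>g \<in> carrier G\<close> \<open>x \<in> \<Gamma> g\<close> that] by presburger
    ultimately show "x \<in> I \<and> (\<forall>h\<in>carrier G. hcomp x h \<in> I)"
      using submodule_zero[OF sub] by metis
  qed
  ultimately have "I \<subseteq> ?N" by (rule subset_trans[OF equalityD1[OF eq] lin_span_subset])
  then show "submodule I F A \<and> (\<forall>x\<in>I. \<forall>g\<in>carrier G. hcomp x g \<in> I)" using sub by auto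
next
  assume I: "submodule I F A \<and> (\<forall>x\<in>I. \<forall>g\<in>carrier G. hcomp x g \<in> I)"
  let ?U = "\<Union>g\<in>carrier G. I \<inter> \<Gamma> g"
  have c: "I \<subseteq> carrier A" using submoduleE(1) I by blast
  have "I \<subseteq> lin_span F A ?U"
  proof
    fix x assume x: "x \<in> I"
    have "x \<in> N" if N: "submodule N F A" "?U \<subseteq> N" for N
    proof -
      have "(\<Oplus>\<^bsub>A\<^esub>g\<in>{g \<in> carrier G. hcomp x g \<noteq> \<zero>\<^bsub>A\<^esub>}. hcomp x g) \<in> N"
      proof (rule finsum_in_submodule[OF N(1)])
        fix g assume "g \<in> {g \<in> carrier G. hcomp x g \<noteq> \<zero>\<^bsub>A\<^esub>}"
        then have "g \<in> carrier G" "hcomp x g \<in> I" "hcomp x g \<in> \<Gamma> g" using x I c hcomp_in by auto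
        then show "hcomp x g \<in> N" using N(2) by blast
      qed
      then show ?thesis using hcomp_props(3) x c by auto
    qed
    then show "x \<in> lin_span F A ?U" unfolding lin_span_def by blast
  qed
  moreover have "lin_span F A ?U \<subseteq> I" using I by (intro lin_span_subset) auto
  ultimately show "graded_subspace F A G \<Gamma> I" unfolding graded_subspace_def using I by blast
qed

lemma subspaceI:
  assumes "I \<subseteq> carrier A" "\<zero>\<^bsub>A\<^esub> \<in> I" "\<And>x y. x \<in> I \<Longrightarrow> y \<in> I \<Longrightarrow> x \<oplus>\<^bsub>A\<^esub> y \<in> I"
    "\<And>a x. a \<in> carrier F \<Longrightarrow> x \<in> I \<Longrightarrow> a \<odot>\<^bsub>A\<^esub> x \<in> I"
  shows "submodule I F A"
proof (rule submoduleI)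
  show "\<ominus>\<^bsub>A\<^esub> x \<in> I" if "x \<in> I" for x
    using that assms(1) assms(4)[of "\<ominus>\<^bsub>F\<^esub> \<one>\<^bsub>F\<^esub>" x] by (auto simp: smult_l_minus subset_iff)
qed (use assms in auto)

end

section \<open>Graded-simple algebras with descending chain condition\<close>

context graded_algebra
begin

lemma graded_left_ideal_iff:
  "graded_left_ideal F A G \<Gamma> I \<longleftrightarrow>
     submodule I F A \<and> (\<forall>x\<in>I. \<forall>g\<in>carrier G. hcomp x g \<in> I) \<and> (\<forall>a\<in>carrier A. \<forall>x\<in>I. a \<bullet> x \<in> I)"
  unfolding graded_left_ideal_def graded_subspace_iff by blast

lemma graded_ideal_iff:
  "graded_ideal F A G \<Gamma> I \<longleftrightarrow>
     submodule I F A \<and> (\<forall>x\<in>I. \<forall>g\<in>carrier G. hcomp x g \<in> I) \<and>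
     (\<forall>a\<in>carrier A. \<forall>x\<in>I. a \<bullet> x \<in> I \<and> x \<bullet> a \<in> I)"
  unfolding graded_ideal_def graded_subspace_iff by blast

lemma graded_left_ideal_carrier: "graded_left_ideal F A G \<Gamma> (carrier A)"
  using carrier_is_submodule hcomp_closed by (auto simp: graded_left_ideal_iff)

text \<open>Right multiplication by a homogeneous element commutes with left multiplications and
  shifts degrees. The images are compared with a minimal left ideal in order to solve equations in
  it.\<close>

lemma graded_left_ideal_mult_right:
  assumes "graded_left_ideal F A G \<Gamma> I" "h \<in> carrier G" "z \<in> \<Gamma> h"
  shows "graded_left_ideal F A G \<Gamma> ((\<lambda>x. x \<bullet> z) ` I)"
proof -
  have sub: "submodule I F A" and hcompI: "\<And>x g. x \<in> I \<Longrightarrow> g \<in> carrier G \<Longrightarrow> hcomp x g \<in> I"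
    and left: "\<And>a x. a \<in> carrier A \<Longrightarrow> x \<in> I \<Longrightarrow> a \<bullet> x \<in> I"
    using assms(1) unfolding graded_left_ideal_iff by auto
  have c: "x \<in> carrier A" if "x \<in> I" for x using submoduleE(1)[OF sub] that by blast
  have z: "z \<in> carrier A" using assms component_closed by blast
  have "submodule ((\<lambda>x. x \<bullet> z) ` I) F A"
  proof (rule subspaceI)
    show "\<zero>\<^bsub>A\<^esub> \<in> (\<lambda>x. x \<bullet> z) ` I"
      using submodule_zero[OF sub] z by (intro image_eqI[of _ _ "\<zero>\<^bsub>A\<^esub>"]) auto
    show "x \<oplus>\<^bsub>A\<^esub> y \<in> (\<lambda>x. x \<bullet> z) ` I" if "x \<in> (\<lambda>x. x \<bullet> z) ` I" "y \<in> (\<lambda>x. x \<bullet> z) ` I" for x y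
    proof -
      obtain x' y' where *: "x' \<in> I" "y' \<in> I" "x = x' \<bullet> z" "y = y' \<bullet> z" using \<open>x \<in> _\<close> \<open>y \<in> _\<close> by auto
      then have "x \<oplus>\<^bsub>A\<^esub> y = (x' \<oplus>\<^bsub>A\<^esub> y') \<bullet> z" using c z by (simp add: a_mult_distl)
      then show ?thesis using * submoduleE(5)[OF sub] by blast
    qed
    show "a \<odot>\<^bsub>A\<^esub> x \<in> (\<lambda>x. x \<bullet> z) ` I" if "a \<in> carrier F" "x \<in> (\<lambda>x. x \<bullet> z) ` I" for a x
    proof -
      obtain x' where *: "x' \<in> I" "x = x' \<bullet> z" using \<open>x \<in> _\<close> by auto
      then have "a \<odot>\<^bsub>A\<^esub> x = (a \<odot>\<^bsub>A\<^esub> x') \<bullet> z" using c z that by (simp add: a_smult_mult_left)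
      then show ?thesis using * that submoduleE(4)[OF sub] by blast
    qed
  qed (use c z in auto)
  moreover have "hcomp (x \<bullet> z) g \<in> (\<lambda>x. x \<bullet> z) ` I" if "x \<in> I" "g \<in> carrier G" for x g
  proof -
    have "g = (g \<otimes>\<^bsub>G\<^esub> inv\<^bsub>G\<^esub> h) \<otimes>\<^bsub>G\<^esub> h" using that assms by (simp add: grp.m_assoc)
    then have "hcomp (x \<bullet> z) g = hcomp x (g \<otimes>\<^bsub>G\<^esub> inv\<^bsub>G\<^esub> h) \<bullet> z"
      using hcomp_mult_right[of x h z "g \<otimes>\<^bsub>G\<^esub> inv\<^bsub>G\<^esub> h"] c that assms by simp
    then show ?thesis using hcompI that assms by simp
  qed
  moreover have "a \<bullet> (x \<bullet> z) \<in> (\<lambda>x. x \<bullet> z) ` I" if "x \<in> I" "a \<in> carrier A" for x a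
    using that left c z by (intro image_eqI[of _ _ "a \<bullet> x"]) (auto simp: a_mult_assoc)
  ultimately show ?thesis unfolding graded_left_ideal_iff by auto
qed

text \<open>Since \<open>u i\<close> is homogeneous, \<open>x \<bullet> u i\<close> vanishes only if
  every component of \<open>x\<close> is annihilated. With \<open>I = carrier A\<close> these are
  the ideals whose descent bounds the basis.\<close>

lemma graded_left_ideal_annihilator:
  assumes "graded_left_ideal F A G \<Gamma> I" "\<And>i. i \<in> S \<Longrightarrow> \<exists>h\<in>carrier G. u i \<in> \<Gamma> h"
  shows "graded_left_ideal F A G \<Gamma> {x \<in> I. \<forall>i\<in>S. x \<bullet> u i = \<zero>\<^bsub>A\<^esub>}"
proof -
  have sub: "submodule I F A" and hcompI: "\<And>x g. x \<in> I \<Longrightarrow> g \<in> carrier G \<Longrightarrow> hcomp x g \<in> I"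
    and left: "\<And>a x. a \<in> carrier A \<Longrightarrow> x \<in> I \<Longrightarrow> a \<bullet> x \<in> I"
    using assms(1) unfolding graded_left_ideal_iff by auto
  have c: "x \<in> carrier A" if "x \<in> I" for x using submoduleE(1)[OF sub] that by blast
  have u: "u i \<in> carrier A" if "i \<in> S" for i using assms(2) component_closed that by blast
  have "submodule {x \<in> I. \<forall>i\<in>S. x \<bullet> u i = \<zero>\<^bsub>A\<^esub>} F A"
    using c u submodule_zero[OF sub] submoduleE(4,5)[OF sub]
    by (intro subspaceI) (auto simp: a_mult_distl a_smult_mult_left)
  moreover have "hcomp x g \<bullet> u i = \<zero>\<^bsub>A\<^esub>" if "x \<in> I" "g \<in> carrier G" "i \<in> S" "x \<bullet> u i = \<zero>\<^bsub>A\<^esub>" for x g i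
  proof -
    obtain h where h: "h \<in> carrier G" "u i \<in> \<Gamma> h" using assms(2) \<open>i \<in> S\<close> by blast
    then have "hcomp x g \<bullet> u i = hcomp (x \<bullet> u i) (g \<otimes>\<^bsub>G\<^esub> h)"
      using hcomp_mult_right[OF c[OF that(1)] h that(2)] by simp
    then show ?thesis using h that by simp
  qed
  ultimately show ?thesis using hcompI left c u by (auto simp: graded_left_ideal_iff a_mult_assoc)
qed

lemma middle_annihilator_submodule:
  assumes "a \<in> carrier A" "b \<in> carrier A"
  shows "submodule {r \<in> carrier A. a \<bullet> (r \<bullet> b) = \<zero>\<^bsub>A\<^esub>} F A"
  using assms
  by (intro subspaceI) (auto simp: a_mult_distl a_mult_distr a_smult_mult_left a_smult_mult_right)

end

section \<open>Graded primeness and minimal graded left ideals\<close>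

locale graded_simple_artinian = graded_algebra F A G \<Gamma>
  for F (structure) and A (structure) and G (structure) and \<Gamma> +
  assumes simple: "graded_simple F A G \<Gamma>"
    and dcc: "dcc_graded_left_ideals F A G \<Gamma>"
begin

text \<open>The elements that kill \<open>A\<close> by left multiplication form a graded ideal. It
  is proper because some product is nonzero, so simplicity leaves only zero.\<close>

lemma annihilator_zero:
  assumes "x \<in> carrier A" "\<And>r. r \<in> carrier A \<Longrightarrow> x \<bullet> r = \<zero>\<^bsub>A\<^esub>"
  shows "x = \<zero>\<^bsub>A\<^esub>"
proof -
  let ?J = "{x \<in> carrier A. \<forall>r\<in>carrier A. x \<bullet> r = \<zero>\<^bsub>A\<^esub>}"
  have "submodule ?J F A"
    by (intro subspaceI) (auto simp: a_mult_distl a_smult_mult_left)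
  moreover have "hcomp y g \<bullet> r = \<zero>\<^bsub>A\<^esub>" if y: "y \<in> ?J" and g: "g \<in> carrier G" and r: "r \<in> carrier A" for y g r
  proof -
    have yc: "y \<in> carrier A" "hcomp y g \<in> carrier A" using y g hcomp_closed by auto
    have "r \<in> {r \<in> carrier A. hcomp y g \<bullet> r = \<zero>\<^bsub>A\<^esub>}"
    proof (rule mem_submodule_if_homogeneous[OF _ _ r])
      show "submodule {r \<in> carrier A. hcomp y g \<bullet> r = \<zero>\<^bsub>A\<^esub>} F A"
        using yc by (intro subspaceI) (auto simp: a_mult_distr a_smult_mult_right)
      fix h s assume h: "h \<in> carrier G" "s \<in> \<Gamma> h"
      then have s: "s \<in> carrier A" using component_closed by blast
      have "hcomp y g \<bullet> s = hcomp (y \<bullet> s) (g \<otimes>\<^bsub>G\<^esub> h)" using hcomp_mult_right[OF yc(1) h g] by simp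
      also have "\<dots> = \<zero>\<^bsub>A\<^esub>" using y s g h by simp
      finally show "s \<in> {r \<in> carrier A. hcomp y g \<bullet> r = \<zero>\<^bsub>A\<^esub>}" using s by simp
    qed
    then show ?thesis by simp
  qed
  ultimately have "graded_ideal F A G \<Gamma> ?J"
    unfolding graded_ideal_iff by (auto simp: hcomp_closed a_mult_assoc)
  then have "?J = {\<zero>\<^bsub>A\<^esub>} \<or> ?J = carrier A" using simple unfolding graded_simple_def by blast
  moreover have "?J \<noteq> carrier A" using simple unfolding graded_simple_def by blast
  ultimately have "?J = {\<zero>\<^bsub>A\<^esub>}" by blast
  moreover have "x \<in> ?J" using assms by blast
  ultimately show ?thesis by blast
qed

text \<open>For fixed \<open>a\<close>, the \<open>x\<close> with
  \<open>a \<bullet> (r \<bullet> x)\<close> zero for all \<open>r\<close> form an ideal, which is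
  graded because \<open>a\<close> is homogeneous. It is therefore zero or everything.\<close>

lemma graded_prime:
  assumes "g \<in> carrier G" "a \<in> \<Gamma> g" "b \<in> carrier A" "\<And>r. r \<in> carrier A \<Longrightarrow> a \<bullet> (r \<bullet> b) = \<zero>\<^bsub>A\<^esub>"
  shows "a = \<zero>\<^bsub>A\<^esub> \<or> b = \<zero>\<^bsub>A\<^esub>"
proof -
  have a: "a \<in> carrier A" using assms component_closed by blast
  let ?J = "{x \<in> carrier A. \<forall>r\<in>carrier A. a \<bullet> (r \<bullet> x) = \<zero>\<^bsub>A\<^esub>}"
  have "submodule ?J F A"
    using a by (intro subspaceI) (auto simp: a_mult_distr a_smult_mult_right)
  moreover have "a \<bullet> (r \<bullet> hcomp y k) = \<zero>\<^bsub>A\<^esub>"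
    if y: "y \<in> ?J" and k: "k \<in> carrier G" and r: "r \<in> carrier A" for y k r
  proof -
    have yc: "y \<in> carrier A" "hcomp y k \<in> carrier A" using y k hcomp_closed by auto
    have "r \<in> {r \<in> carrier A. a \<bullet> (r \<bullet> hcomp y k) = \<zero>\<^bsub>A\<^esub>}"
    proof (rule mem_submodule_if_homogeneous[OF _ _ r])
      show "submodule {r \<in> carrier A. a \<bullet> (r \<bullet> hcomp y k) = \<zero>\<^bsub>A\<^esub>} F A"
        using a yc by (intro middle_annihilator_submodule)
      fix h s assume h: "h \<in> carrier G" "s \<in> \<Gamma> h"
      then have s: "s \<in> carrier A" using component_closed by blast
      have as: "a \<bullet> s \<in> \<Gamma> (g \<otimes>\<^bsub>G\<^esub> h)" using assms h component_mult by blast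
      have "a \<bullet> (s \<bullet> hcomp y k) = hcomp (a \<bullet> s \<bullet> y) (g \<otimes>\<^bsub>G\<^esub> h \<otimes>\<^bsub>G\<^esub> k)"
        using hcomp_mult_left[OF yc(1) _ as k] assms(1) h a s yc by (simp add: a_mult_assoc)
      also have "a \<bullet> s \<bullet> y = \<zero>\<^bsub>A\<^esub>" using y s a by (simp add: a_mult_assoc)
      finally show "s \<in> {r \<in> carrier A. a \<bullet> (r \<bullet> hcomp y k) = \<zero>\<^bsub>A\<^esub>}" using s assms h k by simp
    qed
    then show ?thesis by simp
  qed
  moreover have "a \<bullet> (r \<bullet> (y \<bullet> s)) = \<zero>\<^bsub>A\<^esub>" "a \<bullet> (r \<bullet> (s \<bullet> y)) = \<zero>\<^bsub>A\<^esub>"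
    if "y \<in> ?J" "r \<in> carrier A" "s \<in> carrier A" for y r s
  proof -
    have y: "y \<in> carrier A" "a \<bullet> (r \<bullet> y) = \<zero>\<^bsub>A\<^esub>" "a \<bullet> ((r \<bullet> s) \<bullet> y) = \<zero>\<^bsub>A\<^esub>" using that by auto
    have "a \<bullet> (r \<bullet> (y \<bullet> s)) = (a \<bullet> (r \<bullet> y)) \<bullet> s" using that(2,3) y(1) a by (simp add: a_mult_assoc)
    then show "a \<bullet> (r \<bullet> (y \<bullet> s)) = \<zero>\<^bsub>A\<^esub>" using that y by simp
    show "a \<bullet> (r \<bullet> (s \<bullet> y)) = \<zero>\<^bsub>A\<^esub>" using that y by (simp add: a_mult_assoc)
  qed
  ultimately have "graded_ideal F A G \<Gamma> ?J"
    unfolding graded_ideal_iff by (auto simp: hcomp_closed)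
  then have J: "?J = {\<zero>\<^bsub>A\<^esub>} \<or> ?J = carrier A" using simple unfolding graded_simple_def by blast
  have "b \<in> ?J" using assms by blast
  \<comment> \<open>If the ideal is everything, all \<open>a \<bullet> r \<bullet> s\<close> vanish.
    So \<open>annihilator_zero\<close> is used twice, for \<open>a \<bullet> r\<close> and then for
    \<open>a\<close>.\<close>
  moreover have "a = \<zero>\<^bsub>A\<^esub>" if J: "?J = carrier A"
  proof (rule annihilator_zero[OF a])
    fix r assume r: "r \<in> carrier A"
    show "a \<bullet> r = \<zero>\<^bsub>A\<^esub>"
    proof (rule annihilator_zero)
      fix s assume "s \<in> carrier A"
      then have "s \<in> ?J" using J by simp
      then show "a \<bullet> r \<bullet> s = \<zero>\<^bsub>A\<^esub>" using r a by (simp add: a_mult_assoc)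
    qed (use a r in simp)
  qed
  ultimately show ?thesis using J by blast
qed

text \<open>Vanishing of \<open>a \<bullet> (r \<bullet> b)\<close> is a linear condition on
  \<open>r\<close>. If it held for homogeneous \<open>r\<close> it would hold for all
  \<open>r\<close>, against \<open>graded_prime\<close>.\<close>

lemma exists_homogeneous_middle:
  assumes "g \<in> carrier G" "a \<in> \<Gamma> g" "a \<noteq> \<zero>\<^bsub>A\<^esub>" "b \<in> carrier A" "b \<noteq> \<zero>\<^bsub>A\<^esub>"
  obtains h r where "h \<in> carrier G" "r \<in> \<Gamma> h" "a \<bullet> (r \<bullet> b) \<noteq> \<zero>\<^bsub>A\<^esub>"
proof (rule ccontr)
  note witness = that
  assume "\<not> thesis"
  then have *: "a \<bullet> (r \<bullet> b) = \<zero>\<^bsub>A\<^esub>" if "h \<in> carrier G" "r \<in> \<Gamma> h" for h r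
    using witness[OF that] by blast
  have a: "a \<in> carrier A" using assms component_closed by blast
  have "a \<bullet> (r \<bullet> b) = \<zero>\<^bsub>A\<^esub>" if r: "r \<in> carrier A" for r
  proof -
    have "r \<in> {r \<in> carrier A. a \<bullet> (r \<bullet> b) = \<zero>\<^bsub>A\<^esub>}"
    proof (rule mem_submodule_if_homogeneous[OF middle_annihilator_submodule[OF a assms(4)] _ r])
      fix h x assume "h \<in> carrier G" "x \<in> \<Gamma> h"
      then show "x \<in> {r \<in> carrier A. a \<bullet> (r \<bullet> b) = \<zero>\<^bsub>A\<^esub>}"
        using * component_closed by simp
    qed
    then show ?thesis by simp
  qed
  then show False using graded_prime[OF assms(1,2,4)] assms(3,5) by blast
qed

text \<open>Stated for an arbitrary family, because the bases are later found as minimal members of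
  families of annihilators. A family without minimal member yields a strictly descending sequence by
  dependent choice.\<close>

lemma dcc_minimal:
  assumes "\<S> \<noteq> {}" "\<And>I. I \<in> \<S> \<Longrightarrow> graded_left_ideal F A G \<Gamma> I"
  shows "\<exists>I\<in>\<S>. \<forall>J\<in>\<S>. \<not> J \<subset> I"
proof (rule ccontr)
  assume "\<not> ?thesis"
  then have "\<forall>I\<in>\<S>. \<exists>J\<in>\<S>. J \<subset> I" by blast
  then have *: "\<exists>J. J \<in> \<S> \<and> J \<subset> I" if "I \<in> \<S>" for I using that by blast
  have "\<exists>f :: nat \<Rightarrow> _. \<forall>n. f n \<in> \<S> \<and> f (Suc n) \<subset> f n"
    by (rule dependent_nat_choice) (use * assms(1) in blast)+
  then obtain f :: "nat \<Rightarrow> _" where f: "\<And>n. f n \<in> \<S>" "\<And>n. f (Suc n) \<subset> f n"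
    by blast
  then have "\<exists>N. \<forall>n\<ge>N. f n = f N"
    using dcc assms(2) unfolding dcc_graded_left_ideals_def by blast
  then obtain N where "f (Suc N) = f N" by (meson le_SucI le_refl)
  then show False using f(2)[of N] by blast
qed

text \<open>A graded version of Brauer's lemma. The last clause records minimality: every nonzero
  homogeneous element of \<open>A \<bullet> e\<close> generates this left ideal, so \<open>e\<close>
  is a left multiple of it.\<close>

lemma exists_minimal_idempotent:
  obtains e where "e \<in> \<Gamma> \<one>\<^bsub>G\<^esub>" "e \<noteq> \<zero>\<^bsub>A\<^esub>" "e \<bullet> e = e"
    "\<And>g x. g \<in> carrier G \<Longrightarrow> x \<in> \<Gamma> g \<Longrightarrow> x \<bullet> e = x \<Longrightarrow> x \<noteq> \<zero>\<^bsub>A\<^esub> \<Longrightarrow> \<exists>y\<in>\<Gamma> (inv\<^bsub>G\<^esub> g). e \<bullet> y = y \<and> y \<bullet> x = e"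
proof -
  let ?S = "{I. graded_left_ideal F A G \<Gamma> I \<and> I \<noteq> {\<zero>\<^bsub>A\<^esub>}}"
  have "carrier A \<in> ?S" using simple graded_left_ideal_carrier unfolding graded_simple_def
    by (metis (mono_tags, lifting) a_mult_zero_left mem_Collect_eq singletonD M.zero_closed)
  then have "\<exists>L\<in>?S. \<forall>J\<in>?S. \<not> J \<subset> L" by (intro dcc_minimal) blast+
  then obtain L where L: "graded_left_ideal F A G \<Gamma> L" "L \<noteq> {\<zero>\<^bsub>A\<^esub>}"
    and min: "\<And>J. graded_left_ideal F A G \<Gamma> J \<Longrightarrow> J \<noteq> {\<zero>\<^bsub>A\<^esub>} \<Longrightarrow> J \<subseteq> L \<Longrightarrow> J = L"
    by blast
  have sub: "submodule L F A" and hcompL: "\<And>x g. x \<in> L \<Longrightarrow> g \<in> carrier G \<Longrightarrow> hcomp x g \<in> L"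
    and left: "\<And>a x. a \<in> carrier A \<Longrightarrow> x \<in> L \<Longrightarrow> a \<bullet> x \<in> L"
    using L(1) unfolding graded_left_ideal_iff by auto
  have c: "x \<in> carrier A" if "x \<in> L" for x using submoduleE(1)[OF sub] that by blast
  have "\<zero>\<^bsub>A\<^esub> \<in> L" using submodule_zero[OF sub] .
  then obtain x0 where "x0 \<in> L" "x0 \<noteq> \<zero>\<^bsub>A\<^esub>" using L(2) by blast
  then obtain g0 where "g0 \<in> carrier G" "hcomp x0 g0 \<noteq> \<zero>\<^bsub>A\<^esub>" using exists_hcomp_nonzero c by blast
  then obtain x g where x: "x \<in> L" "g \<in> carrier G" "x \<in> \<Gamma> g" "x \<noteq> \<zero>\<^bsub>A\<^esub>"
    using hcompL hcomp_in c \<open>x0 \<in> L\<close> by blast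
  \<comment> \<open>Primeness yields \<open>z = r \<bullet> x\<close> in \<open>L\<close> such that
    right multiplication by \<open>z\<close> does not kill \<open>L\<close>; minimality then gives
    \<open>L \<bullet> z = L\<close>.\<close>
  obtain h r where r: "h \<in> carrier G" "r \<in> \<Gamma> h" "x \<bullet> (r \<bullet> x) \<noteq> \<zero>\<^bsub>A\<^esub>"
    using exists_homogeneous_middle[OF x(2,3,4) c[OF x(1)] x(4)] .
  define z where "z = r \<bullet> x"
  define k where "k = h \<otimes>\<^bsub>G\<^esub> g"
  have k: "k \<in> carrier G" using r x by (simp add: k_def)
  have z: "z \<in> \<Gamma> k" "z \<in> L" "x \<bullet> z \<noteq> \<zero>\<^bsub>A\<^esub>"
    using r x left component_mult component_closed by (auto simp: z_def k_def)
  have zc: "z \<in> carrier A" using z c by blast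
  have "(\<lambda>l. l \<bullet> z) ` L = L"
  proof (rule min)
    show "graded_left_ideal F A G \<Gamma> ((\<lambda>l. l \<bullet> z) ` L)"
      using graded_left_ideal_mult_right L k z by blast
  qed (use z x left c in auto)
  then obtain e0 where e0: "e0 \<in> L" "e0 \<bullet> z = z" using z by (metis (no_types, lifting) imageE)
  \<comment> \<open>Passing to the component of degree one keeps \<open>e \<bullet> z = z\<close>,
    because \<open>z\<close> is homogeneous.\<close>
  define e where "e = hcomp e0 \<one>\<^bsub>G\<^esub>"
  have e: "e \<in> L" "e \<in> \<Gamma> \<one>\<^bsub>G\<^esub>" using e0 hcompL hcomp_in c by (auto simp: e_def)
  have ec: "e \<in> carrier A" using e c by blast
  have ez: "e \<bullet> z = z"
    using hcomp_mult_right[of e0 k z "\<one>\<^bsub>G\<^esub>"] hcomp_homogeneous[of k z k] e0 c k z by (simp add: e_def)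
  have zn: "z \<noteq> \<zero>\<^bsub>A\<^esub>" using z x c by auto
  have en: "e \<noteq> \<zero>\<^bsub>A\<^esub>" using ez zn zc by auto
  let ?N = "{y \<in> L. \<forall>i\<in>{z}. y \<bullet> i = \<zero>\<^bsub>A\<^esub>}"
  \<comment> \<open>The annihilator of \<open>z\<close> in \<open>L\<close> is a graded left ideal
    missing \<open>x\<close>, hence zero. Idempotency follows because it contains the difference of
    \<open>e \<bullet> e\<close> and \<open>e\<close>.\<close>
  have "?N = {\<zero>\<^bsub>A\<^esub>}"
  proof (rule ccontr)
    assume "?N \<noteq> {\<zero>\<^bsub>A\<^esub>}"
    then have "?N = L" using graded_left_ideal_annihilator[OF L(1), of "{z}" "\<lambda>i. i"] k z
      by (intro min) auto
    then show False using x z by blast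
  qed
  moreover have "e \<bullet> e \<ominus>\<^bsub>A\<^esub> e \<in> ?N"
  proof -
    have "e \<bullet> e \<ominus>\<^bsub>A\<^esub> e \<in> L"
      using left[OF ec e(1)] e submoduleE(3,5)[OF sub] by (simp add: a_minus_def)
    moreover have "(e \<bullet> e \<ominus>\<^bsub>A\<^esub> e) \<bullet> z = \<zero>\<^bsub>A\<^esub>"
      using ec zc ez by (simp add: a_mult_diff_left a_mult_assoc diff_eq_zero_iff)
    ultimately show ?thesis by simp
  qed
  ultimately have ee: "e \<bullet> e = e" using diff_eq_zero_iff[of "e \<bullet> e" e] ec by blast
  have "\<exists>y\<in>\<Gamma> (inv\<^bsub>G\<^esub> p). e \<bullet> y = y \<and> y \<bullet> w = e"
    if p: "p \<in> carrier G" and w: "w \<in> \<Gamma> p" "w \<bullet> e = w" "w \<noteq> \<zero>\<^bsub>A\<^esub>" for p w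
  proof -
    have wc: "w \<in> carrier A" using p w component_closed by blast
    have wL: "w \<in> L" using left[OF wc e(1)] w by simp
    have "(\<lambda>l. l \<bullet> w) ` carrier A = L"
    proof (rule min)
      show "graded_left_ideal F A G \<Gamma> ((\<lambda>l. l \<bullet> w) ` carrier A)"
        using graded_left_ideal_mult_right graded_left_ideal_carrier p w by blast
      show "(\<lambda>l. l \<bullet> w) ` carrier A \<noteq> {\<zero>\<^bsub>A\<^esub>}"
      proof
        assume "(\<lambda>l. l \<bullet> w) ` carrier A = {\<zero>\<^bsub>A\<^esub>}"
        then have "r \<bullet> w = \<zero>\<^bsub>A\<^esub>" if "r \<in> carrier A" for r using that by blast
        then show False using graded_prime[OF p w(1) wc] w(3) wc by simp
      qed
    qed (use wL left in auto)
    then obtain y0 where y0: "y0 \<in> carrier A" "y0 \<bullet> w = e" using e by (metis (no_types, lifting) imageE)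
    \<comment> \<open>Since \<open>w\<close> has degree \<open>p\<close> and \<open>e\<close> has
      degree one, only this component of \<open>y0\<close> contributes to
      \<open>y0 \<bullet> w = e\<close>.\<close>
    define y where "y = hcomp y0 (inv\<^bsub>G\<^esub> p)"
    have y: "y \<in> \<Gamma> (inv\<^bsub>G\<^esub> p)" "y \<in> carrier A" using y0 hcomp_in hcomp_closed p by (auto simp: y_def)
    have yw: "y \<bullet> w = e"
      using hcomp_mult_right[OF y0(1) p w(1), of "inv\<^bsub>G\<^esub> p"] hcomp_homogeneous[of "\<one>\<^bsub>G\<^esub>" e "\<one>\<^bsub>G\<^esub>"] y0 p e
      by (simp add: y_def)
    have "e \<bullet> y \<in> \<Gamma> (inv\<^bsub>G\<^esub> p)" using component_mult[of "\<one>\<^bsub>G\<^esub>" "inv\<^bsub>G\<^esub> p" e y] e y p by simp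
    moreover have "e \<bullet> (e \<bullet> y) = e \<bullet> y" using ec y ee by (simp add: a_mult_assoc[symmetric])
    moreover have "(e \<bullet> y) \<bullet> w = e" using ec y wc yw ee by (simp add: a_mult_assoc)
    ultimately show ?thesis by blast
  qed
  then show thesis using that e en ee by blast
qed

end

section \<open>Involutions and the hermitian form\<close>

locale graded_simple_involution = graded_simple_artinian F A G \<Gamma> + comm: comm_group G
  for F (structure) and A (structure) and G (structure) and \<Gamma> +
  fixes \<phi>
  assumes inv_A: "involution F A \<phi>"
    and deg_pres: "degree_preserving G \<Gamma> \<phi>"
begin

lemma invol_closed [simp, intro]: "x \<in> carrier A \<Longrightarrow> \<phi> x \<in> carrier A"
  and invol_add: "x \<in> carrier A \<Longrightarrow> y \<in> carrier A \<Longrightarrow> \<phi> (x \<oplus>\<^bsub>A\<^esub> y) = \<phi> x \<oplus>\<^bsub>A\<^esub> \<phi> y"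
  and invol_smult: "a \<in> carrier F \<Longrightarrow> x \<in> carrier A \<Longrightarrow> \<phi> (a \<odot>\<^bsub>A\<^esub> x) = a \<odot>\<^bsub>A\<^esub> \<phi> x"
  and invol_mult: "x \<in> carrier A \<Longrightarrow> y \<in> carrier A \<Longrightarrow> \<phi> (x \<bullet> y) = \<phi> y \<bullet> \<phi> x"
  and invol_invol [simp]: "x \<in> carrier A \<Longrightarrow> \<phi> (\<phi> x) = x"
  using inv_A unfolding involution_def by auto

lemma invol_component: "g \<in> carrier G \<Longrightarrow> x \<in> \<Gamma> g \<Longrightarrow> \<phi> x \<in> \<Gamma> g"
  using deg_pres unfolding degree_preserving_def by blast

lemma invol_zero [simp]: "\<phi> \<zero>\<^bsub>A\<^esub> = \<zero>\<^bsub>A\<^esub>"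
  using invol_smult[of "\<zero>\<^bsub>F\<^esub>" "\<zero>\<^bsub>A\<^esub>"] by simp

lemma invol_eq_zero_iff: "x \<in> carrier A \<Longrightarrow> \<phi> x = \<zero>\<^bsub>A\<^esub> \<longleftrightarrow> x = \<zero>\<^bsub>A\<^esub>"
  by (metis invol_invol invol_zero)

lemma invol_finsum:
  assumes "f \<in> I \<rightarrow> carrier A"
  shows "\<phi> (\<Oplus>\<^bsub>A\<^esub>i\<in>I. f i) = (\<Oplus>\<^bsub>A\<^esub>i\<in>I. \<phi> (f i))"
  using assms
proof (induction I rule: infinite_finite_induct)
  case (infinite I) then show ?case by simp
next
  case empty then show ?case by simp
next
  case (insert i I)
  then have "f i \<in> carrier A" "f \<in> I \<rightarrow> carrier A" "(\<lambda>i. \<phi> (f i)) \<in> I \<rightarrow> carrier A"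
    by auto
  then show ?case using insert by (simp add: invol_add)
qed

end

text \<open>The idempotents \<open>e\<close> and \<open>\<phi> e\<close> are equivalent:
  \<open>c\<close> lies in \<open>\<phi> e \<bullet> A \<bullet> e\<close>, \<open>c'\<close> in
  \<open>e \<bullet> A \<bullet> \<phi> e\<close>, and their two products are the idempotents. From
  here on, minimality of the left ideal enters only through \<open>e_left_inverse\<close>.\<close>

locale graded_form = graded_simple_involution F A G \<Gamma> \<phi>
  for F (structure) and A (structure) and G (structure) and \<Gamma> and \<phi> +
  fixes e c c' \<gamma> \<delta>
  assumes e_deg: "e \<in> \<Gamma> \<one>\<^bsub>G\<^esub>" and e_nonzero: "e \<noteq> \<zero>\<^bsub>A\<^esub>" and e_idem [simp]: "e \<bullet> e = e"
    and e_left_inverse: "\<lbrakk>g \<in> carrier G; x \<in> \<Gamma> g; x \<bullet> e = x; x \<noteq> \<zero>\<^bsub>A\<^esub>\<rbrakk> \<Longrightarrow>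
      \<exists>y\<in>\<Gamma> (inv\<^bsub>G\<^esub> g). e \<bullet> y = y \<and> y \<bullet> x = e"
    and \<gamma>_closed [simp]: "\<gamma> \<in> carrier G" and \<delta>_sign: "\<delta> \<in> {\<one>\<^bsub>F\<^esub>, \<ominus>\<^bsub>F\<^esub> \<one>\<^bsub>F\<^esub>}"
    and c_deg: "c \<in> \<Gamma> \<gamma>" and c_right [simp]: "c \<bullet> e = c" and invol_c: "\<phi> c = \<delta> \<odot>\<^bsub>A\<^esub> c"
    and c'_deg: "c' \<in> \<Gamma> (inv\<^bsub>G\<^esub> \<gamma>)" and c'_left [simp]: "e \<bullet> c' = c'"
    and c'_c [simp]: "c' \<bullet> c = e" and c_c' [simp]: "c \<bullet> c' = \<phi> e"

lemma (in graded_simple_involution) exists_graded_form: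
  obtains e c c' \<gamma> \<delta> where "graded_form F A G \<Gamma> \<phi> e c c' \<gamma> \<delta>"
proof -
  obtain e where e: "e \<in> \<Gamma> \<one>\<^bsub>G\<^esub>" "e \<noteq> \<zero>\<^bsub>A\<^esub>" "e \<bullet> e = e"
    and left_inv: "\<And>g x. g \<in> carrier G \<Longrightarrow> x \<in> \<Gamma> g \<Longrightarrow> x \<bullet> e = x \<Longrightarrow> x \<noteq> \<zero>\<^bsub>A\<^esub> \<Longrightarrow>
      \<exists>y\<in>\<Gamma> (inv\<^bsub>G\<^esub> g). e \<bullet> y = y \<and> y \<bullet> x = e"
    using exists_minimal_idempotent by blast
  have ec: "e \<in> carrier A" using e component_closed by blast
  have se: "\<phi> e \<in> \<Gamma> \<one>\<^bsub>G\<^esub>" "\<phi> e \<bullet> \<phi> e = \<phi> e" using invol_component e invol_mult[of e e] ec by auto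
  obtain \<gamma> r where r: "\<gamma> \<in> carrier G" "r \<in> \<Gamma> \<gamma>" "\<phi> e \<bullet> (r \<bullet> e) \<noteq> \<zero>\<^bsub>A\<^esub>"
    using exists_homogeneous_middle[OF grp.one_closed se(1) _ ec e(2)] invol_eq_zero_iff[OF ec] e(2) by metis
  define c0 where "c0 = \<phi> e \<bullet> (r \<bullet> e)"
  have rc: "r \<in> carrier A" using r component_closed by blast
  have "r \<bullet> e \<in> \<Gamma> \<gamma>" using component_mult[of \<gamma> "\<one>\<^bsub>G\<^esub>" r e] r e by simp
  then have c0_deg: "c0 \<in> \<Gamma> \<gamma>" using component_mult[of "\<one>\<^bsub>G\<^esub>" \<gamma> "\<phi> e" "r \<bullet> e"] r se by (simp add: c0_def)
  have c0c: "c0 \<in> carrier A" using ec rc by (simp add: c0_def)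
  have c0e: "c0 \<bullet> e = c0" "\<phi> c0 \<bullet> e = \<phi> c0" "\<phi> e \<bullet> c0 = c0" "\<phi> e \<bullet> \<phi> c0 = \<phi> c0"
    using ec rc e se a_mult_assoc[symmetric, of "\<phi> e" "\<phi> e"]
    by (simp_all add: c0_def a_mult_assoc invol_mult)
  \<comment> \<open>If the symmetrization of \<open>c0\<close> vanishes, \<open>c0\<close> itself is
    skew and serves with \<delta> = -1. Nothing is halved, so characteristic 2 is covered.\<close>
  have "\<exists>c \<delta>. c \<in> \<Gamma> \<gamma> \<and> c \<bullet> e = c \<and> \<phi> e \<bullet> c = c \<and> c \<noteq> \<zero>\<^bsub>A\<^esub> \<and>
      \<delta> \<in> {\<one>\<^bsub>F\<^esub>, \<ominus>\<^bsub>F\<^esub> \<one>\<^bsub>F\<^esub>} \<and> \<phi> c = \<delta> \<odot>\<^bsub>A\<^esub> c"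
  proof (cases "c0 \<oplus>\<^bsub>A\<^esub> \<phi> c0 = \<zero>\<^bsub>A\<^esub>")
    case True
    then have "\<phi> c0 = \<ominus>\<^bsub>A\<^esub> c0" using c0c by (metis M.a_comm M.minus_equality invol_closed)
    then have "\<phi> c0 = (\<ominus>\<^bsub>F\<^esub> \<one>\<^bsub>F\<^esub>) \<odot>\<^bsub>A\<^esub> c0" using c0c by (simp add: smult_l_minus)
    then show ?thesis using c0_deg c0e r(3) unfolding c0_def[symmetric] by blast
  next
    case False
    let ?c = "c0 \<oplus>\<^bsub>A\<^esub> \<phi> c0"
    have "?c \<in> \<Gamma> \<gamma>" using c0_deg component_add invol_component r by blast
    moreover have "?c \<bullet> e = ?c" "\<phi> e \<bullet> ?c = ?c" using c0c c0e ec by (simp_all add: a_mult_distl a_mult_distr)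
    moreover have "\<phi> ?c = \<one>\<^bsub>F\<^esub> \<odot>\<^bsub>A\<^esub> ?c" using c0c by (simp add: invol_add M.a_comm)
    ultimately show ?thesis using False by blast
  qed
  then obtain c \<delta> where c: "c \<in> \<Gamma> \<gamma>" "c \<bullet> e = c" "\<phi> e \<bullet> c = c" "c \<noteq> \<zero>\<^bsub>A\<^esub>"
    and \<delta>: "\<delta> \<in> {\<one>\<^bsub>F\<^esub>, \<ominus>\<^bsub>F\<^esub> \<one>\<^bsub>F\<^esub>}" and invol_c: "\<phi> c = \<delta> \<odot>\<^bsub>A\<^esub> c" by blast
  have cc: "c \<in> carrier A" using c r component_closed by blast
  obtain y where y: "y \<in> \<Gamma> (inv\<^bsub>G\<^esub> \<gamma>)" "e \<bullet> y = y" "y \<bullet> c = e" using left_inv[OF r(1) c(1,2,4)] by blast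
  have yc: "y \<in> carrier A" using y component_closed r by (meson grp.inv_closed)
  \<comment> \<open>The left inverse \<open>y\<close> is cut down on the right by
    \<open>\<phi> e\<close>; the product with \<open>c\<close> does not change, since
    \<open>\<phi> e \<bullet> c = c\<close>.\<close>
  define c' where "c' = y \<bullet> \<phi> e"
  have c'c: "c' \<in> carrier A" using yc ec by (simp add: c'_def)
  have c'_deg: "c' \<in> \<Gamma> (inv\<^bsub>G\<^esub> \<gamma>)"
    using component_mult[of "inv\<^bsub>G\<^esub> \<gamma>" "\<one>\<^bsub>G\<^esub>" y "\<phi> e"] y se r by (simp add: c'_def)
  have c'e: "e \<bullet> c' = c'" "c' \<bullet> \<phi> e = c'" "c' \<bullet> c = e"
    using yc ec y se c cc by (simp_all add: c'_def a_mult_assoc a_mult_assoc[symmetric, of e y])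
  have "c \<bullet> c' = \<phi> e"
  proof -
    \<comment> \<open>The difference annihilates \<open>c\<close> from the left. Applying \<phi>
      turns this into \<open>\<phi> c \<bullet> w = 0\<close>, hence
      \<open>c \<bullet> w = 0\<close> as \<open>\<phi> c\<close> is \<open>c\<close> up to sign,
      and multiplying by \<open>c'\<close> gives \<open>w = e \<bullet> w = 0\<close>.\<close>
    define w where "w = \<phi> (c \<bullet> c' \<ominus>\<^bsub>A\<^esub> \<phi> e)"
    have wc: "w \<in> carrier A" using cc c'c ec by (simp add: w_def)
    have "(c \<bullet> c' \<ominus>\<^bsub>A\<^esub> \<phi> e) \<bullet> \<phi> e = c \<bullet> c' \<ominus>\<^bsub>A\<^esub> \<phi> e"
      using ec cc c'c c'e se by (simp add: a_mult_diff_left a_mult_assoc)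
    then have ew: "e \<bullet> w = w"
      using ec cc c'c invol_mult[of "c \<bullet> c' \<ominus>\<^bsub>A\<^esub> \<phi> e" "\<phi> e"] by (simp add: w_def)
    have "(c \<bullet> c' \<ominus>\<^bsub>A\<^esub> \<phi> e) \<bullet> c = \<zero>\<^bsub>A\<^esub>"
      using cc c'c ec c'e c by (simp add: a_mult_diff_left a_mult_assoc diff_eq_zero_iff)
    then have "\<phi> c \<bullet> w = \<zero>\<^bsub>A\<^esub>"
      using invol_mult[of "c \<bullet> c' \<ominus>\<^bsub>A\<^esub> \<phi> e" c] cc c'c ec by (simp add: w_def)
    moreover have "\<phi> c \<bullet> w = c \<bullet> w \<or> \<phi> c \<bullet> w = \<ominus>\<^bsub>A\<^esub> (c \<bullet> w)"
      using \<delta> cc wc by (auto simp: invol_c smult_l_minus a_mult_minus_left)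
    ultimately have "c \<bullet> w = \<zero>\<^bsub>A\<^esub>" using cc wc
      by (metis M.r_neg M.r_zero a_mult_closed)
    then have "c' \<bullet> (c \<bullet> w) = \<zero>\<^bsub>A\<^esub>" using c'c by simp
    then have "w = \<zero>\<^bsub>A\<^esub>" using c'c cc wc ew c'e by (simp add: a_mult_assoc[symmetric])
    then have "c \<bullet> c' \<ominus>\<^bsub>A\<^esub> \<phi> e = \<zero>\<^bsub>A\<^esub>"
      unfolding w_def using cc c'c ec invol_eq_zero_iff[of "c \<bullet> c' \<ominus>\<^bsub>A\<^esub> \<phi> e"] by simp
    then show ?thesis using cc c'c ec by (simp add: diff_eq_zero_iff)
  qed
  then have "graded_form F A G \<Gamma> \<phi> e c c' \<gamma> \<delta>"
    using e left_inv r c \<delta> invol_c c'_deg c'e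
    by unfold_locales auto
  then show thesis using that by blast
qed

section \<open>The corner algebra of the idempotent and its involution\<close>

context graded_form
begin

lemma e_closed [simp]: "e \<in> carrier A" using e_deg component_closed by blast
lemma c_closed [simp]: "c \<in> carrier A" using c_deg component_closed \<gamma>_closed by blast
lemma c'_closed [simp]: "c' \<in> carrier A" using c'_deg component_closed \<gamma>_closed grp.inv_closed by blast
lemma \<delta>_closed [simp]: "\<delta> \<in> carrier F" using \<delta>_sign by auto

lemma \<delta>_square: "\<delta> \<otimes>\<^bsub>F\<^esub> \<delta> = \<one>\<^bsub>F\<^esub>"
  using \<delta>_sign by (auto simp: l_minus r_minus)

lemma \<delta>_smult [simp]: "x \<in> carrier A \<Longrightarrow> \<delta> \<odot>\<^bsub>A\<^esub> (\<delta> \<odot>\<^bsub>A\<^esub> x) = x"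
  by (simp add: smult_assoc1[symmetric] \<delta>_square)

lemma \<delta>_smult_eq_zero_iff: "x \<in> carrier A \<Longrightarrow> \<delta> \<odot>\<^bsub>A\<^esub> x = \<zero>\<^bsub>A\<^esub> \<longleftrightarrow> x = \<zero>\<^bsub>A\<^esub>"
  by (metis \<delta>_closed \<delta>_smult smult_r_null)

lemma invol_e_idem [simp]: "\<phi> e \<bullet> \<phi> e = \<phi> e"
  using invol_mult[of e e] by simp

lemma c_left [simp]: "\<phi> e \<bullet> c = c"
  using a_mult_assoc[of c c' c] by simp

lemma c'_right [simp]: "c' \<bullet> \<phi> e = c'"
  using a_mult_assoc[of c' c c'] by simp

text \<open>Right-nested versions of the product rules: after rewriting with
  \<open>a_mult_assoc\<close> two neighbouring factors usually have a tail behind them.\<close>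

lemma absorb [simp]:
  assumes "x \<in> carrier A"
  shows "e \<bullet> (e \<bullet> x) = e \<bullet> x" "\<phi> e \<bullet> (\<phi> e \<bullet> x) = \<phi> e \<bullet> x" "c \<bullet> (e \<bullet> x) = c \<bullet> x" "e \<bullet> (c' \<bullet> x) = c' \<bullet> x"
    "c' \<bullet> (c \<bullet> x) = e \<bullet> x" "c \<bullet> (c' \<bullet> x) = \<phi> e \<bullet> x" "\<phi> e \<bullet> (c \<bullet> x) = c \<bullet> x" "c' \<bullet> (\<phi> e \<bullet> x) = c' \<bullet> x"
  using assms by (simp_all add: a_mult_assoc[symmetric])

text \<open>Applying \<phi> to \<open>c' \<bullet> c = e\<close> expresses \<open>\<phi> e\<close>
  as \<delta> times \<open>c \<bullet> \<phi> c'\<close>. Left multiplication by \<open>c'\<close>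
  isolates \<open>\<phi> c'\<close>, and \<delta> is its own inverse.\<close>

lemma invol_c' [simp]: "\<phi> c' = \<delta> \<odot>\<^bsub>A\<^esub> c'"
proof -
  have "\<phi> c \<bullet> \<phi> c' = \<phi> e" using invol_mult[of c' c] by simp
  then have "\<delta> \<odot>\<^bsub>A\<^esub> (c \<bullet> \<phi> c') = \<phi> e" by (simp add: invol_c a_smult_mult_left)
  then have "c' \<bullet> (\<delta> \<odot>\<^bsub>A\<^esub> (c \<bullet> \<phi> c')) = c'" by simp
  then have "\<delta> \<odot>\<^bsub>A\<^esub> (e \<bullet> \<phi> c') = c'" by (simp add: a_smult_mult_right)
  moreover have "e \<bullet> \<phi> c' = \<phi> c'" using invol_mult[of c' "\<phi> e"] by simp
  ultimately show ?thesis by (metis \<delta>_smult c'_closed invol_closed)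
qed

definition corner where "corner = {x \<in> carrier A. e \<bullet> x = x \<and> x \<bullet> e = x}"

definition D where "D = A\<lparr>carrier := corner, monoid.one := e\<rparr>"

definition \<Gamma>\<^sub>D where "\<Gamma>\<^sub>D g = \<Gamma> g \<inter> corner"

definition \<phi>\<^sub>0 where "\<phi>\<^sub>0 x = c' \<bullet> (\<phi> x \<bullet> c)"

lemma D_simps [simp]:
  "carrier D = corner" "monoid.mult D = monoid.mult A" "monoid.one D = e" "ring.zero D = \<zero>\<^bsub>A\<^esub>"
  "ring.add D = ring.add A" "module.smult D = module.smult A"
  by (simp_all add: D_def)

lemma corner_closed: "x \<in> corner \<Longrightarrow> x \<in> carrier A"
  by (simp add: corner_def)

lemma corner_submodule: "submodule corner F A"
  by (intro subspaceI)
    (auto simp: corner_def a_mult_distl a_mult_distr a_smult_mult_left a_smult_mult_right)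

lemma corner_mult: "x \<in> corner \<Longrightarrow> y \<in> corner \<Longrightarrow> x \<bullet> y \<in> corner"
  by (simp add: corner_def a_mult_assoc) (simp add: a_mult_assoc[symmetric])

lemma e_corner: "e \<in> corner" by (simp add: corner_def)

lemma module_D: "module F D"
proof -
  have m: "module F (A\<lparr>carrier := corner\<rparr>)"
    using submodule.submodule_is_module[OF corner_submodule module_axioms] .
  \<comment> \<open>\<open>D\<close> differs from the restriction of \<open>A\<close> only in
    \<open>one\<close>, which the additive monoid does not contain.\<close>
  have add: "add_monoid D = add_monoid (A\<lparr>carrier := corner\<rparr>)" by (simp add: D_def)
  show ?thesis
    using m unfolding module_def module_axioms_def abelian_group_def abelian_monoid_def
      abelian_group_axioms_def add by simp
qed

sublocale D: module F D by (rule module_D)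

lemma assoc_algebra_D: "assoc_algebra F D"
  using corner_mult corner_closed
  by unfold_locales
    (auto simp: a_mult_assoc a_mult_distl a_mult_distr a_smult_mult_left a_smult_mult_right)

lemma finsum_D: "f \<in> I \<rightarrow> corner \<Longrightarrow> finsum D f I = finsum A f I"
  unfolding D_def
  using finsum_change_carrier[where S = corner and u = e] D.abelian_monoid_axioms corner_closed
  unfolding D_def by blast

lemma ring_D: "ring D"
proof (intro ringI monoidI)
  show "abelian_group D" by (rule D.M.abelian_group_axioms)
  fix x y z assume "x \<in> carrier D" "y \<in> carrier D" "z \<in> carrier D"
  then have "x \<in> carrier A" "y \<in> carrier A" "z \<in> carrier A" using corner_closed by simp_all
  then show "x \<otimes>\<^bsub>D\<^esub> y \<otimes>\<^bsub>D\<^esub> z = x \<otimes>\<^bsub>D\<^esub> (y \<otimes>\<^bsub>D\<^esub> z)"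
    "(x \<oplus>\<^bsub>D\<^esub> y) \<otimes>\<^bsub>D\<^esub> z = x \<otimes>\<^bsub>D\<^esub> z \<oplus>\<^bsub>D\<^esub> y \<otimes>\<^bsub>D\<^esub> z"
    "z \<otimes>\<^bsub>D\<^esub> (x \<oplus>\<^bsub>D\<^esub> y) = z \<otimes>\<^bsub>D\<^esub> x \<oplus>\<^bsub>D\<^esub> z \<otimes>\<^bsub>D\<^esub> y"
    by (simp_all add: a_mult_assoc a_mult_distl a_mult_distr)
qed (simp_all add: corner_mult e_corner, simp_all add: corner_def)

text \<open>Multiplication by \<open>e\<close> preserves degrees, so it commutes with taking
  components. Hence the components taken in \<open>A\<close> also serve as those of
  \<open>D\<close>.\<close>

lemma hcomp_corner:
  assumes "x \<in> corner" "g \<in> carrier G" shows "hcomp x g \<in> corner"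
proof -
  have x: "x \<in> carrier A" "e \<bullet> x = x" "x \<bullet> e = x" using assms by (auto simp: corner_def)
  have "e \<bullet> hcomp x g = hcomp x g" using hcomp_mult_left[of x "\<one>\<^bsub>G\<^esub>" e g] x e_deg assms by simp
  moreover have "hcomp x g \<bullet> e = hcomp x g" using hcomp_mult_right[of x "\<one>\<^bsub>G\<^esub>" e g] x e_deg assms by simp
  ultimately show ?thesis using hcomp_closed x assms by (simp add: corner_def)
qed

lemma \<Gamma>\<^sub>D_submodule:
  assumes "g \<in> carrier G" shows "submodule (\<Gamma>\<^sub>D g) F D"
proof (rule D.submoduleI)
  have um: "\<ominus>\<^bsub>D\<^esub> x = (\<ominus>\<^bsub>F\<^esub> \<one>\<^bsub>F\<^esub>) \<odot>\<^bsub>D\<^esub> x" if "x \<in> corner" for x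
    using D.smult_l_minus[of "\<one>\<^bsub>F\<^esub>" x] D.smult_one[of x] that by simp
  show sm: "a \<odot>\<^bsub>D\<^esub> x \<in> \<Gamma>\<^sub>D g" if "a \<in> carrier F" "x \<in> \<Gamma>\<^sub>D g" for a x
    using that assms component_smult submoduleE(4)[OF corner_submodule] by (simp add: \<Gamma>\<^sub>D_def)
  show "\<ominus>\<^bsub>D\<^esub> x \<in> \<Gamma>\<^sub>D g" if "x \<in> \<Gamma>\<^sub>D g" for x
    using that sm[of "\<ominus>\<^bsub>F\<^esub> \<one>\<^bsub>F\<^esub>" x] um[of x] by (simp add: \<Gamma>\<^sub>D_def)
qed (use assms component_zero component_add submodule_zero[OF corner_submodule]
      submoduleE(5)[OF corner_submodule] in \<open>auto simp: \<Gamma>\<^sub>D_def\<close>)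

lemma graded_algebra_D: "graded_algebra F D G \<Gamma>\<^sub>D"
proof -
  interpret D: assoc_algebra F D by (rule assoc_algebra_D)
  show ?thesis
  proof (intro graded_algebra.intro graded_algebra_axioms.intro assoc_algebra_D grp.group_axioms)
    fix x assume x: "x \<in> carrier D"
    then have xA: "x \<in> carrier A" using corner_closed by simp
    let ?P = "\<lambda>c. c \<in> (\<Pi>\<^sub>E g\<in>carrier G. \<Gamma>\<^sub>D g) \<and> finite {g \<in> carrier G. c g \<noteq> \<zero>\<^bsub>D\<^esub>} \<and>
           x = (\<Oplus>\<^bsub>D\<^esub>g\<in>{g \<in> carrier G. c g \<noteq> \<zero>\<^bsub>D\<^esub>}. c g)"
    show "\<exists>!c. ?P c"
    proof (rule ex_ex1I)
      have "hcomp x \<in> (\<Pi>\<^sub>E g\<in>carrier G. \<Gamma>\<^sub>D g)"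
        using hcomp_props(1)[OF xA] hcomp_corner x by (auto simp: \<Gamma>\<^sub>D_def PiE_iff)
      moreover have "x = (\<Oplus>\<^bsub>D\<^esub>g\<in>{g \<in> carrier G. hcomp x g \<noteq> \<zero>\<^bsub>A\<^esub>}. hcomp x g)"
        using hcomp_props(3)[OF xA] hcomp_corner x by (subst finsum_D) auto
      ultimately have "?P (hcomp x)" using hcomp_props(2)[OF xA] by simp
      then show "\<exists>c. ?P c" by blast
    next
      fix c c' assume "?P c" "?P c'"
      moreover have "b = hcomp x" if P: "?P b" for b
      proof -
        have b: "b \<in> (\<Pi>\<^sub>E g\<in>carrier G. \<Gamma> g)" "b \<in> {g \<in> carrier G. b g \<noteq> \<zero>\<^bsub>A\<^esub>} \<rightarrow> corner"
          using P by (auto simp: \<Gamma>\<^sub>D_def PiE_iff)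
        then have "x = (\<Oplus>\<^bsub>A\<^esub>g\<in>{g \<in> carrier G. b g \<noteq> \<zero>\<^bsub>A\<^esub>}. b g)"
          using P finsum_D by simp
        moreover have "finite {g \<in> carrier G. b g \<noteq> \<zero>\<^bsub>A\<^esub>}" using P by simp
        ultimately have "hcomp x = b"
          unfolding hcomp_def using b(1) direct_decomposition[OF xA]
          by (intro the1_equality) blast+
        then show ?thesis by simp
      qed
      ultimately show "c = c'" by blast
    qed
  qed (use \<Gamma>\<^sub>D_submodule component_mult corner_mult in \<open>auto simp: \<Gamma>\<^sub>D_def\<close>)
qed

text \<open>A left inverse supplied by \<open>e_left_inverse\<close> is again nonzero and
  homogeneous, so it has a left inverse of its own, which must be \<open>x\<close>.\<close>

lemma corner_inverse:
  assumes "g \<in> carrier G" "x \<in> \<Gamma>\<^sub>D g" "x \<noteq> \<zero>\<^bsub>A\<^esub>"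
  obtains y where "y \<in> \<Gamma>\<^sub>D (inv\<^bsub>G\<^esub> g)" "y \<bullet> x = e" "x \<bullet> y = e"
proof -
  have left: "\<exists>y\<in>\<Gamma>\<^sub>D (inv\<^bsub>G\<^esub> g). y \<bullet> x = e" if g: "g \<in> carrier G" and x: "x \<in> \<Gamma>\<^sub>D g" "x \<noteq> \<zero>\<^bsub>A\<^esub>" for g x
  proof -
    have xD: "x \<in> \<Gamma> g" "x \<in> carrier A" "e \<bullet> x = x" "x \<bullet> e = x" using x by (auto simp: \<Gamma>\<^sub>D_def corner_def)
    obtain y where y: "y \<in> \<Gamma> (inv\<^bsub>G\<^esub> g)" "e \<bullet> y = y" "y \<bullet> x = e"
      using e_left_inverse[OF g xD(1,4) x(2)] by blast
    have yc: "y \<in> carrier A" using y g component_closed grp.inv_closed by blast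
    \<comment> \<open>Right multiplication by \<open>e\<close> moves \<open>y\<close> into the
      corner without changing \<open>y \<bullet> x\<close>.\<close>
    have "y \<bullet> e \<in> \<Gamma> (inv\<^bsub>G\<^esub> g)" using component_mult[of "inv\<^bsub>G\<^esub> g" "\<one>\<^bsub>G\<^esub>" y e] y g e_deg by simp
    moreover have "y \<bullet> e \<in> corner" using y(2) yc by (simp add: corner_def a_mult_assoc a_mult_assoc[symmetric, of e y])
    moreover have "y \<bullet> e \<bullet> x = e" using y xD yc by (simp add: a_mult_assoc)
    ultimately show ?thesis by (auto simp: \<Gamma>\<^sub>D_def)
  qed
  obtain y where y: "y \<in> \<Gamma>\<^sub>D (inv\<^bsub>G\<^esub> g)" "y \<bullet> x = e" using left assms by blast
  have c: "x \<in> corner" "y \<in> corner" using y assms by (auto simp: \<Gamma>\<^sub>D_def)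
  have "y \<noteq> \<zero>\<^bsub>A\<^esub>" using y(2) e_nonzero c corner_closed a_mult_zero_left by metis
  then obtain z where z: "z \<in> \<Gamma>\<^sub>D (inv\<^bsub>G\<^esub> (inv\<^bsub>G\<^esub> g))" "z \<bullet> y = e" using left[of "inv\<^bsub>G\<^esub> g" y] y assms by auto
  have zc: "z \<in> corner" using z by (auto simp: \<Gamma>\<^sub>D_def)
  have "z \<bullet> (y \<bullet> x) = (z \<bullet> y) \<bullet> x" using c zc corner_closed by (simp add: a_mult_assoc)
  then have "z = x" using y z c zc by (simp add: corner_def)
  then show thesis using that y z by blast
qed

lemma graded_division_D: "graded_division_algebra F D G \<Gamma>\<^sub>D"
proof -
  have "x \<in> Units D" if g: "g \<in> carrier G" and x: "x \<in> \<Gamma>\<^sub>D g" "x \<noteq> \<zero>\<^bsub>A\<^esub>" for g x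
  proof -
    obtain y where y: "y \<in> \<Gamma>\<^sub>D (inv\<^bsub>G\<^esub> g)" "y \<bullet> x = e" "x \<bullet> y = e" using corner_inverse[OF g x] .
    then show ?thesis using x unfolding Units_def by (auto simp: \<Gamma>\<^sub>D_def)
  qed
  then show ?thesis
    unfolding graded_division_algebra_def using graded_algebra_D ring_D e_nonzero by auto
qed

text \<open>Nonzero homogeneous elements are invertible, so their products stay nonzero, and the
  inverse has the inverse degree.\<close>

lemma support_D: "subgroup (grading_support D G \<Gamma>\<^sub>D) G"
proof -
  have nz: "\<Gamma>\<^sub>D g \<noteq> {\<zero>\<^bsub>A\<^esub>} \<longleftrightarrow> (\<exists>x\<in>\<Gamma>\<^sub>D g. x \<noteq> \<zero>\<^bsub>A\<^esub>)" if "g \<in> carrier G" for g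
    using component_zero that submodule_zero[OF corner_submodule] by (auto simp: \<Gamma>\<^sub>D_def)
  show ?thesis
  proof (rule grp.subgroupI)
    show "grading_support D G \<Gamma>\<^sub>D \<subseteq> carrier G" by (auto simp: grading_support_def)
    have "e \<in> \<Gamma>\<^sub>D \<one>\<^bsub>G\<^esub>" using e_deg e_corner by (simp add: \<Gamma>\<^sub>D_def)
    then have "\<one>\<^bsub>G\<^esub> \<in> grading_support D G \<Gamma>\<^sub>D" using nz e_nonzero by (auto simp: grading_support_def)
    then show "grading_support D G \<Gamma>\<^sub>D \<noteq> {}" by blast
    fix g assume "g \<in> grading_support D G \<Gamma>\<^sub>D"
    then obtain x where x: "g \<in> carrier G" "x \<in> \<Gamma>\<^sub>D g" "x \<noteq> \<zero>\<^bsub>A\<^esub>" using nz by (auto simp: grading_support_def)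
    then obtain y where y: "y \<in> \<Gamma>\<^sub>D (inv\<^bsub>G\<^esub> g)" "y \<bullet> x = e" "x \<bullet> y = e" using corner_inverse by blast
    have yx: "x \<in> carrier A" "y \<in> carrier A" using x y by (auto simp: \<Gamma>\<^sub>D_def corner_def)
    then have "y \<noteq> \<zero>\<^bsub>A\<^esub>" using y(2) e_nonzero a_mult_zero_left by metis
    then show "inv\<^bsub>G\<^esub> g \<in> grading_support D G \<Gamma>\<^sub>D" using y x nz by (auto simp: grading_support_def)
    fix h assume "h \<in> grading_support D G \<Gamma>\<^sub>D"
    then obtain z where z: "h \<in> carrier G" "z \<in> \<Gamma>\<^sub>D h" "z \<noteq> \<zero>\<^bsub>A\<^esub>" using nz by (auto simp: grading_support_def)
    then have zc: "z \<in> carrier A" "e \<bullet> z = z" by (auto simp: \<Gamma>\<^sub>D_def corner_def)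
    have "y \<bullet> (x \<bullet> z) = z" using y(2) zc yx by (simp add: a_mult_assoc[symmetric])
    then have "x \<bullet> z \<noteq> \<zero>\<^bsub>A\<^esub>" using z(3) yx by auto
    moreover have "x \<bullet> z \<in> \<Gamma>\<^sub>D (g \<otimes>\<^bsub>G\<^esub> h)" using x z component_mult corner_mult by (simp add: \<Gamma>\<^sub>D_def)
    ultimately show "g \<otimes>\<^bsub>G\<^esub> h \<in> grading_support D G \<Gamma>\<^sub>D" using x z nz by (auto simp: grading_support_def)
  qed
qed

lemma invol_corner: "x \<in> corner \<Longrightarrow> \<phi> e \<bullet> \<phi> x = \<phi> x \<and> \<phi> x \<bullet> \<phi> e = \<phi> x"
  using invol_mult[of x e] invol_mult[of e x] by (auto simp: corner_def)

lemma involution_D: "involution F D \<phi>\<^sub>0"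
proof -
  have "\<phi>\<^sub>0 (x \<bullet> y) = \<phi>\<^sub>0 y \<bullet> \<phi>\<^sub>0 x" if "x \<in> corner" "y \<in> corner" for x y
  proof -
    have c: "x \<in> carrier A" "y \<in> carrier A" using that corner_closed by auto
    \<comment> \<open>The inner \<open>c \<bullet> c'\<close> collapses to \<open>\<phi> e\<close>,
      which the neighbouring \<open>\<phi> y\<close> absorbs.\<close>
    have "\<phi>\<^sub>0 y \<bullet> \<phi>\<^sub>0 x = c' \<bullet> (\<phi> y \<bullet> (\<phi> e \<bullet> (\<phi> x \<bullet> c)))" using c by (simp add: \<phi>\<^sub>0_def a_mult_assoc)
    also have "\<phi> y \<bullet> (\<phi> e \<bullet> (\<phi> x \<bullet> c)) = \<phi> y \<bullet> (\<phi> x \<bullet> c)"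
      using c invol_corner[OF that(2)] by (simp add: a_mult_assoc[symmetric])
    finally show ?thesis using c by (simp add: \<phi>\<^sub>0_def a_mult_assoc invol_mult)
  qed
  moreover have "\<phi>\<^sub>0 (\<phi>\<^sub>0 x) = x" if "x \<in> corner" for x
  proof -
    have c: "x \<in> carrier A" "e \<bullet> x = x" "x \<bullet> e = x" using that by (auto simp: corner_def)
    have "\<phi>\<^sub>0 (\<phi>\<^sub>0 x) = c' \<bullet> (\<phi> (c' \<bullet> (\<phi> x \<bullet> c)) \<bullet> c)" by (simp add: \<phi>\<^sub>0_def)
    \<comment> \<open>\<open>\<phi> c\<close> and \<open>\<phi> c'\<close> contribute one factor
      \<delta> each, and the two cancel.\<close>
    also have "\<phi> (c' \<bullet> (\<phi> x \<bullet> c)) = c \<bullet> (x \<bullet> c')"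
      using c by (simp add: invol_mult invol_c a_smult_mult_left a_smult_mult_right a_mult_assoc)
    also have "c' \<bullet> (c \<bullet> (x \<bullet> c') \<bullet> c) = x" using c by (simp add: a_mult_assoc)
    finally show ?thesis .
  qed
  moreover have "\<phi>\<^sub>0 x \<in> corner" if "x \<in> corner" for x
    using that corner_closed[OF that] by (simp add: corner_def \<phi>\<^sub>0_def a_mult_assoc)
  ultimately show ?thesis
    unfolding involution_def \<phi>\<^sub>0_def
    using corner_closed
    by (simp add: invol_add invol_smult a_mult_distl a_mult_distr a_smult_mult_left a_smult_mult_right)
qed

lemma \<phi>\<^sub>0_closed: "x \<in> corner \<Longrightarrow> \<phi>\<^sub>0 x \<in> corner"
  using involution_D by (simp add: involution_def)

lemma degree_preserving_D: "degree_preserving G \<Gamma>\<^sub>D \<phi>\<^sub>0"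
  unfolding degree_preserving_def
proof clarify
  fix g x assume g: "g \<in> carrier G" and x: "x \<in> \<Gamma>\<^sub>D g"
  have "\<phi> x \<in> \<Gamma> g" using x g invol_component by (simp add: \<Gamma>\<^sub>D_def)
  then have "\<phi> x \<bullet> c \<in> \<Gamma> (g \<otimes>\<^bsub>G\<^esub> \<gamma>)" using component_mult g c_deg by simp
  then have "\<phi>\<^sub>0 x \<in> \<Gamma> (inv\<^bsub>G\<^esub> \<gamma> \<otimes>\<^bsub>G\<^esub> (g \<otimes>\<^bsub>G\<^esub> \<gamma>))"
    using component_mult[of "inv\<^bsub>G\<^esub> \<gamma>" "g \<otimes>\<^bsub>G\<^esub> \<gamma>"] g c'_deg by (simp add: \<phi>\<^sub>0_def)
  \<comment> \<open>\<open>\<phi>\<^sub>0\<close> conjugates degrees by \<gamma>, which is harmless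
    because \<open>G\<close> is commutative.\<close>
  moreover have "inv\<^bsub>G\<^esub> \<gamma> \<otimes>\<^bsub>G\<^esub> (g \<otimes>\<^bsub>G\<^esub> \<gamma>) = g"
    using g by (simp add: comm.m_comm[of g \<gamma>] grp.m_assoc[symmetric])
  ultimately show "\<phi>\<^sub>0 x \<in> \<Gamma>\<^sub>D g" using \<phi>\<^sub>0_closed x by (simp add: \<Gamma>\<^sub>D_def)
qed

end

section \<open>Adapted bases\<close>

lemma (in graded_algebra) component_degree_unique:
  assumes "g \<in> carrier G" "h \<in> carrier G" "x \<in> \<Gamma> g" "x \<in> \<Gamma> h" "x \<noteq> \<zero>\<^bsub>A\<^esub>"
  shows "g = h"
  using hcomp_homogeneous[of g x h] hcomp_homogeneous[of h x h] assms by (auto split: if_splits)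

section \<open>The hermitian form and its dual families\<close>

context graded_form
begin

text \<open>The functional \<open>B(x, -)\<close> as an element of \<open>A\<close>, so that the
  form is \<open>adj x \<bullet> y\<close> and functionals multiply with vectors and ring elements
  in one algebra.\<close>

definition adj where "adj x = c' \<bullet> \<phi> x"

lemma adj_closed [simp, intro]: "x \<in> carrier A \<Longrightarrow> adj x \<in> carrier A"
  by (simp add: adj_def)

lemma adj_left [simp]: "x \<in> carrier A \<Longrightarrow> e \<bullet> adj x = adj x"
  by (simp add: adj_def)

lemma adj_component:
  assumes "g \<in> carrier G" "x \<in> \<Gamma> g" shows "adj x \<in> \<Gamma> (inv\<^bsub>G\<^esub> \<gamma> \<otimes>\<^bsub>G\<^esub> g)"
  unfolding adj_def using assms by (intro component_mult c'_deg invol_component) auto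

lemma form_corner:
  assumes "x \<in> carrier A" "y \<in> carrier A" "y \<bullet> e = y" shows "adj x \<bullet> y \<in> corner"
  using assms a_mult_assoc[of e "adj x" y] by (simp add: corner_def a_mult_assoc)

lemma form_component:
  assumes "g \<in> carrier G" "h \<in> carrier G" "x \<in> \<Gamma> g" "y \<in> \<Gamma> h" "y \<bullet> e = y"
  shows "adj x \<bullet> y \<in> \<Gamma>\<^sub>D (inv\<^bsub>G\<^esub> \<gamma> \<otimes>\<^bsub>G\<^esub> g \<otimes>\<^bsub>G\<^esub> h)"
  using form_corner component_mult adj_component component_closed assms by (simp add: \<Gamma>\<^sub>D_def)

text \<open>Hermitian symmetry; the sign is the one by which \<phi> acts on
  \<open>c'\<close>.\<close>

lemma \<phi>\<^sub>0_form:
  assumes "x \<in> carrier A" "y \<in> carrier A" "x \<bullet> e = x"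
  shows "\<phi>\<^sub>0 (adj x \<bullet> y) = \<delta> \<odot>\<^bsub>A\<^esub> (adj y \<bullet> x)"
  using assms
  by (simp add: \<phi>\<^sub>0_def adj_def invol_mult a_smult_mult_left a_smult_mult_right a_mult_assoc)

lemma form_zero_sym:
  assumes "x \<in> carrier A" "y \<in> carrier A" "x \<bullet> e = x" "adj x \<bullet> y = \<zero>\<^bsub>A\<^esub>"
  shows "adj y \<bullet> x = \<zero>\<^bsub>A\<^esub>"
proof -
  have "\<delta> \<odot>\<^bsub>A\<^esub> (adj y \<bullet> x) = \<phi>\<^sub>0 \<zero>\<^bsub>A\<^esub>" using \<phi>\<^sub>0_form assms by metis
  then show ?thesis using assms by (simp add: \<phi>\<^sub>0_def \<delta>_smult_eq_zero_iff)
qed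

text \<open>Conjugate-linearity of the form in its first argument.\<close>

lemma adj_mult_corner:
  assumes "d \<in> corner" "x \<in> carrier A"
  shows "adj (x \<bullet> d) = \<phi>\<^sub>0 d \<bullet> adj x"
proof -
  have d: "d \<in> carrier A" "\<phi> d \<bullet> \<phi> e = \<phi> d" using assms corner_closed invol_corner by auto
  have "\<phi> d \<bullet> (\<phi> e \<bullet> \<phi> x) = \<phi> d \<bullet> \<phi> x" using d assms by (simp add: a_mult_assoc[symmetric])
  then show ?thesis using d(1) assms by (simp add: adj_def \<phi>\<^sub>0_def invol_mult a_mult_assoc)
qed

text \<open>Unspecified unless \<open>x\<close> is invertible in the corner.\<close>

definition dinv where "dinv x = (SOME y. y \<in> corner \<and> y \<bullet> x = e \<and> x \<bullet> y = e)"

lemma dinv_props: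
  assumes "g \<in> carrier G" "x \<in> \<Gamma>\<^sub>D g" "x \<noteq> \<zero>\<^bsub>A\<^esub>"
  shows "dinv x \<in> \<Gamma>\<^sub>D (inv\<^bsub>G\<^esub> g)" "dinv x \<bullet> x = e" "x \<bullet> dinv x = e"
proof -
  obtain y where y: "y \<in> \<Gamma>\<^sub>D (inv\<^bsub>G\<^esub> g)" "y \<bullet> x = e" "x \<bullet> y = e" using corner_inverse assms by blast
  then have "y \<in> corner \<and> y \<bullet> x = e \<and> x \<bullet> y = e" by (simp add: \<Gamma>\<^sub>D_def)
  then have d: "dinv x \<in> corner \<and> dinv x \<bullet> x = e \<and> x \<bullet> dinv x = e" unfolding dinv_def by (rule someI)
  have "dinv x \<in> carrier A" "x \<in> carrier A" "y \<in> carrier A"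
    using d y(1) assms(2) corner_closed by (auto simp: \<Gamma>\<^sub>D_def)
  then have "dinv x \<bullet> (x \<bullet> y) = (dinv x \<bullet> x) \<bullet> y" by (rule a_mult_assoc[symmetric])
  then have "dinv x = y" using d y by (simp add: \<Gamma>\<^sub>D_def corner_def)
  then show "dinv x \<in> \<Gamma>\<^sub>D (inv\<^bsub>G\<^esub> g)" "dinv x \<bullet> x = e" "x \<bullet> dinv x = e" using y d by auto
qed

text \<open>
  The entries of \<open>model_form\<close>, with the pairs \<open>(q + 2m - 1, q + 2m)\<close> described by the parity of \<open>i - q\<close>.
\<close>

definition form_entry where
  "form_entry q d i j = (if i = j \<and> i \<le> q then d i
     else if q < i \<and> odd (i - q) \<and> j = i + 1 then e
     else if q < j \<and> odd (j - q) \<and> i = j + 1 then \<delta> \<odot>\<^bsub>A\<^esub> e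
     else \<zero>\<^bsub>A\<^esub>)" for i j q :: nat

definition adapted where
  "adapted q s u g \<longleftrightarrow>
     (\<forall>i\<in>{1..q + 2 * s}. g i \<in> carrier G \<and> u i \<in> \<Gamma> (g i) \<and> u i \<bullet> e = u i) \<and>
     (\<forall>i\<in>{1..q}. adj (u i) \<bullet> u i \<noteq> \<zero>\<^bsub>A\<^esub>) \<and>
     (\<forall>i\<in>{1..q + 2 * s}. \<forall>j\<in>{1..q + 2 * s}. adj (u i) \<bullet> u j = form_entry q (\<lambda>i. adj (u i) \<bullet> u i) i j)"
  for q s :: nat

lemma adapted_empty: "adapted 0 0 u g"
  by (simp add: adapted_def)

text \<open>
  The matrix of the form is monomial: its only nonzero entry in row \<open>partner q i\<close> is in column \<open>i\<close>, with
  inverse \<open>coef q u i\<close>. So the dual family is obtained without inverting a matrix.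
\<close>

definition partner where
  "partner q i = (if i \<le> q then i else if odd (i - q) then i + 1 else i - 1)" for q i :: nat

definition coef where
  "coef q u i = (if i \<le> q then dinv (adj (u i) \<bullet> u i) else if odd (i - q) then \<delta> \<odot>\<^bsub>A\<^esub> e else e)"
  for q i :: nat

definition dual where
  "dual q u i = coef q u i \<bullet> adj (u (partner q i))"

lemma partner_range:
  assumes "i \<in> {1..q + 2 * s}" shows "partner q i \<in> {1..q + 2 * s}"
proof (cases "i \<le> q")
  case True then show ?thesis using assms by (auto simp: partner_def)
next
  case False
  then obtain m where m: "i = q + m" "m > 0" using less_imp_add_positive[of q i] by auto
  show ?thesis using assms m unfolding partner_def by (cases "odd m") (auto elim!: oddE evenE, arith+)
qed

lemma partner_partner:
  assumes "i > 0" shows "partner q (partner q i) = i"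
proof (cases "i \<le> q")
  case True then show ?thesis by (simp add: partner_def)
next
  case False
  then obtain m where m: "i = q + m" "m > 0" using less_imp_add_positive[of q i] by auto
  show ?thesis using m unfolding partner_def by (cases "odd m") (auto elim!: oddE evenE)
qed

context
  fixes q s u g k
  assumes good: "adapted q s u g"
  defines k: "k \<equiv> q + 2 * s"
begin

lemma partner_in: "i \<in> {1..k} \<Longrightarrow> partner q i \<in> {1..k}"
  using partner_range unfolding k .

lemma u_props:
  assumes "i \<in> {1..k}"
  shows "g i \<in> carrier G" "u i \<in> \<Gamma> (g i)" "u i \<bullet> e = u i" "u i \<in> carrier A"
  using good assms component_closed unfolding adapted_def k by blast+

lemma d_props:
  assumes "i \<in> {1..q}"
  shows "adj (u i) \<bullet> u i \<in> \<Gamma>\<^sub>D (inv\<^bsub>G\<^esub> \<gamma> \<otimes>\<^bsub>G\<^esub> g i \<otimes>\<^bsub>G\<^esub> g i)" "adj (u i) \<bullet> u i \<noteq> \<zero>\<^bsub>A\<^esub>"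
    "adj (u i) \<bullet> u i \<in> corner"
proof -
  have "i \<in> {1..k}" using assms by (auto simp: k)
  then show "adj (u i) \<bullet> u i \<in> \<Gamma>\<^sub>D (inv\<^bsub>G\<^esub> \<gamma> \<otimes>\<^bsub>G\<^esub> g i \<otimes>\<^bsub>G\<^esub> g i)" "adj (u i) \<bullet> u i \<in> corner"
    using form_component form_corner u_props by auto
  show "adj (u i) \<bullet> u i \<noteq> \<zero>\<^bsub>A\<^esub>" using good assms unfolding adapted_def by blast
qed

lemma coef_props:
  assumes "i \<in> {1..k}"
  obtains h where "h \<in> carrier G" "coef q u i \<in> \<Gamma>\<^sub>D h"
proof (cases "i \<le> q")
  case True
  then have i: "i \<in> {1..q}" using assms by auto
  have "inv\<^bsub>G\<^esub> \<gamma> \<otimes>\<^bsub>G\<^esub> g i \<otimes>\<^bsub>G\<^esub> g i \<in> carrier G" using u_props[OF assms] by simp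
  then show ?thesis using dinv_props(1)[OF _ d_props(1,2)[OF i]] True that
    by (metis coef_def grp.inv_closed)
next
  case False
  have "e \<in> \<Gamma>\<^sub>D \<one>\<^bsub>G\<^esub>" "\<delta> \<odot>\<^bsub>A\<^esub> e \<in> \<Gamma>\<^sub>D \<one>\<^bsub>G\<^esub>"
    using e_deg e_corner component_smult submoduleE(4)[OF corner_submodule]
    by (auto simp: \<Gamma>\<^sub>D_def)
  then show ?thesis using False that[of "\<one>\<^bsub>G\<^esub>"] by (auto simp: coef_def)
qed

lemma coef_corner: "i \<in> {1..k} \<Longrightarrow> coef q u i \<in> corner"
  using coef_props[of i] by (auto simp: \<Gamma>\<^sub>D_def)

lemma form_eq_entry: "i \<in> {1..k} \<Longrightarrow> j \<in> {1..k} \<Longrightarrow> adj (u i) \<bullet> u j = form_entry q (\<lambda>i. adj (u i) \<bullet> u i) i j"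
  using good unfolding adapted_def k by blast

lemma dual_closed [simp]: "i \<in> {1..k} \<Longrightarrow> dual q u i \<in> carrier A"
  unfolding dual_def
  using coef_corner[of i] corner_closed u_props(4)[of "partner q i"] partner_in[of i] by auto

lemma dual_left:
  assumes "i \<in> {1..k}" shows "e \<bullet> dual q u i = dual q u i"
proof -
  have "adj (u (partner q i)) \<in> carrier A" "coef q u i \<in> carrier A" "e \<bullet> coef q u i = coef q u i"
    using assms coef_corner[of i] u_props(4)[of "partner q i"] partner_in[of i]
    by (auto simp: corner_def)
  then show ?thesis by (simp add: dual_def a_mult_assoc[symmetric])
qed

lemma dual_u:
  assumes "i \<in> {1..k}" "j \<in> {1..k}"
  shows "dual q u i \<bullet> u j = (if i = j then e else \<zero>\<^bsub>A\<^esub>)"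
proof -
  have p: "partner q i \<in> {1..k}" using partner_in assms by blast
  have c: "coef q u i \<in> carrier A" "u j \<in> carrier A" "adj (u (partner q i)) \<in> carrier A"
    using coef_corner corner_closed u_props(4) assms p by auto
  have eq: "dual q u i \<bullet> u j = coef q u i \<bullet> form_entry q (\<lambda>i. adj (u i) \<bullet> u i) (partner q i) j"
    using c form_eq_entry[OF p assms(2)] by (simp add: dual_def a_mult_assoc)
  consider (sym) "i \<le> q" | (odd) "q < i" "odd (i - q)" | (even) "q < i" "even (i - q)" by linarith
  then show ?thesis
  proof cases
    case sym
    then have i: "i \<in> {1..q}" using assms by auto
    have "inv\<^bsub>G\<^esub> \<gamma> \<otimes>\<^bsub>G\<^esub> g i \<otimes>\<^bsub>G\<^esub> g i \<in> carrier G" using u_props(1)[OF assms(1)] by simp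
    then have "coef q u i \<bullet> (adj (u i) \<bullet> u i) = e"
      using dinv_props(2)[OF _ d_props(1,2)[OF i]] sym by (simp add: coef_def)
    moreover have "form_entry q (\<lambda>i. adj (u i) \<bullet> u i) (partner q i) j = (if i = j then adj (u i) \<bullet> u i else \<zero>\<^bsub>A\<^esub>)"
      using sym by (auto simp: form_entry_def partner_def)
    ultimately show ?thesis using eq c by (cases "i = j") auto
  next
    \<comment> \<open>The partner is \<open>i + 1\<close>. The entry in row \<open>i + 1\<close> and
      column \<open>i\<close> is \<delta> times \<open>e\<close>, as is the coefficient, and
      \<delta> squares to one.\<close>
    case odd
    then have "form_entry q (\<lambda>i. adj (u i) \<bullet> u i) (partner q i) j = (if i = j then \<delta> \<odot>\<^bsub>A\<^esub> e else \<zero>\<^bsub>A\<^esub>)"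
      by (auto simp: form_entry_def partner_def Suc_diff_le)
    then show ?thesis using eq c odd by (simp add: coef_def a_smult_mult_left a_smult_mult_right)
  next
    \<comment> \<open>The partner is \<open>i - 1\<close>, with entry and coefficient
      \<open>e\<close>. Writing \<open>i = q + 2 * m\<close> and \<open>m = Suc n\<close> removes
      the truncated subtraction.\<close>
    case even
    then obtain m where "i - q = 2 * m" by (elim evenE)
    then have m: "i = q + 2 * m" "m > 0" using even by auto
    then obtain n where n: "m = Suc n" by (cases m) auto
    have "partner q i = q + 2 * n + 1" using m n by (simp add: partner_def)
    then have "form_entry q (\<lambda>i. adj (u i) \<bullet> u i) (partner q i) j = (if i = j then e else \<zero>\<^bsub>A\<^esub>)"
      using m n by (auto simp: form_entry_def)
    then show ?thesis using eq c even by (cases "i = j") (simp_all add: coef_def)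
  qed
qed

text \<open>The degree is read off from \<open>dual q u i \<bullet> u i = e\<close>, which is
  nonzero of degree one, so the degrees of coefficient and partner need not be evaluated.\<close>

lemma dual_component:
  assumes "i \<in> {1..k}" shows "dual q u i \<in> \<Gamma> (inv\<^bsub>G\<^esub> (g i))"
proof -
  have p: "partner q i \<in> {1..k}" using partner_in assms by blast
  obtain h where h: "h \<in> carrier G" "coef q u i \<in> \<Gamma>\<^sub>D h" using coef_props assms .
  define h' where "h' = h \<otimes>\<^bsub>G\<^esub> (inv\<^bsub>G\<^esub> \<gamma> \<otimes>\<^bsub>G\<^esub> g (partner q i))"
  have h': "h' \<in> carrier G" using h u_props p by (simp add: h'_def)
  have d: "dual q u i \<in> \<Gamma> h'"
    unfolding dual_def h'_def using h adj_component u_props p by (intro component_mult) (auto simp: \<Gamma>\<^sub>D_def)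
  have "e \<in> \<Gamma> (h' \<otimes>\<^bsub>G\<^esub> g i)"
    using component_mult[OF h' u_props(1)[OF assms] d u_props(2)[OF assms]] dual_u assms by simp
  then have "h' \<otimes>\<^bsub>G\<^esub> g i = \<one>\<^bsub>G\<^esub>"
    using component_degree_unique[of "\<one>\<^bsub>G\<^esub>" "h' \<otimes>\<^bsub>G\<^esub> g i" e] e_deg e_nonzero h' u_props assms by simp
  then have "h' = inv\<^bsub>G\<^esub> (g i)" using h' u_props assms by (metis grp.inv_equality)
  then show ?thesis using d by simp
qed

text \<open>The coefficients are invertible in the corner, so the definition of \<open>dual\<close>
  can be solved for the functionals. This carries \<open>dual_frame_sum\<close> over to
  \<open>adj_frame_sum\<close>.\<close>

lemma adj_dual:
  assumes "i \<in> {1..k}"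
  shows "\<exists>l\<in>corner. adj (u i) = l \<bullet> dual q u (partner q i)"
proof -
  have p: "partner q i \<in> {1..k}" "partner q (partner q i) = i"
    using partner_in partner_partner assms by auto
  have c: "coef q u (partner q i) \<in> corner" "adj (u i) \<in> carrier A" "e \<bullet> adj (u i) = adj (u i)"
    using coef_corner p u_props(4) assms by auto
  have "\<exists>l\<in>corner. l \<bullet> coef q u (partner q i) = e"
  proof (cases "i \<le> q")
    case True
    then have i: "i \<in> {1..q}" using assms by auto
    have "inv\<^bsub>G\<^esub> \<gamma> \<otimes>\<^bsub>G\<^esub> g i \<otimes>\<^bsub>G\<^esub> g i \<in> carrier G" using u_props(1)[OF assms(1)] by simp
    then have "(adj (u i) \<bullet> u i) \<bullet> coef q u (partner q i) = e"
      using dinv_props(3)[OF _ d_props(1,2)[OF i]] True by (simp add: coef_def partner_def)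
    then show ?thesis using d_props(3)[OF i] by blast
  next
    case False
    then have "coef q u (partner q i) = e \<or> coef q u (partner q i) = \<delta> \<odot>\<^bsub>A\<^esub> e"
      using p by (auto simp: coef_def partner_def split: if_splits)
    then show ?thesis
    proof
      assume "coef q u (partner q i) = e"
      then show ?thesis using e_corner e_idem by metis
    next
      assume "coef q u (partner q i) = \<delta> \<odot>\<^bsub>A\<^esub> e"
      then have "(\<delta> \<odot>\<^bsub>A\<^esub> e) \<bullet> coef q u (partner q i) = e"
        by (simp add: a_smult_mult_left a_smult_mult_right)
      then show ?thesis using submoduleE(4)[OF corner_submodule] e_corner \<delta>_closed by blast
    qed
  qed
  then obtain l where l: "l \<in> corner" "l \<bullet> coef q u (partner q i) = e" by blast
  then have "adj (u i) = l \<bullet> (coef q u (partner q i) \<bullet> adj (u i))"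
    using c corner_closed by (simp add: a_mult_assoc[symmetric])
  then show ?thesis using l p by (auto simp: dual_def)
qed

text \<open>Left multiplication by this element is the orthogonal projection of
  \<open>A \<bullet> e\<close> onto the right \<open>D\<close>-span of the
  \<open>u i\<close>.\<close>

definition frame_sum where "frame_sum = (\<Oplus>\<^bsub>A\<^esub>i\<in>{1..k}. u i \<bullet> dual q u i)"

lemma frame_sum_component: "frame_sum \<in> \<Gamma> \<one>\<^bsub>G\<^esub>"
  unfolding frame_sum_def
proof (rule finsum_in_submodule[OF component_subspace])
  fix i assume "i \<in> {1..k}"
  then show "u i \<bullet> dual q u i \<in> \<Gamma> \<one>\<^bsub>G\<^esub>"
    using component_mult[OF _ _ u_props(2)[of i] dual_component[of i]] u_props(1) by simp
qed simp

lemma frame_sum_closed [simp]: "frame_sum \<in> carrier A"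
  using frame_sum_component component_closed by blast

lemma dual_frame_sum: 
  assumes "i \<in> {1..k}" shows "dual q u i \<bullet> frame_sum = dual q u i"
proof -
  have "dual q u i \<bullet> frame_sum = (\<Oplus>\<^bsub>A\<^esub>j\<in>{1..k}. dual q u i \<bullet> (u j \<bullet> dual q u j))"
    unfolding frame_sum_def using assms u_props(4) by (intro a_mult_finsum_right) auto
  also have "\<dots> = (\<Oplus>\<^bsub>A\<^esub>j\<in>{1..k}. if j = i then dual q u i else \<zero>\<^bsub>A\<^esub>)"
    using assms u_props(4) dual_u dual_left
    by (intro M.finsum_cong') (auto simp: a_mult_assoc[symmetric])
  also have "\<dots> = dual q u i" using assms by (intro finsum_single) auto
  finally show ?thesis .
qed

lemma adj_frame_sum: 
  assumes "i \<in> {1..k}" shows "adj (u i) \<bullet> frame_sum = adj (u i)"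
proof -
  obtain l where l: "l \<in> corner" "adj (u i) = l \<bullet> dual q u (partner q i)" using adj_dual assms by blast
  have "partner q i \<in> {1..k}" using partner_in assms by blast
  then show ?thesis using l dual_frame_sum corner_closed by (simp add: a_mult_assoc)
qed

text \<open>The Gram-Schmidt correction. Degrees survive because \<open>frame_sum\<close> has degree
  one, and orthogonality holds because \<open>adj (u i)\<close> is unchanged by
  \<open>frame_sum\<close> on its right.\<close>

lemma residual_props:
  assumes "h \<in> carrier G" "x \<in> \<Gamma> h" "x \<bullet> e = x"
  shows "x \<ominus>\<^bsub>A\<^esub> frame_sum \<bullet> x \<in> \<Gamma> h" "(x \<ominus>\<^bsub>A\<^esub> frame_sum \<bullet> x) \<bullet> e = x \<ominus>\<^bsub>A\<^esub> frame_sum \<bullet> x"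
    "i \<in> {1..k} \<Longrightarrow> adj (u i) \<bullet> (x \<ominus>\<^bsub>A\<^esub> frame_sum \<bullet> x) = \<zero>\<^bsub>A\<^esub>"
proof -
  have x: "x \<in> carrier A" using assms component_closed by blast
  have "frame_sum \<bullet> x \<in> \<Gamma> h" using component_mult[OF _ assms(1) frame_sum_component assms(2)] assms(1) by simp
  then show "x \<ominus>\<^bsub>A\<^esub> frame_sum \<bullet> x \<in> \<Gamma> h" using component_diff assms by blast
  show "(x \<ominus>\<^bsub>A\<^esub> frame_sum \<bullet> x) \<bullet> e = x \<ominus>\<^bsub>A\<^esub> frame_sum \<bullet> x"
    using x assms by (simp add: a_mult_diff_left a_mult_assoc)
  assume i: "i \<in> {1..k}"
  have "adj (u i) \<bullet> (frame_sum \<bullet> x) = adj (u i) \<bullet> x"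
    using x u_props(4)[OF i] adj_frame_sum[OF i] by (simp add: a_mult_assoc[symmetric])
  then show "adj (u i) \<bullet> (x \<ominus>\<^bsub>A\<^esub> frame_sum \<bullet> x) = \<zero>\<^bsub>A\<^esub>"
    using x u_props(4)[OF i] by (simp add: a_mult_diff_right diff_eq_zero_iff)
qed

lemma annihilator_frame_sum:
  assumes "w \<in> carrier A" "\<And>i. i \<in> {1..k} \<Longrightarrow> w \<bullet> u i = \<zero>\<^bsub>A\<^esub>"
  shows "w \<bullet> frame_sum = \<zero>\<^bsub>A\<^esub>"
proof -
  have "w \<bullet> frame_sum = (\<Oplus>\<^bsub>A\<^esub>j\<in>{1..k}. w \<bullet> (u j \<bullet> dual q u j))"
    unfolding frame_sum_def using assms u_props(4) by (intro a_mult_finsum_right) auto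
  also have "\<dots> = (\<Oplus>\<^bsub>A\<^esub>j\<in>{1..k}. \<zero>\<^bsub>A\<^esub>)"
    using assms u_props(4) by (intro M.finsum_cong') (auto simp: a_mult_assoc[symmetric])
  finally show ?thesis by simp
qed

end

section \<open>Extending an adapted family by an anisotropic vector or by a hyperbolic pair\<close>

lemma adapted_extend_symmetric:
  assumes good: "adapted q 0 u g" and x: "h \<in> carrier G" "x \<in> \<Gamma> h" "x \<bullet> e = x" "adj x \<bullet> x \<noteq> \<zero>\<^bsub>A\<^esub>"
    and orth: "\<And>i. i \<in> {1..q} \<Longrightarrow> adj (u i) \<bullet> x = \<zero>\<^bsub>A\<^esub>"
  shows "adapted (Suc q) 0 (u(Suc q := x)) (g(Suc q := h))"
proof -
  have xc: "x \<in> carrier A" using x component_closed by blast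
  have u: "g i \<in> carrier G" "u i \<in> \<Gamma> (g i)" "u i \<bullet> e = u i" "u i \<in> carrier A" if "i \<in> {1..q}" for i
    using u_props[OF good] that by auto
  have orth': "adj x \<bullet> u i = \<zero>\<^bsub>A\<^esub>" if "i \<in> {1..q}" for i
    using form_zero_sym[of "u i" x] u orth xc that by blast
  have old: "adj (u i) \<bullet> u j = (if i = j then adj (u i) \<bullet> u i else \<zero>\<^bsub>A\<^esub>)" if "i \<in> {1..q}" "j \<in> {1..q}" for i j
    using form_eq_entry[OF good, of i j] that by (auto simp: form_entry_def)
  have nz: "adj (u i) \<bullet> u i \<noteq> \<zero>\<^bsub>A\<^esub>" if "i \<in> {1..q}" for i using d_props(2)[OF good that] .
  have split: "i \<in> {1..Suc q} \<longleftrightarrow> i \<in> {1..q} \<or> i = Suc q" for i by auto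
  \<comment> \<open>Without pairs only the diagonal clause applies; the others need an index beyond
    \<open>Suc q\<close>.\<close>
  have form_entry: "form_entry (Suc q) f i j = (if i = j then f i else \<zero>\<^bsub>A\<^esub>)" if "i \<in> {1..Suc q}" "j \<in> {1..Suc q}" for f i j
    using that by (auto simp: form_entry_def)
  have form: "adj ((u(Suc q := x)) i) \<bullet> (u(Suc q := x)) j =
      form_entry (Suc q) (\<lambda>i. adj ((u(Suc q := x)) i) \<bullet> (u(Suc q := x)) i) i j"
    if ij: "i \<in> {1..Suc q}" "j \<in> {1..Suc q}" for i j
  proof -
    consider "i \<in> {1..q}" "j \<in> {1..q}" | "i \<in> {1..q}" "j = Suc q" | "i = Suc q" "j \<in> {1..q}"
      | "i = Suc q" "j = Suc q" using ij split by blast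
    then show ?thesis
    proof cases
      case 1
      then show ?thesis unfolding form_entry[OF ij] using old[OF 1] by (cases "i = j") auto
    next
      case 2
      then show ?thesis unfolding form_entry[OF ij] using orth[of i] by auto
    next
      case 3
      then show ?thesis unfolding form_entry[OF ij] using orth'[of j] by auto
    next
      case 4
      then show ?thesis unfolding form_entry[OF ij] by simp
    qed
  qed
  show ?thesis
    unfolding adapted_def
  proof (intro conjI ballI)
    fix i assume "i \<in> {1..Suc q + 2 * 0}"
    then have "i \<in> {1..q} \<or> i = Suc q" by auto
    then show "(g(Suc q := h)) i \<in> carrier G" "(u(Suc q := x)) i \<in> \<Gamma> ((g(Suc q := h)) i)"
      "(u(Suc q := x)) i \<bullet> e = (u(Suc q := x)) i" using u x by auto
  next
    fix i assume "i \<in> {1..Suc q}"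
    then have "i \<in> {1..q} \<or> i = Suc q" by auto
    then show "adj ((u(Suc q := x)) i) \<bullet> (u(Suc q := x)) i \<noteq> \<zero>\<^bsub>A\<^esub>" using nz x by auto
  qed (use form in simp)
qed

lemma adapted_extend_pair:
  assumes good: "adapted q s u g" and x: "h \<in> carrier G" "x \<in> \<Gamma> h" "x \<bullet> e = x" "adj x \<bullet> x = \<zero>\<^bsub>A\<^esub>"
    and z: "h' \<in> carrier G" "z \<in> \<Gamma> h'" "z \<bullet> e = z" "adj z \<bullet> z = \<zero>\<^bsub>A\<^esub>"
    and xz: "adj x \<bullet> z = e"
    and orth: "\<And>i. i \<in> {1..q + 2 * s} \<Longrightarrow> adj (u i) \<bullet> x = \<zero>\<^bsub>A\<^esub>"
      "\<And>i. i \<in> {1..q + 2 * s} \<Longrightarrow> adj (u i) \<bullet> z = \<zero>\<^bsub>A\<^esub>"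
  shows "adapted q (Suc s) (u(q + 2 * s + 1 := x, q + 2 * s + 2 := z)) (g(q + 2 * s + 1 := h, q + 2 * s + 2 := h'))"
proof -
  define k where "k = q + 2 * s"
  have xc: "x \<in> carrier A" "z \<in> carrier A" using x z component_closed by blast+
  have u: "g i \<in> carrier G" "u i \<in> \<Gamma> (g i)" "u i \<bullet> e = u i" "u i \<in> carrier A" if "i \<in> {1..k}" for i
    using u_props[OF good] that by (auto simp: k_def)
  have orth': "adj x \<bullet> u i = \<zero>\<^bsub>A\<^esub>" "adj z \<bullet> u i = \<zero>\<^bsub>A\<^esub>" if "i \<in> {1..k}" for i
    using form_zero_sym[of "u i" x] form_zero_sym[of "u i" z] u orth xc that by (auto simp: k_def)
  \<comment> \<open>The lower entry of the block is forced: hermitian symmetry and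
    \<open>\<phi>\<^sub>0 e = e\<close> derive it from the upper one.\<close>
  have "\<phi>\<^sub>0 (adj x \<bullet> z) = \<delta> \<odot>\<^bsub>A\<^esub> (adj z \<bullet> x)" using \<phi>\<^sub>0_form x xc by blast
  then have "\<delta> \<odot>\<^bsub>A\<^esub> (\<phi>\<^sub>0 e) = adj z \<bullet> x" using xz xc by simp
  moreover have "\<phi>\<^sub>0 e = e" by (simp add: \<phi>\<^sub>0_def)
  ultimately have zx: "adj z \<bullet> x = \<delta> \<odot>\<^bsub>A\<^esub> e" by simp
  define u' where "u' = u(k + 1 := x, k + 2 := z)"
  define g' where "g' = g(k + 1 := h, k + 2 := h')"
  have u'_simps: "u' (k + 1) = x" "u' (k + 2) = z" "g' (k + 1) = h" "g' (k + 2) = h'"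
    and u'_old: "\<And>i. i \<in> {1..k} \<Longrightarrow> u' i = u i \<and> g' i = g i" by (auto simp: u'_def g'_def)
  have split: "i \<in> {1..k + 2} \<longleftrightarrow> i \<in> {1..k} \<or> i = k + 1 \<or> i = k + 2" for i by auto
  have nz: "adj (u i) \<bullet> u i \<noteq> \<zero>\<^bsub>A\<^esub>" if "i \<in> {1..q}" for i using d_props(2)[OF good that] .
  have form: "adj (u' i) \<bullet> u' j = form_entry q (\<lambda>i. adj (u' i) \<bullet> u' i) i j"
    if ij: "i \<in> {1..k + 2}" "j \<in> {1..k + 2}" for i j
  proof -
    have old: "form_entry q (\<lambda>i. adj (u i) \<bullet> u i) i j = form_entry q (\<lambda>i. adj (u' i) \<bullet> u' i) i j"
      if "i \<in> {1..k}" using that u'_old by (simp add: form_entry_def)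
    \<comment> \<open>\<open>k - q\<close> is even, so a new block starts at \<open>k + 1\<close>
      and no block joins old indices with new ones.\<close>
    have p1: "form_entry q f i j = \<zero>\<^bsub>A\<^esub>" if "i \<in> {1..k}" "j = k + 1 \<or> j = k + 2" for f
      using that unfolding form_entry_def k_def by (auto elim!: oddE; presburger)
    have p2: "form_entry q f i j = \<zero>\<^bsub>A\<^esub>" if "j \<in> {1..k}" "i = k + 1 \<or> i = k + 2" for f
      using that unfolding form_entry_def k_def by (auto elim!: oddE; presburger)
    have p3: "form_entry q f i j = (if i = k + 1 \<and> j = k + 2 then e else if i = k + 2 \<and> j = k + 1 then \<delta> \<odot>\<^bsub>A\<^esub> e else \<zero>\<^bsub>A\<^esub>)"
      if "j = k + 1 \<or> j = k + 2" "i = k + 1 \<or> i = k + 2" for f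
      using that unfolding form_entry_def k_def by auto
    consider "i \<in> {1..k}" "j \<in> {1..k}" | "i \<in> {1..k}" "j = k + 1 \<or> j = k + 2"
      | "i = k + 1 \<or> i = k + 2" "j \<in> {1..k}"
      | "i = k + 1 \<or> i = k + 2" "j = k + 1 \<or> j = k + 2" using ij split by blast
    then show ?thesis
    proof cases
      case 1
      then show ?thesis using u'_old[of i] u'_old[of j] form_eq_entry[OF good, of i j] old by (simp add: k_def)
    next
      case 2
      then show ?thesis using p1 u'_old u'_simps orth by (auto simp: k_def)
    next
      case 3
      then show ?thesis using p2 u'_old u'_simps orth' by auto
    next
      case 4
      then show ?thesis using p3 u'_simps x z xz zx by auto
    qed
  qed
  have "adapted q (Suc s) u' g'"
    unfolding adapted_def
  proof (intro conjI ballI)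
    fix i assume "i \<in> {1..q + 2 * Suc s}"
    then have "i \<in> {1..k} \<or> i = k + 1 \<or> i = k + 2" by (auto simp: k_def)
    then show "g' i \<in> carrier G" "u' i \<in> \<Gamma> (g' i)" "u' i \<bullet> e = u' i" using u u'_old u'_simps x z by auto
  next
    fix i assume "i \<in> {1..q}"
    then show "adj (u' i) \<bullet> u' i \<noteq> \<zero>\<^bsub>A\<^esub>" using nz u'_old by (simp add: k_def)
  qed (use form in \<open>simp add: k_def\<close>)
  then show ?thesis by (simp add: u'_def g'_def k_def)
qed

text \<open>The measure of progress in both minimality arguments below. Adding \<open>x\<close>, or
  a pair \<open>x\<close>, \<open>z\<close>, makes it strictly smaller: \<open>adj x\<close>
  annihilates the old vectors, but not \<open>x\<close>, respectively \<open>z\<close>.\<close>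

definition left_annihilator where "left_annihilator n u = {r \<in> carrier A. \<forall>i\<in>{1..n}. r \<bullet> u i = \<zero>\<^bsub>A\<^esub>}" for n :: nat

lemma left_annihilator_graded_left_ideal:
  assumes "adapted q s u g" shows "graded_left_ideal F A G \<Gamma> (left_annihilator (q + 2 * s) u)"
  unfolding left_annihilator_def
  using u_props(1,2)[OF assms] by (intro graded_left_ideal_annihilator graded_left_ideal_carrier) blast

text \<open>A family with minimal left annihilator admits no further anisotropic vector. Only
  \<open>s = 0\<close> is considered, since these vectors must take the indices \<open>1..q\<close>,
  in front of all pairs.\<close>

lemma exists_maximal_symmetric:
  obtains q u g where "adapted q 0 u g"
    "\<And>h x. h \<in> carrier G \<Longrightarrow> x \<in> \<Gamma> h \<Longrightarrow> x \<bullet> e = x \<Longrightarrow>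
      (\<And>i. i \<in> {1..q} \<Longrightarrow> adj (u i) \<bullet> x = \<zero>\<^bsub>A\<^esub>) \<Longrightarrow> adj x \<bullet> x = \<zero>\<^bsub>A\<^esub>"
proof -
  let ?S = "{left_annihilator q u |q u g. adapted q 0 u g}"
  have ne: "?S \<noteq> {}" using adapted_empty by blast
  have ideals: "graded_left_ideal F A G \<Gamma> I" if IS: "I \<in> ?S" for I
  proof -
    obtain q u g where I: "I = left_annihilator q u" "adapted q 0 u g" using IS by auto
    show ?thesis using left_annihilator_graded_left_ideal[OF I(2)] I(1) by simp
  qed
  obtain I where I: "I \<in> ?S" "\<forall>J\<in>?S. \<not> J \<subset> I"
    by (rule bexE[OF dcc_minimal[OF ne ideals]])
  obtain q u g where good: "adapted q 0 u g" and Iu: "I = left_annihilator q u"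
    using I(1) by auto
  have min: "\<And>J. J \<in> ?S \<Longrightarrow> \<not> J \<subset> left_annihilator q u" using I(2) unfolding Iu by (rule bspec)
  have "adj x \<bullet> x = \<zero>\<^bsub>A\<^esub>" if x: "h \<in> carrier G" "x \<in> \<Gamma> h" "x \<bullet> e = x"
    and orth: "\<And>i. i \<in> {1..q} \<Longrightarrow> adj (u i) \<bullet> x = \<zero>\<^bsub>A\<^esub>" for h x
  proof (rule ccontr)
    assume nz: "adj x \<bullet> x \<noteq> \<zero>\<^bsub>A\<^esub>"
    have xc: "x \<in> carrier A" using x component_closed by blast
    have "adapted (Suc q) 0 (u(Suc q := x)) (g(Suc q := h))"
      using adapted_extend_symmetric good x nz orth by blast
    then have "\<not> left_annihilator (Suc q) (u(Suc q := x)) \<subset> left_annihilator q u" by (intro min) blast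
    moreover have "left_annihilator (Suc q) (u(Suc q := x)) \<subseteq> left_annihilator q u"
    proof
      fix r assume r: "r \<in> left_annihilator (Suc q) (u(Suc q := x))"
      have "r \<bullet> u i = \<zero>\<^bsub>A\<^esub>" if "i \<in> {1..q}" for i
      proof -
        have i: "i \<in> {1..Suc q}" "(u(Suc q := x)) i = u i" using that by auto
        have "\<forall>i\<in>{1..Suc q}. r \<bullet> (u(Suc q := x)) i = \<zero>\<^bsub>A\<^esub>" using r unfolding left_annihilator_def by blast
        from bspec[OF this i(1)] show ?thesis unfolding i(2) .
      qed
      then show "r \<in> left_annihilator q u" using r by (simp add: left_annihilator_def)
    qed
    moreover have "adj x \<in> left_annihilator q u"
      using xc form_zero_sym[of "u _" x] u_props[OF good] orth by (auto simp: left_annihilator_def)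
    moreover have "adj x \<notin> left_annihilator (Suc q) (u(Suc q := x))" using nz by (auto simp: left_annihilator_def)
    ultimately show False by blast
  qed
  then show thesis using that good by blast
qed

definition complete where
  "complete k u \<longleftrightarrow> (\<forall>h\<in>carrier G. \<forall>x\<in>\<Gamma> h. x \<bullet> e = x \<longrightarrow>
     (\<forall>i\<in>{1..k}. adj (u i) \<bullet> x = \<zero>\<^bsub>A\<^esub>) \<longrightarrow> x = \<zero>\<^bsub>A\<^esub>)" for k :: nat

text \<open>The maximal anisotropic part is kept and the annihilator is minimised again, now over
  the added pairs. Nondegeneracy, a consequence of primeness, gives any vector left over a
  partner.\<close>

lemma exists_basis:
  obtains q s u g where "adapted q s u g" "complete (q + 2 * s) u"
proof -
  obtain q u0 g0 where good0: "adapted q 0 u0 g0"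
    and alt0: "\<And>h x. h \<in> carrier G \<Longrightarrow> x \<in> \<Gamma> h \<Longrightarrow> x \<bullet> e = x \<Longrightarrow>
      (\<And>i. i \<in> {1..q} \<Longrightarrow> adj (u0 i) \<bullet> x = \<zero>\<^bsub>A\<^esub>) \<Longrightarrow> adj x \<bullet> x = \<zero>\<^bsub>A\<^esub>"
    using exists_maximal_symmetric by blast
  \<comment> \<open>Freezing the first \<open>q\<close> vectors keeps \<open>alt0\<close> available:
    orthogonality to the whole family includes orthogonality to the \<open>u0 i\<close>.\<close>
  let ?S = "{left_annihilator (q + 2 * s) u |s u g. adapted q s u g \<and> (\<forall>i\<in>{1..q}. u i = u0 i)}"
  have ne: "?S \<noteq> {}" using good0 by blast
  have ideals: "graded_left_ideal F A G \<Gamma> I" if IS: "I \<in> ?S" for I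
  proof -
    obtain s u g where I: "I = left_annihilator (q + 2 * s) u" "adapted q s u g" using IS by auto
    show ?thesis using left_annihilator_graded_left_ideal[OF I(2)] I(1) by simp
  qed
  obtain I where I: "I \<in> ?S" "\<forall>J\<in>?S. \<not> J \<subset> I"
    by (rule bexE[OF dcc_minimal[OF ne ideals]])
  obtain s u g where good: "adapted q s u g" and u0: "\<And>i. i \<in> {1..q} \<Longrightarrow> u i = u0 i"
    and Iu: "I = left_annihilator (q + 2 * s) u" using I(1) by auto
  have min: "\<And>J. J \<in> ?S \<Longrightarrow> \<not> J \<subset> left_annihilator (q + 2 * s) u" using I(2) unfolding Iu by (rule bspec)
  define k where "k = q + 2 * s"
  have alt: "adj x \<bullet> x = \<zero>\<^bsub>A\<^esub>" if "h \<in> carrier G" "x \<in> \<Gamma> h" "x \<bullet> e = x"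
    and "\<And>i. i \<in> {1..k} \<Longrightarrow> adj (u i) \<bullet> x = \<zero>\<^bsub>A\<^esub>" for h x
  proof (rule alt0[OF that(1-3)])
    fix i assume "i \<in> {1..q}"
    then show "adj (u0 i) \<bullet> x = \<zero>\<^bsub>A\<^esub>" using that(4)[of i] u0[of i] by (simp add: k_def)
  qed
  have "x = \<zero>\<^bsub>A\<^esub>" if x: "h \<in> carrier G" "x \<in> \<Gamma> h" "x \<bullet> e = x"
    and orth: "\<And>i. i \<in> {1..k} \<Longrightarrow> adj (u i) \<bullet> x = \<zero>\<^bsub>A\<^esub>" for h x
  proof (rule ccontr)
    assume nz: "x \<noteq> \<zero>\<^bsub>A\<^esub>"
    have xc: "x \<in> carrier A" using x component_closed by blast
    have bx_deg: "adj x \<in> \<Gamma> (inv\<^bsub>G\<^esub> \<gamma> \<otimes>\<^bsub>G\<^esub> h)" using adj_component x by blast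
    \<comment> \<open>\<open>c\<close> recovers \<open>\<phi> x\<close> from \<open>adj x\<close>,
      so a nonzero vector has a nonzero functional.\<close>
    have "c \<bullet> adj x = \<phi> (x \<bullet> e)" using xc by (simp add: adj_def invol_mult)
    then have bx_nz: "adj x \<noteq> \<zero>\<^bsub>A\<^esub>" using nz xc x(3) invol_eq_zero_iff[OF xc] by auto
    have deg: "inv\<^bsub>G\<^esub> \<gamma> \<otimes>\<^bsub>G\<^esub> h \<in> carrier G" using x by simp
    \<comment> \<open>Primeness makes the functional nonzero on some vector
      \<open>r \<bullet> e\<close>; the inverse \<open>w\<close> of the value then normalises it to
      \<open>e\<close>.\<close>
    obtain p r where r: "p \<in> carrier G" "r \<in> \<Gamma> p" "adj x \<bullet> (r \<bullet> e) \<noteq> \<zero>\<^bsub>A\<^esub>"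
      using exists_homogeneous_middle[OF deg bx_deg bx_nz e_closed e_nonzero] .
    have rc: "r \<in> carrier A" using r component_closed by blast
    have re: "r \<bullet> e \<in> \<Gamma> p" "r \<bullet> e \<bullet> e = r \<bullet> e" using component_mult[of p "\<one>\<^bsub>G\<^esub>" r e] r e_deg rc by (simp_all add: a_mult_assoc)
    have "adj x \<bullet> (r \<bullet> e) \<in> \<Gamma>\<^sub>D (inv\<^bsub>G\<^esub> \<gamma> \<otimes>\<^bsub>G\<^esub> h \<otimes>\<^bsub>G\<^esub> p)" using form_component x r re by blast
    then obtain w where w: "w \<in> \<Gamma>\<^sub>D (inv\<^bsub>G\<^esub> (inv\<^bsub>G\<^esub> \<gamma> \<otimes>\<^bsub>G\<^esub> h \<otimes>\<^bsub>G\<^esub> p))" "adj x \<bullet> (r \<bullet> e) \<bullet> w = e"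
      using corner_inverse[of "inv\<^bsub>G\<^esub> \<gamma> \<otimes>\<^bsub>G\<^esub> h \<otimes>\<^bsub>G\<^esub> p" "adj x \<bullet> (r \<bullet> e)"] r x by auto
    have wc: "w \<in> carrier A" "w \<bullet> e = w" using w by (auto simp: \<Gamma>\<^sub>D_def corner_def)
    define h1 where "h1 = p \<otimes>\<^bsub>G\<^esub> inv\<^bsub>G\<^esub> (inv\<^bsub>G\<^esub> \<gamma> \<otimes>\<^bsub>G\<^esub> h \<otimes>\<^bsub>G\<^esub> p)"
    define z1 where "z1 = r \<bullet> e \<bullet> w"
    have h1: "h1 \<in> carrier G" using r x by (simp add: h1_def)
    have z1: "z1 \<in> \<Gamma> h1" "z1 \<bullet> e = z1" "z1 \<in> carrier A"
      using component_mult[OF _ _ re(1), of "inv\<^bsub>G\<^esub> (inv\<^bsub>G\<^esub> \<gamma> \<otimes>\<^bsub>G\<^esub> h \<otimes>\<^bsub>G\<^esub> p)" w] w r x wc rc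
      by (auto simp: z1_def h1_def \<Gamma>\<^sub>D_def a_mult_assoc)
    have xz1: "adj x \<bullet> z1 = e" using w(2) xc rc wc by (simp add: z1_def a_mult_assoc)
    have bxu: "adj x \<bullet> u i = \<zero>\<^bsub>A\<^esub>" if "i \<in> {1..k}" for i
      using form_zero_sym[of "u i" x] u_props[OF good] orth xc that by (auto simp: k_def)
    \<comment> \<open>Projecting \<open>z1\<close> off the family leaves the value \<open>e\<close>
      intact, because \<open>adj x\<close> annihilates every \<open>u i\<close>.\<close>
    define z where "z = z1 \<ominus>\<^bsub>A\<^esub> frame_sum q s u \<bullet> z1"
    have z: "z \<in> \<Gamma> h1" "z \<bullet> e = z" "\<And>i. i \<in> {1..k} \<Longrightarrow> adj (u i) \<bullet> z = \<zero>\<^bsub>A\<^esub>"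
      using residual_props[OF good h1 z1(1,2)] by (auto simp: z_def k_def)
    have "adj x \<bullet> (frame_sum q s u \<bullet> z1) = \<zero>\<^bsub>A\<^esub>"
      using annihilator_frame_sum[OF good, of "adj x"] bxu xc z1 frame_sum_closed[OF good]
      by (simp add: a_mult_assoc[symmetric] k_def)
    then have xz: "adj x \<bullet> z = e"
      using xz1 xc z1 frame_sum_closed[OF good] by (simp add: z_def a_mult_diff_right) (simp add: a_minus_def)
    let ?u = "u(q + 2 * s + 1 := x, q + 2 * s + 2 := z)"
    \<comment> \<open>\<open>x\<close> and \<open>z\<close> are homogeneous and orthogonal to the
      family, so \<open>alt\<close> makes both isotropic, and \<open>z\<close> needs no multiple of
      \<open>x\<close> subtracted.\<close>
    have "adapted q (Suc s) ?u (g(q + 2 * s + 1 := h, q + 2 * s + 2 := h1))"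
      using alt[OF x orth] alt[OF h1 z] xz orth z(3)
      by (intro adapted_extend_pair[OF good x _ h1 z(1,2)]) (auto simp: k_def)
    moreover have "\<forall>i\<in>{1..q}. ?u i = u0 i" using u0 by auto
    ultimately have "\<not> left_annihilator (q + 2 * Suc s) ?u \<subset> left_annihilator (q + 2 * s) u" by (intro min) blast
    moreover have "left_annihilator (q + 2 * Suc s) ?u \<subseteq> left_annihilator (q + 2 * s) u"
    proof
      fix r assume r: "r \<in> left_annihilator (q + 2 * Suc s) ?u"
      have "r \<bullet> u i = \<zero>\<^bsub>A\<^esub>" if "i \<in> {1..k}" for i
      proof -
        have i: "i \<in> {1..q + 2 * Suc s}" "?u i = u i" using that by (auto simp: k_def)
        have "\<forall>i\<in>{1..q + 2 * Suc s}. r \<bullet> ?u i = \<zero>\<^bsub>A\<^esub>" using r unfolding left_annihilator_def by blast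
        from bspec[OF this i(1)] show ?thesis unfolding i(2) .
      qed
      then show "r \<in> left_annihilator (q + 2 * s) u" using r by (simp add: left_annihilator_def k_def)
    qed
    moreover have "adj x \<in> left_annihilator (q + 2 * s) u" using xc bxu by (simp add: left_annihilator_def k_def)
    moreover have "adj x \<notin> left_annihilator (q + 2 * Suc s) ?u"
    proof
      assume "adj x \<in> left_annihilator (q + 2 * Suc s) ?u"
      then have "adj x \<bullet> ?u (q + 2 * s + 2) = \<zero>\<^bsub>A\<^esub>" unfolding left_annihilator_def by force
      then show False using xz e_nonzero by simp
    qed
    ultimately show False by blast
  qed
  then have "complete (q + 2 * s) u" unfolding complete_def k_def by blast
  then show thesis using that good by blast
qed

text \<open>Completeness makes all residuals in \<open>A \<bullet> e\<close> vanish, which gives a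
  left unit there. For homogeneous \<open>y\<close> the residual then kills
  \<open>A \<bullet> e\<close> and is zero by primeness, which gives a left unit on
  \<open>A\<close>. Finally \<open>x\<close> minus \<open>x \<bullet> frame_sum\<close> kills
  \<open>A\<close>, so \<open>annihilator_zero\<close> makes the unit two-sided.\<close>

lemma frame_sum_unit:
  assumes good: "adapted q s u g"
    and complete: "complete (q + 2 * s) u"
    and x: "x \<in> carrier A"
  shows "frame_sum q s u \<bullet> x = x" "x \<bullet> frame_sum q s u = x"
proof -
  let ?frame_sum = "frame_sum q s u"
  note [simp] = frame_sum_closed[OF good]
  have 1: "?frame_sum \<bullet> (w \<bullet> e) = w \<bullet> e" if w: "w \<in> carrier A" for w
  proof -
    have "w \<in> {w \<in> carrier A. ?frame_sum \<bullet> (w \<bullet> e) = w \<bullet> e}"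
    proof (rule mem_submodule_if_homogeneous[OF _ _ w])
      show "submodule {w \<in> carrier A. ?frame_sum \<bullet> (w \<bullet> e) = w \<bullet> e} F A"
        by (intro subspaceI) (auto simp: a_mult_distl a_mult_distr a_smult_mult_left a_smult_mult_right)
      fix h y assume y: "h \<in> carrier G" "y \<in> \<Gamma> h"
      then have yc: "y \<in> carrier A" using component_closed by blast
      have ye: "y \<bullet> e \<in> \<Gamma> h" "y \<bullet> e \<bullet> e = y \<bullet> e"
        using component_mult[of h "\<one>\<^bsub>G\<^esub>" y e] y e_deg yc by (simp_all add: a_mult_assoc)
      have "y \<bullet> e \<ominus>\<^bsub>A\<^esub> ?frame_sum \<bullet> (y \<bullet> e) = \<zero>\<^bsub>A\<^esub>"
        using complete residual_props[OF good y(1) ye] y(1) unfolding complete_def by blast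
      then show "y \<in> {w \<in> carrier A. ?frame_sum \<bullet> (w \<bullet> e) = w \<bullet> e}" using yc by (simp add: diff_eq_zero_iff)
    qed
    then show ?thesis by simp
  qed
  have 2: "?frame_sum \<bullet> w = w" if w: "w \<in> carrier A" for w
  proof -
    have "w \<in> {w \<in> carrier A. ?frame_sum \<bullet> w = w}"
    proof (rule mem_submodule_if_homogeneous[OF _ _ w])
      show "submodule {w \<in> carrier A. ?frame_sum \<bullet> w = w} F A"
        by (intro subspaceI) (auto simp: a_mult_distr a_smult_mult_right)
      fix h y assume y: "h \<in> carrier G" "y \<in> \<Gamma> h"
      then have yc: "y \<in> carrier A" using component_closed by blast
      have "?frame_sum \<bullet> y \<in> \<Gamma> h" using component_mult[OF _ y(1) frame_sum_component[OF good] y(2)] y by simp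
      then have d: "y \<ominus>\<^bsub>A\<^esub> ?frame_sum \<bullet> y \<in> \<Gamma> h" using component_diff y by blast
      have "(y \<ominus>\<^bsub>A\<^esub> ?frame_sum \<bullet> y) \<bullet> (r \<bullet> e) = \<zero>\<^bsub>A\<^esub>" if r: "r \<in> carrier A" for r
        using 1[of "y \<bullet> r"] yc r by (simp add: a_mult_diff_left a_mult_assoc diff_eq_zero_iff)
      then have "y \<ominus>\<^bsub>A\<^esub> ?frame_sum \<bullet> y = \<zero>\<^bsub>A\<^esub>"
        using graded_prime[OF y(1) d, of e] e_nonzero by simp
      then show "y \<in> {w \<in> carrier A. ?frame_sum \<bullet> w = w}" using yc by (simp add: diff_eq_zero_iff)
    qed
    then show ?thesis by simp
  qed
  show "?frame_sum \<bullet> x = x" using 2 x .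
  have "x \<ominus>\<^bsub>A\<^esub> x \<bullet> ?frame_sum = \<zero>\<^bsub>A\<^esub>"
  proof (rule annihilator_zero)
    fix r assume "r \<in> carrier A"
    then show "(x \<ominus>\<^bsub>A\<^esub> x \<bullet> ?frame_sum) \<bullet> r = \<zero>\<^bsub>A\<^esub>"
      using x 2 by (simp add: a_mult_diff_left a_mult_assoc diff_eq_zero_iff)
  qed (use x in simp)
  then show "x \<bullet> ?frame_sum = x" using x by (simp add: diff_eq_zero_iff)
qed

end

section \<open>The grading group\<close>

text \<open>All relators have the same image \<gamma>, so their quotients lie in the kernel and the
  map factors through the quotient group. The carrier memberships are exported to evaluate \<alpha>
  on products of generators.\<close>

lemma (in comm_group) tilde_group_universal:
  fixes q s :: nat
  assumes S: "subgroup S G" and T: "T = G\<lparr>carrier := S\<rparr>"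
    and t: "\<And>i. i \<in> {1..q} \<Longrightarrow> t i \<in> S"
    and p: "\<And>i. i \<in> {1..q + 2 * s} \<Longrightarrow> p i \<in> carrier G"
    and sq: "\<And>i. i \<in> {1..q} \<Longrightarrow> p i \<otimes> p i \<otimes> inv (t i) = \<gamma>"
    and pair: "\<And>m. m \<in> {1..s} \<Longrightarrow> p (q + 2 * m - 1) \<otimes> p (q + 2 * m) = \<gamma>"
  obtains \<alpha> where "group (tilde_group T q s t)" "\<alpha> \<in> hom (tilde_group T q s t) G"
    "\<And>i. i \<in> {1..q + 2 * s} \<Longrightarrow> tilde_gen T q s t i \<in> carrier (tilde_group T q s t)"
    "\<And>u. u \<in> S \<Longrightarrow> tilde_emb T q s t u \<in> carrier (tilde_group T q s t)"
    "\<And>i. i \<in> {1..q + 2 * s} \<Longrightarrow> \<alpha> (tilde_gen T q s t i) = p i"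
    "\<And>u. u \<in> S \<Longrightarrow> \<alpha> (tilde_emb T q s t u) = u"
proof -
  define k where "k = q + 2 * s"
  let ?FA = "free_Abelian_group {1..k}"
  interpret FA: comm_group ?FA by (rule abelian_free_Abelian_group)
  have SG: "S \<subseteq> carrier G" using S subgroup.subset by blast
  have gT: "group T" unfolding T using subgroup.subgroup_is_group[OF S is_group] .
  have amb: "ambient T q s = ?FA \<times>\<times> T" by (simp add: ambient_def k_def)
  have T_simps: "carrier T = S" "\<one>\<^bsub>T\<^esub> = \<one>" by (simp_all add: T)
  have amb_carrier: "carrier (ambient T q s) = carrier ?FA \<times> S"
    unfolding amb by (simp add: T_simps)
  have amb_mult: "(x, u) \<otimes>\<^bsub>ambient T q s\<^esub> (y, w) = (x + y, u \<otimes> w)" for x u y w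
    unfolding amb by (simp add: T)
  interpret Amb: comm_group "ambient T q s"
  proof (rule group.group_comm_groupI)
    show "group (ambient T q s)" unfolding amb using DirProd_group FA.is_group gT by blast
    show "x \<otimes>\<^bsub>ambient T q s\<^esub> y = y \<otimes>\<^bsub>ambient T q s\<^esub> x"
      if "x \<in> carrier (ambient T q s)" "y \<in> carrier (ambient T q s)" for x y
      using that SG unfolding amb_carrier by (auto simp: amb_mult m_comm add.commute subset_iff)
  qed
  obtain h where h: "h \<in> hom ?FA G" "\<And>i. i \<in> {1..k} \<Longrightarrow> h (frag_of i) = p i"
  proof (rule free_Abelian_group_universal)
    show "p ` {1..k} \<subseteq> carrier G" using p by (auto simp: k_def)
  qed blast
  interpret h: group_hom ?FA G h using h by unfold_locales
  \<comment> \<open>\<open>p\<close> on the free generators combined with the inclusion of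
    \<open>S\<close>; multiplicativity uses that \<open>G\<close> is commutative.\<close>
  define \<beta> where "\<beta> = (\<lambda>(x, u). h x \<otimes> u)"
  have "\<beta> \<in> hom (ambient T q s) G"
  proof (rule homI)
    fix x assume "x \<in> carrier (ambient T q s)"
    then show "\<beta> x \<in> carrier G" using SG h.hom_closed by (auto simp: \<beta>_def amb_carrier subset_iff)
  next
    fix x y assume "x \<in> carrier (ambient T q s)" "y \<in> carrier (ambient T q s)"
    moreover obtain x1 x2 y1 y2 where eq: "x = (x1, x2)" "y = (y1, y2)" by (cases x, cases y)
    ultimately have xy: "x = (x1, x2)" "y = (y1, y2)" "x1 \<in> carrier ?FA" "y1 \<in> carrier ?FA"
      "x2 \<in> carrier G" "y2 \<in> carrier G" using SG unfolding amb_carrier by blast+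
    have "h (x1 \<otimes>\<^bsub>?FA\<^esub> y1) = h x1 \<otimes> h y1" using h.hom_mult xy by blast
    then show "\<beta> (x \<otimes>\<^bsub>ambient T q s\<^esub> y) = \<beta> x \<otimes> \<beta> y"
      using xy h.hom_closed[OF xy(3)] h.hom_closed[OF xy(4)] by (simp add: \<beta>_def amb_mult m_ac)
  qed
  then interpret \<beta>: group_hom "ambient T q s" G \<beta> by unfold_locales
  have gen: "amb_gen T i \<in> carrier (ambient T q s)" "\<beta> (amb_gen T i) = p i" if "i \<in> {1..k}" for i
  proof -
    show "amb_gen T i \<in> carrier (ambient T q s)"
      using that subgroup.one_closed[OF S] by (simp add: amb_gen_def amb_carrier T_simps)
    show "\<beta> (amb_gen T i) = p i" using h(2)[OF that] p that by (simp add: \<beta>_def amb_gen_def T_simps k_def)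
  qed
  have emb: "amb_emb u \<in> carrier (ambient T q s)" "\<beta> (amb_emb u) = u" if "u \<in> S" for u
  proof -
    show "amb_emb u \<in> carrier (ambient T q s)" using that by (simp add: amb_emb_def amb_carrier)
    have "h 0 = \<one>" using h.hom_one by simp
    then show "\<beta> (amb_emb u) = u" using that SG by (auto simp: \<beta>_def amb_emb_def)
  qed
  have rel: "a \<in> carrier (ambient T q s) \<and> \<beta> a = \<gamma>" if "a \<in> relators T q s t" for a
    using that unfolding relators_def
  proof (elim UnE CollectE exE conjE)
    fix i assume a: "a = amb_gen T i [^]\<^bsub>ambient T q s\<^esub> (2::nat) \<otimes>\<^bsub>ambient T q s\<^esub> inv\<^bsub>ambient T q s\<^esub> amb_emb (t i)"
      and i: "i \<in> {1..q}"
    have ik: "i \<in> {1..k}" using i by (simp add: k_def)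
    have "amb_gen T i [^]\<^bsub>ambient T q s\<^esub> (2::nat) = amb_gen T i \<otimes>\<^bsub>ambient T q s\<^esub> amb_gen T i"
      using gen[OF ik] by (simp add: numeral_2_eq_2)
    then show ?thesis using a gen[OF ik] emb[OF t[OF i]] sq[OF i] by simp
  next
    fix m assume a: "a = amb_gen T (q + 2 * m - 1) \<otimes>\<^bsub>ambient T q s\<^esub> amb_gen T (q + 2 * m)"
      and m: "m \<in> {1..s}"
    have "q + 2 * m - 1 \<in> {1..k}" "q + 2 * m \<in> {1..k}" using m by (auto simp: k_def)
    then show ?thesis using a gen[of "q + 2 * m - 1"] gen[of "q + 2 * m"] pair[OF m] by simp
  qed
  let ?R = "{a \<otimes>\<^bsub>ambient T q s\<^esub> inv\<^bsub>ambient T q s\<^esub> b |a b. a \<in> relators T q s t \<and> b \<in> relators T q s t}"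
  let ?N = "relation_subgroup T q s t"
  have R: "?R \<subseteq> carrier (ambient T q s)" using rel by auto
  have N: "?N \<lhd> ambient T q s"
    unfolding relation_subgroup_def using Amb.subgroup_imp_normal[OF Amb.generate_is_subgroup[OF R]] .
  have "?R \<subseteq> kernel (ambient T q s) G \<beta>"
  proof
    fix r assume "r \<in> ?R"
    then obtain a b where ab: "a \<in> relators T q s t" "b \<in> relators T q s t"
      "r = a \<otimes>\<^bsub>ambient T q s\<^esub> inv\<^bsub>ambient T q s\<^esub> b" by blast
    then have "\<beta> r = \<gamma> \<otimes> inv \<gamma>" "\<gamma> \<in> carrier G"
      using rel[OF ab(1)] rel[OF ab(2)] \<beta>.hom_closed[of a] by auto
    then show "r \<in> kernel (ambient T q s) G \<beta>" using rel ab by (simp add: kernel_def)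
  qed
  then have "?N \<subseteq> kernel (ambient T q s) G \<beta>"
    unfolding relation_subgroup_def by (rule Amb.generate_subgroup_incl[OF _ \<beta>.subgroup_kernel])
  from \<beta>.FactGroup_universal_kernel[OF N this] obtain \<alpha> where
    \<alpha>: "\<alpha> \<in> hom (ambient T q s Mod ?N) G"
    "\<And>x. x \<in> carrier (ambient T q s) \<Longrightarrow> \<alpha> (?N #>\<^bsub>ambient T q s\<^esub> x) = \<beta> x" by blast
  have car: "?N #>\<^bsub>ambient T q s\<^esub> x \<in> carrier (tilde_group T q s t)" if "x \<in> carrier (ambient T q s)" for x
    using that by (auto simp: tilde_group_def FactGroup_def RCOSETS_def)
  show thesis
  proof (rule that[of \<alpha>])
    show "group (tilde_group T q s t)" unfolding tilde_group_def using normal.factorgroup_is_group[OF N] .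
    show "\<alpha> \<in> hom (tilde_group T q s t) G" using \<alpha>(1) by (simp add: tilde_group_def)
  qed (use gen emb car \<alpha>(2) in \<open>auto simp: tilde_gen_def tilde_emb_def k_def\<close>)
qed

context graded_form
begin

context
  fixes q s u g
  assumes good: "adapted q s u g"
begin

text \<open>The degree \<open>t_i\<close> of \<open>d_i\<close>, computed from the degree of the
  form, which is the inverse of \<gamma>.\<close>

definition sqdeg where "sqdeg i = inv\<^bsub>G\<^esub> \<gamma> \<otimes>\<^bsub>G\<^esub> g i \<otimes>\<^bsub>G\<^esub> g i"

lemma sqdeg_support:
  assumes "i \<in> {1..q}"
  shows "sqdeg i \<in> grading_support D G \<Gamma>\<^sub>D"
proof -
  have "g i \<in> carrier G" using u_props[OF good] assms by auto
  then show ?thesis using d_props[OF good assms] unfolding grading_support_def sqdeg_def by auto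
qed

lemma sqdeg_relation:
  assumes "i \<in> {1..q}"
  shows "g i \<otimes>\<^bsub>G\<^esub> g i \<otimes>\<^bsub>G\<^esub> inv\<^bsub>G\<^esub> (sqdeg i) = \<gamma>"
proof -
  have g: "g i \<in> carrier G" using u_props[OF good] assms by auto
  have "\<gamma> \<otimes>\<^bsub>G\<^esub> sqdeg i = g i \<otimes>\<^bsub>G\<^esub> g i"
    using g by (simp add: sqdeg_def grp.m_assoc[symmetric])
  then have "g i \<otimes>\<^bsub>G\<^esub> g i \<otimes>\<^bsub>G\<^esub> inv\<^bsub>G\<^esub> (sqdeg i) = \<gamma> \<otimes>\<^bsub>G\<^esub> sqdeg i \<otimes>\<^bsub>G\<^esub> inv\<^bsub>G\<^esub> (sqdeg i)" by simp
  also have "\<dots> = \<gamma>" using g by (simp add: grp.m_assoc sqdeg_def)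
  finally show ?thesis .
qed

text \<open>The form takes the value \<open>e\<close> on a hyperbolic pair. This is nonzero of
  degree one, and comparison with the degree predicted by \<open>form_component\<close> gives the
  relation.\<close>

lemma pair_relation:
  assumes "m \<in> {1..s}"
  shows "g (q + 2 * m - 1) \<otimes>\<^bsub>G\<^esub> g (q + 2 * m) = \<gamma>"
proof -
  define i where "i = q + 2 * m - 1"
  have i: "i \<in> {1..q + 2 * s}" "i + 1 \<in> {1..q + 2 * s}" "q + 2 * m = i + 1" using assms by (auto simp: i_def)
  have o: "odd (i - q)" "q < i" using assms by (auto simp: i_def)
  have g: "g i \<in> carrier G" "g (i + 1) \<in> carrier G" using u_props[OF good] i by auto
  have "adj (u i) \<bullet> u (i + 1) = e" using form_eq_entry[OF good i(1,2)] o by (simp add: form_entry_def)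
  then have "e \<in> \<Gamma> (inv\<^bsub>G\<^esub> \<gamma> \<otimes>\<^bsub>G\<^esub> g i \<otimes>\<^bsub>G\<^esub> g (i + 1))"
    using form_component[OF g u_props(2)[OF good i(1)] u_props(2,3)[OF good i(2)]] by (simp add: \<Gamma>\<^sub>D_def)
  then have "inv\<^bsub>G\<^esub> \<gamma> \<otimes>\<^bsub>G\<^esub> g i \<otimes>\<^bsub>G\<^esub> g (i + 1) = \<one>\<^bsub>G\<^esub>"
    using component_degree_unique[OF _ _ _ e_deg e_nonzero] g by simp
  then have "inv\<^bsub>G\<^esub> \<gamma> \<otimes>\<^bsub>G\<^esub> (g i \<otimes>\<^bsub>G\<^esub> g (i + 1)) = \<one>\<^bsub>G\<^esub>" using g by (simp add: grp.m_assoc)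
  moreover have "\<gamma> \<otimes>\<^bsub>G\<^esub> (inv\<^bsub>G\<^esub> \<gamma> \<otimes>\<^bsub>G\<^esub> (g i \<otimes>\<^bsub>G\<^esub> g (i + 1))) = g i \<otimes>\<^bsub>G\<^esub> g (i + 1)"
    using g by (simp add: grp.m_assoc[symmetric])
  ultimately have "g i \<otimes>\<^bsub>G\<^esub> g (i + 1) = \<gamma>" by simp
  then show ?thesis using i unfolding i_def[symmetric] by simp
qed

end

end

section \<open>Matrix coordinates\<close>

lemma matrix_algebra_sel:
  "carrier (matrix_algebra k D) = ({1..k} \<times> {1..k}) \<rightarrow>\<^sub>E carrier D"
  "x \<otimes>\<^bsub>matrix_algebra k D\<^esub> y =
     (\<lambda>(i, j)\<in>{1..k} \<times> {1..k}. \<Oplus>\<^bsub>D\<^esub>l\<in>{1..k}. x (i, l) \<otimes>\<^bsub>D\<^esub> y (l, j))"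
  "\<one>\<^bsub>matrix_algebra k D\<^esub> = (\<lambda>(i, j)\<in>{1..k} \<times> {1..k}. if i = j then \<one>\<^bsub>D\<^esub> else \<zero>\<^bsub>D\<^esub>)"
  "\<zero>\<^bsub>matrix_algebra k D\<^esub> = (\<lambda>(i, j)\<in>{1..k} \<times> {1..k}. \<zero>\<^bsub>D\<^esub>)"
  "x \<oplus>\<^bsub>matrix_algebra k D\<^esub> y = (\<lambda>(i, j)\<in>{1..k} \<times> {1..k}. x (i, j) \<oplus>\<^bsub>D\<^esub> y (i, j))"
  "a \<odot>\<^bsub>matrix_algebra k D\<^esub> x = (\<lambda>(i, j)\<in>{1..k} \<times> {1..k}. a \<odot>\<^bsub>D\<^esub> x (i, j))"
  by (simp_all add: matrix_algebra_def)

lemma restrict_pair_eqI: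
  assumes "\<And>i j. i \<in> I \<Longrightarrow> j \<in> J \<Longrightarrow> f i j = f' i j"
  shows "(\<lambda>(i, j)\<in>I \<times> J. f i j) = (\<lambda>(i, j)\<in>I \<times> J. f' i j)"
  using assms by (auto simp: restrict_def)

lemma PiE_pair_eqI:
  assumes "x \<in> (I \<times> J) \<rightarrow>\<^sub>E C" "y \<in> (I \<times> J) \<rightarrow>\<^sub>E C" "\<And>i j. i \<in> I \<Longrightarrow> j \<in> J \<Longrightarrow> x (i, j) = y (i, j)"
  shows "x = y"
  using assms by (intro PiE_ext[OF assms(1,2)]) auto

locale graded_form_basis = graded_form F A G \<Gamma> \<phi> e c c' \<gamma> \<delta>
  for F (structure) and A (structure) and G (structure) and \<Gamma> and \<phi> and e c c' \<gamma> \<delta> +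
  fixes q s :: nat and u g
  assumes good: "adapted q s u g"
    and complete: "complete (q + 2 * s) u"
begin

abbreviation k where "k \<equiv> q + 2 * s"
abbreviation I where "I \<equiv> {1..q + 2 * s}"
abbreviation v where "v \<equiv> dual q u"
abbreviation M where "M \<equiv> matrix_algebra (q + 2 * s) D"
abbreviation One where "One \<equiv> frame_sum q s u"

lemma u_closed [simp]: "i \<in> I \<Longrightarrow> u i \<in> carrier A" using u_props[OF good] by blast
lemma u_e [simp]: "i \<in> I \<Longrightarrow> u i \<bullet> e = u i" using u_props[OF good] by blast
lemma g_closed [simp]: "i \<in> I \<Longrightarrow> g i \<in> carrier G" using u_props[OF good] by blast
lemma u_deg: "i \<in> I \<Longrightarrow> u i \<in> \<Gamma> (g i)" using u_props[OF good] by blast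
lemma v_closed [simp]: "i \<in> I \<Longrightarrow> v i \<in> carrier A" using dual_closed[OF good] by blast
lemma e_v [simp]: "i \<in> I \<Longrightarrow> e \<bullet> v i = v i" using dual_left[OF good] by blast
lemma v_deg: "i \<in> I \<Longrightarrow> v i \<in> \<Gamma> (inv\<^bsub>G\<^esub> (g i))" using dual_component[OF good] by blast
lemma v_u: "i \<in> I \<Longrightarrow> j \<in> I \<Longrightarrow> v i \<bullet> u j = (if i = j then e else \<zero>\<^bsub>A\<^esub>)" using dual_u[OF good] by blast
lemma coef_in: "i \<in> I \<Longrightarrow> coef q u i \<in> corner" using coef_corner[OF good] by blast
lemma partner_I: "i \<in> I \<Longrightarrow> partner q i \<in> I" using partner_in[OF good] by blast

lemma One_closed [simp]: "One \<in> carrier A" using frame_sum_closed[OF good] .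

lemma One_unit [simp]:
  assumes "x \<in> carrier A" shows "One \<bullet> x = x" "x \<bullet> One = x"
  using frame_sum_unit[OF good complete assms] by blast+

lemma One_sum: "One = (\<Oplus>\<^bsub>A\<^esub>i\<in>I. u i \<bullet> v i)"
  by (rule frame_sum_def[OF good])

lemma expand_left:
  assumes "x \<in> carrier A" shows "x = (\<Oplus>\<^bsub>A\<^esub>i\<in>I. u i \<bullet> (v i \<bullet> x))"
proof -
  have "x = (\<Oplus>\<^bsub>A\<^esub>i\<in>I. u i \<bullet> v i) \<bullet> x" using assms One_unit(1) One_sum by simp
  also have "\<dots> = (\<Oplus>\<^bsub>A\<^esub>i\<in>I. u i \<bullet> v i \<bullet> x)" using assms by (intro a_mult_finsum_left) auto
  also have "\<dots> = (\<Oplus>\<^bsub>A\<^esub>i\<in>I. u i \<bullet> (v i \<bullet> x))" using assms by (intro M.finsum_cong') (auto simp: a_mult_assoc)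
  finally show ?thesis .
qed

lemma expand_right:
  assumes "x \<in> carrier A" shows "x = (\<Oplus>\<^bsub>A\<^esub>i\<in>I. (x \<bullet> u i) \<bullet> v i)"
proof -
  have "x = x \<bullet> (\<Oplus>\<^bsub>A\<^esub>i\<in>I. u i \<bullet> v i)" using assms One_unit(2) One_sum by simp
  also have "\<dots> = (\<Oplus>\<^bsub>A\<^esub>i\<in>I. x \<bullet> (u i \<bullet> v i))" using assms by (intro a_mult_finsum_right) auto
  also have "\<dots> = (\<Oplus>\<^bsub>A\<^esub>i\<in>I. (x \<bullet> u i) \<bullet> v i)" using assms by (intro M.finsum_cong') (auto simp: a_mult_assoc)
  finally show ?thesis .
qed

text \<open>The matrix of left multiplication by \<open>r\<close> on the right
  \<open>D\<close>-module \<open>A \<bullet> e\<close> in the basis \<open>u\<close>.\<close>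

definition mat where "mat r = (\<lambda>(i, j)\<in>I \<times> I. v i \<bullet> (r \<bullet> u j))"

lemma entry_corner: "r \<in> carrier A \<Longrightarrow> i \<in> I \<Longrightarrow> j \<in> I \<Longrightarrow> v i \<bullet> (r \<bullet> u j) \<in> corner"
  by (simp add: corner_def a_mult_assoc) (simp add: a_mult_assoc[symmetric])

lemma mat_closed: "r \<in> carrier A \<Longrightarrow> mat r \<in> carrier M"
  using entry_corner by (auto simp: mat_def matrix_algebra_sel)

lemma mat_entry: "i \<in> I \<Longrightarrow> j \<in> I \<Longrightarrow> mat r (i, j) = v i \<bullet> (r \<bullet> u j)"
  by (simp add: mat_def)

lemma mat_inj:
  assumes "r \<in> carrier A" "r' \<in> carrier A" "mat r = mat r'" shows "r = r'"
proof -
  have 1: "v i \<bullet> (r \<bullet> u j) = v i \<bullet> (r' \<bullet> u j)" if "i \<in> I" "j \<in> I" for i j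
    using mat_entry[OF that] assms(3) by metis
  have 2: "r \<bullet> u j = r' \<bullet> u j" if j: "j \<in> I" for j
  proof -
    have "r \<bullet> u j = (\<Oplus>\<^bsub>A\<^esub>i\<in>I. u i \<bullet> (v i \<bullet> (r \<bullet> u j)))" using assms j by (intro expand_left) simp
    also have "\<dots> = (\<Oplus>\<^bsub>A\<^esub>i\<in>I. u i \<bullet> (v i \<bullet> (r' \<bullet> u j)))"
      using 1 j assms by (intro M.finsum_cong') auto
    also have "\<dots> = r' \<bullet> u j" using assms j by (intro expand_left[symmetric]) simp
    finally show ?thesis .
  qed
  have "r = (\<Oplus>\<^bsub>A\<^esub>j\<in>I. (r \<bullet> u j) \<bullet> v j)" using assms by (intro expand_right)
  also have "\<dots> = (\<Oplus>\<^bsub>A\<^esub>j\<in>I. (r' \<bullet> u j) \<bullet> v j)" using 2 assms by (intro M.finsum_cong') auto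
  also have "\<dots> = r'" using assms by (intro expand_right[symmetric])
  finally show ?thesis .
qed

lemma v_sum:
  assumes "w \<in> I \<rightarrow> carrier A" "i \<in> I"
  shows "v i \<bullet> (\<Oplus>\<^bsub>A\<^esub>l\<in>I. u l \<bullet> w l) = e \<bullet> w i"
proof -
  have w: "w l \<in> carrier A" if "l \<in> I" for l using that assms by blast
  have "v i \<bullet> (\<Oplus>\<^bsub>A\<^esub>l\<in>I. u l \<bullet> w l) = (\<Oplus>\<^bsub>A\<^esub>l\<in>I. v i \<bullet> (u l \<bullet> w l))"
    using w assms(2) by (intro a_mult_finsum_right) auto
  also have "\<dots> = (\<Oplus>\<^bsub>A\<^esub>l\<in>I. if l = i then e \<bullet> w i else \<zero>\<^bsub>A\<^esub>)"
  proof (intro M.finsum_cong')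
    fix l assume l: "l \<in> I"
    then show "v i \<bullet> (u l \<bullet> w l) = (if l = i then e \<bullet> w i else \<zero>\<^bsub>A\<^esub>)"
      using w[OF l] w[OF assms(2)] v_u[OF assms(2) l] assms(2) by (simp add: a_mult_assoc[symmetric])
  qed (use w assms(2) in auto)
  also have "\<dots> = e \<bullet> w i" using assms w by (intro finsum_single) auto
  finally show ?thesis .
qed

lemma sum_u:
  assumes "w \<in> I \<rightarrow> carrier A" "i \<in> I"
  shows "(\<Oplus>\<^bsub>A\<^esub>l\<in>I. w l \<bullet> v l) \<bullet> u i = w i \<bullet> e"
proof -
  have w: "w l \<in> carrier A" if "l \<in> I" for l using that assms by blast
  have "(\<Oplus>\<^bsub>A\<^esub>l\<in>I. w l \<bullet> v l) \<bullet> u i = (\<Oplus>\<^bsub>A\<^esub>l\<in>I. w l \<bullet> v l \<bullet> u i)"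
    using w assms(2) by (intro a_mult_finsum_left) auto
  also have "\<dots> = (\<Oplus>\<^bsub>A\<^esub>l\<in>I. if l = i then w i \<bullet> e else \<zero>\<^bsub>A\<^esub>)"
  proof (intro M.finsum_cong')
    fix l assume l: "l \<in> I"
    then show "w l \<bullet> v l \<bullet> u i = (if l = i then w i \<bullet> e else \<zero>\<^bsub>A\<^esub>)"
      using w[OF l] w[OF assms(2)] v_u[OF l assms(2)] assms(2) by (simp add: a_mult_assoc)
  qed (use w assms(2) in auto)
  also have "\<dots> = w i \<bullet> e" using assms w by (intro finsum_single) auto
  finally show ?thesis .
qed

lemma mat_surj:
  assumes "Z \<in> carrier M" obtains r where "r \<in> carrier A" "mat r = Z"
proof -
  have Z: "Z (i, j) \<in> carrier A" "e \<bullet> Z (i, j) = Z (i, j)" "Z (i, j) \<bullet> e = Z (i, j)" if "i \<in> I" "j \<in> I" for i j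
    using assms that by (auto simp: matrix_algebra_sel corner_def)
  define row where "row i = (\<Oplus>\<^bsub>A\<^esub>j\<in>I. Z (i, j) \<bullet> v j)" for i
  have row: "row i \<in> carrier A" if "i \<in> I" for i
    unfolding row_def using Z that by (intro M.finsum_closed) auto
  have row_u: "row i \<bullet> u j = Z (i, j)" if "i \<in> I" "j \<in> I" for i j
    unfolding row_def using Z that by (subst sum_u) auto
  \<comment> \<open>The preimage is the double sum of the
    \<open>u i \<bullet> Z (i, j) \<bullet> v j\<close>, formed by rows so that \<open>sum_u\<close>
    and \<open>v_sum\<close> each remove one index.\<close>
  define r where "r = (\<Oplus>\<^bsub>A\<^esub>i\<in>I. u i \<bullet> row i)"
  have r: "r \<in> carrier A" unfolding r_def using row by (intro M.finsum_closed) auto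
  have vr: "v i \<bullet> r = e \<bullet> row i" if "i \<in> I" for i
    unfolding r_def using row that by (intro v_sum) auto
  have "mat r (i, j) = Z (i, j)" if "i \<in> I" "j \<in> I" for i j
  proof -
    have "mat r (i, j) = (v i \<bullet> r) \<bullet> u j" using that r by (simp add: mat_entry a_mult_assoc)
    also have "\<dots> = e \<bullet> (row i \<bullet> u j)" using that row[OF that(1)] by (simp add: vr a_mult_assoc)
    finally show ?thesis using row_u Z that by simp
  qed
  then have "mat r = Z"
    using mat_closed[OF r] assms unfolding matrix_algebra_sel by (intro PiE_pair_eqI) auto
  then show thesis using that r by blast
qed

lemma mat_bij: "bij_betw mat (carrier A) (carrier M)"
  unfolding bij_betw_def
proof
  show "inj_on mat (carrier A)" using mat_inj by (intro inj_onI)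
  show "mat ` carrier A = carrier M"
  proof (intro subset_antisym subsetI)
    fix Z assume "Z \<in> carrier M"
    then obtain r where "r \<in> carrier A" "mat r = Z" by (rule mat_surj)
    then show "Z \<in> mat ` carrier A" by blast
  qed (use mat_closed in blast)
qed

lemma mat_add:
  assumes "x \<in> carrier A" "y \<in> carrier A" shows "mat (x \<oplus>\<^bsub>A\<^esub> y) = mat x \<oplus>\<^bsub>M\<^esub> mat y"
  unfolding matrix_algebra_sel mat_def
  using assms by (intro restrict_pair_eqI) (simp add: a_mult_distl a_mult_distr)

lemma mat_smult:
  assumes "a \<in> carrier F" "x \<in> carrier A" shows "mat (a \<odot>\<^bsub>A\<^esub> x) = a \<odot>\<^bsub>M\<^esub> mat x"
  unfolding matrix_algebra_sel mat_def
  using assms by (intro restrict_pair_eqI) (simp add: a_smult_mult_left a_smult_mult_right)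

lemma mat_zero: "mat \<zero>\<^bsub>A\<^esub> = \<zero>\<^bsub>M\<^esub>"
  unfolding matrix_algebra_sel mat_def by (intro restrict_pair_eqI) simp

lemma mat_one: "mat One = \<one>\<^bsub>M\<^esub>"
  unfolding matrix_algebra_sel mat_def by (intro restrict_pair_eqI) (simp add: v_u)

text \<open>The unit, written as the sum of the \<open>u l \<bullet> v l\<close>, is inserted
  between \<open>x\<close> and \<open>y\<close>.\<close>

lemma mat_mult:
  assumes x: "x \<in> carrier A" and y: "y \<in> carrier A" shows "mat (x \<bullet> y) = mat x \<otimes>\<^bsub>M\<^esub> mat y"
  unfolding matrix_algebra_sel(2) mat_def[of "x \<bullet> y"]
proof (intro restrict_pair_eqI)
  fix i j assume i: "i \<in> I" and j: "j \<in> I"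
  have "(\<Oplus>\<^bsub>D\<^esub>l\<in>I. mat x (i, l) \<otimes>\<^bsub>D\<^esub> mat y (l, j)) = (\<Oplus>\<^bsub>A\<^esub>l\<in>I. mat x (i, l) \<bullet> mat y (l, j))"
    using i j x y entry_corner corner_mult by (subst finsum_D) (auto simp: mat_entry)
  also have "\<dots> = (\<Oplus>\<^bsub>A\<^esub>l\<in>I. (v i \<bullet> x) \<bullet> (u l \<bullet> (v l \<bullet> (y \<bullet> u j))))"
    using i j x y by (intro M.finsum_cong') (auto simp: mat_entry a_mult_assoc)
  also have "\<dots> = (v i \<bullet> x) \<bullet> (\<Oplus>\<^bsub>A\<^esub>l\<in>I. u l \<bullet> (v l \<bullet> (y \<bullet> u j)))"
    using i j x y by (intro a_mult_finsum_right[symmetric]) auto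
  also have "\<dots> = (v i \<bullet> x) \<bullet> (y \<bullet> u j)" using expand_left[of "y \<bullet> u j"] j y by simp
  finally show "v i \<bullet> (x \<bullet> y \<bullet> u j) = (\<Oplus>\<^bsub>D\<^esub>l\<in>I. mat x (i, l) \<otimes>\<^bsub>D\<^esub> mat y (l, j))"
    using i j x y by (simp add: a_mult_assoc)
qed

text \<open>Duality of \<open>u\<close> and \<open>v\<close> leaves a single entry. For homogeneous
  \<open>x\<close> these elements are homogeneous in \<open>A\<close>, so the gradings can be
  compared on generators.\<close>

lemma mat_unit:
  assumes "i \<in> I" "j \<in> I" "x \<in> corner"
  shows "mat (u i \<bullet> (x \<bullet> v j)) = matrix_unit k D i j x"
  unfolding mat_def matrix_unit_def
proof (rule restrict_ext, clarify)
  fix i' j' assume ij: "i' \<in> I" "j' \<in> I"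
  have x: "x \<in> carrier A" "e \<bullet> x = x" "x \<bullet> e = x" using assms by (auto simp: corner_def)
  have "v i' \<bullet> (u i \<bullet> (x \<bullet> v j) \<bullet> u j') = (v i' \<bullet> u i) \<bullet> (x \<bullet> (v j \<bullet> u j'))"
    using assms(1,2) ij x(1) by (simp add: a_mult_assoc)
  also have "\<dots> = (if (i', j') = (i, j) then x else \<zero>\<^bsub>D\<^esub>)"
    using assms(1,2) ij x by (auto simp: v_u)
  finally show "v i' \<bullet> (u i \<bullet> (x \<bullet> v j) \<bullet> u j') = (if (i', j') = (i, j) then x else \<zero>\<^bsub>D\<^esub>)" .
qed

text \<open>
  Nothing is known about \<open>matrix_algebra\<close> beyond its definition. Its structure is transported from \<open>A\<close>
  along the bijection \<open>mat\<close>.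
\<close>

lemma submodule_preimage:
  assumes "submodule N F M" shows "submodule {x \<in> carrier A. mat x \<in> N} F A"
proof (rule subspaceI)
  have N: "subgroup N (add_monoid M)" using assms submodule.axioms(1) by blast
  show "\<zero>\<^bsub>A\<^esub> \<in> {x \<in> carrier A. mat x \<in> N}" using subgroup.one_closed[OF N] by (simp add: mat_zero)
  show "x \<oplus>\<^bsub>A\<^esub> y \<in> {x \<in> carrier A. mat x \<in> N}"
    if "x \<in> {x \<in> carrier A. mat x \<in> N}" "y \<in> {x \<in> carrier A. mat x \<in> N}" for x y
    using that subgroup.m_closed[OF N] by (simp add: mat_add)
  show "a \<odot>\<^bsub>A\<^esub> x \<in> {x \<in> carrier A. mat x \<in> N}"
    if "a \<in> carrier F" "x \<in> {x \<in> carrier A. mat x \<in> N}" for a x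
    using that submodule.smult_closed[OF assms] by (simp add: mat_smult)
qed auto

lemma submodule_image:
  assumes "submodule N F A" shows "submodule (mat ` N) F M"
proof -
  have N: "N \<subseteq> carrier A" using submoduleE(1)[OF assms] .
  have hom: "mat \<in> hom (add_monoid A) (add_monoid M)"
    using mat_closed mat_add by (intro homI) auto
  have iso: "mat \<in> iso (add_monoid A) (add_monoid M)"
    using hom mat_bij by (simp add: iso_def)
  \<comment> \<open>The group axioms for matrix addition are transported along the
    isomorphism.\<close>
  have "group (add_monoid M)" using M.add.iso_imp_img_group[OF iso] by (simp add: mat_zero)
  then interpret mat: group_hom "add_monoid A" "add_monoid M" mat
    using hom M.add.is_group by (simp add: group_hom_def group_hom_axioms_def)
  have "subgroup (mat ` N) (add_monoid M)"
    using mat.subgroup_img_is_subgroup[OF submodule.axioms(1)[OF assms]] .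
  moreover have "a \<odot>\<^bsub>M\<^esub> y \<in> mat ` N" if a: "a \<in> carrier F" and y: "y \<in> mat ` N" for a y
  proof -
    obtain x where x: "x \<in> N" "y = mat x" using y by blast
    then have "a \<odot>\<^bsub>M\<^esub> y = mat (a \<odot>\<^bsub>A\<^esub> x)" using a N mat_smult by auto
    then show ?thesis using x a submoduleE(4)[OF assms] by blast
  qed
  ultimately show ?thesis by (intro submodule.intro submodule_axioms.intro) auto
qed

section \<open>Comparison of the two gradings\<close>

definition T where "T = G\<lparr>carrier := grading_support D G \<Gamma>\<^sub>D\<rparr>"

abbreviation t where "t \<equiv> sqdeg g"
abbreviation d where "d \<equiv> \<lambda>i. adj (u i) \<bullet> u i"

text \<open>\<alpha> sends the degree of a matrix unit to the degree of its preimage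
  \<open>u i \<bullet> (x \<bullet> v j)\<close>. One inclusion is checked on generators; for the
  other, an element of \<open>\<Gamma> h\<close> is the sum of its coordinate parts, each such a
  preimage or zero.\<close>

lemma mat_grading:
  assumes grp_H: "group (tilde_group T q s t)"
    and \<alpha>: "\<alpha> \<in> hom (tilde_group T q s t) G"
    and gen: "\<And>i. i \<in> I \<Longrightarrow> tilde_gen T q s t i \<in> carrier (tilde_group T q s t)"
      "\<And>i. i \<in> I \<Longrightarrow> \<alpha> (tilde_gen T q s t i) = g i"
    and emb: "\<And>p. p \<in> carrier T \<Longrightarrow> tilde_emb T q s t p \<in> carrier (tilde_group T q s t)"
      "\<And>p. p \<in> carrier T \<Longrightarrow> \<alpha> (tilde_emb T q s t p) = p"
    and h: "h \<in> carrier G"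
  shows "push_grading F M (tilde_group T q s t) \<alpha> (model_grading F D T \<Gamma>\<^sub>D q s t) h = mat ` \<Gamma> h"
proof -
  let ?H = "tilde_group T q s t"
  interpret \<alpha>: group_hom ?H G \<alpha> using grp_H \<alpha> by (simp add: group_hom_def group_hom_axioms_def)
  define deg where "deg i j p = tilde_gen T q s t i \<otimes>\<^bsub>?H\<^esub> inv\<^bsub>?H\<^esub> tilde_gen T q s t j \<otimes>\<^bsub>?H\<^esub> tilde_emb T q s t p" for i j p
  have deg: "deg i j p \<in> carrier ?H" "\<alpha> (deg i j p) = g i \<otimes>\<^bsub>G\<^esub> inv\<^bsub>G\<^esub> (g j) \<otimes>\<^bsub>G\<^esub> p"
    if "i \<in> I" "j \<in> I" "p \<in> carrier T" for i j p
    using that gen emb by (simp_all add: deg_def)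
  have TG: "carrier T \<subseteq> carrier G" by (auto simp: T_def grading_support_def)
  have unit_deg: "u i \<bullet> (x \<bullet> v j) \<in> \<Gamma> (g i \<otimes>\<^bsub>G\<^esub> inv\<^bsub>G\<^esub> (g j) \<otimes>\<^bsub>G\<^esub> p)"
    if "i \<in> I" "j \<in> I" "p \<in> carrier G" "x \<in> \<Gamma> p" for i j p x
  proof -
    have "u i \<bullet> (x \<bullet> v j) \<in> \<Gamma> (g i \<otimes>\<^bsub>G\<^esub> (p \<otimes>\<^bsub>G\<^esub> inv\<^bsub>G\<^esub> (g j)))"
      using that u_deg v_deg by (intro component_mult) auto
    then show ?thesis using that by (simp add: grp.m_assoc comm.m_comm[of p])
  qed
  show ?thesis
  proof
    have "model_grading F D T \<Gamma>\<^sub>D q s t h' \<subseteq> mat ` \<Gamma> h" if h': "h' \<in> carrier ?H" "\<alpha> h' = h" for h'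
      unfolding model_grading_def
    proof (rule lin_span_subset[OF submodule_image[OF component_subspace[OF h]]], clarify)
      fix i j p x assume ij: "i \<in> I" "j \<in> I" and p: "p \<in> carrier T" and x: "x \<in> \<Gamma>\<^sub>D p"
        and h'_eq: "h' = tilde_gen T q s t i \<otimes>\<^bsub>?H\<^esub> inv\<^bsub>?H\<^esub> tilde_gen T q s t j \<otimes>\<^bsub>?H\<^esub> tilde_emb T q s t p"
      have "h = g i \<otimes>\<^bsub>G\<^esub> inv\<^bsub>G\<^esub> (g j) \<otimes>\<^bsub>G\<^esub> p" using deg(2)[OF ij p] h' h'_eq by (simp add: deg_def)
      then have "u i \<bullet> (x \<bullet> v j) \<in> \<Gamma> h" using unit_deg[OF ij, of p x] p TG x by (auto simp: \<Gamma>\<^sub>D_def)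
      moreover have "mat (u i \<bullet> (x \<bullet> v j)) = matrix_unit k D i j x"
        using mat_unit[OF ij] x by (simp add: \<Gamma>\<^sub>D_def)
      ultimately show "matrix_unit k D i j x \<in> mat ` \<Gamma> h" by (metis imageI)
    qed
    then show "push_grading F M ?H \<alpha> (model_grading F D T \<Gamma>\<^sub>D q s t) h \<subseteq> mat ` \<Gamma> h"
      unfolding push_grading_def
      by (intro lin_span_subset submodule_image component_subspace h) auto
  next
    show "mat ` \<Gamma> h \<subseteq> push_grading F M ?H \<alpha> (model_grading F D T \<Gamma>\<^sub>D q s t) h"
      unfolding push_grading_def lin_span_def[of F M "\<Union> _"]
    proof (clarify)
      fix x N assume x: "x \<in> \<Gamma> h" and N: "submodule N F M"
        and sub: "(\<Union>h'\<in>{h' \<in> carrier ?H. \<alpha> h' = h}. model_grading F D T \<Gamma>\<^sub>D q s t h') \<subseteq> N"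
      have xc: "x \<in> carrier A" using x h component_closed by blast
      let ?V = "{x \<in> carrier A. mat x \<in> N}"
      have V: "submodule ?V F A" using submodule_preimage[OF N] .
      have 1: "u i \<bullet> ((v i \<bullet> (x \<bullet> u j)) \<bullet> v j) \<in> ?V" if ij: "i \<in> I" "j \<in> I" for i j
      \<comment> \<open>The spanning set of \<open>model_grading\<close> admits only nonzero entries
        with degree in the support, so zero coordinates are treated apart.\<close>
      proof (cases "v i \<bullet> (x \<bullet> u j) = \<zero>\<^bsub>A\<^esub>")
        case True
        then show ?thesis using submodule_zero[OF V] ij by simp
      next
        case False
        define p where "p = inv\<^bsub>G\<^esub> (g i) \<otimes>\<^bsub>G\<^esub> (h \<otimes>\<^bsub>G\<^esub> g j)"
        have pG: "p \<in> carrier G" using ij h by (simp add: p_def)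
        have "v i \<bullet> (x \<bullet> u j) \<in> \<Gamma> p"
          unfolding p_def using ij u_deg v_deg x h by (intro component_mult) auto
        then have a: "v i \<bullet> (x \<bullet> u j) \<in> \<Gamma>\<^sub>D p" using entry_corner[OF xc ij] by (simp add: \<Gamma>\<^sub>D_def)
        then have p: "p \<in> carrier T" using False pG by (auto simp: T_def grading_support_def)
        have "g i \<otimes>\<^bsub>G\<^esub> inv\<^bsub>G\<^esub> (g j) \<otimes>\<^bsub>G\<^esub> p = g i \<otimes>\<^bsub>G\<^esub> inv\<^bsub>G\<^esub> (g i) \<otimes>\<^bsub>G\<^esub> (g j \<otimes>\<^bsub>G\<^esub> inv\<^bsub>G\<^esub> (g j)) \<otimes>\<^bsub>G\<^esub> h"
          unfolding p_def using ij h by (simp only: comm.m_ac g_closed grp.inv_closed grp.m_closed)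
        also have "\<dots> = h" using ij h by simp
        finally have "\<alpha> (deg i j p) = h" using deg(2)[OF ij p] by simp
        moreover have "matrix_unit k D i j (v i \<bullet> (x \<bullet> u j)) \<in> model_grading F D T \<Gamma>\<^sub>D q s t (deg i j p)"
          unfolding model_grading_def
        proof (rule subsetD[OF subset_lin_span], intro CollectI exI conjI)
          show "matrix_unit k D i j (v i \<bullet> (x \<bullet> u j)) = matrix_unit k D i j (v i \<bullet> (x \<bullet> u j))" ..
          show "deg i j p = tilde_gen T q s t i \<otimes>\<^bsub>?H\<^esub> inv\<^bsub>?H\<^esub> tilde_gen T q s t j \<otimes>\<^bsub>?H\<^esub> tilde_emb T q s t p"
            by (rule deg_def)
        qed (use ij p a False in simp_all)
        ultimately have "matrix_unit k D i j (v i \<bullet> (x \<bullet> u j)) \<in> N" using sub deg(1)[OF ij p] by blast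
        then show ?thesis using mat_unit[OF ij entry_corner[OF xc ij]] ij xc by simp
      qed
      have 2: "u i \<bullet> (v i \<bullet> x) \<in> ?V" if i: "i \<in> I" for i
      proof -
        have "u i \<bullet> (v i \<bullet> x) = (\<Oplus>\<^bsub>A\<^esub>j\<in>I. (u i \<bullet> (v i \<bullet> x)) \<bullet> u j \<bullet> v j)"
          using i xc by (intro expand_right) simp
        also have "\<dots> = (\<Oplus>\<^bsub>A\<^esub>j\<in>I. u i \<bullet> ((v i \<bullet> (x \<bullet> u j)) \<bullet> v j))"
          using i xc by (intro M.finsum_cong') (auto simp: a_mult_assoc)
        also have "\<dots> \<in> ?V" using 1 i by (intro finsum_in_submodule[OF V])
        finally show ?thesis .
      qed
      have "(\<Oplus>\<^bsub>A\<^esub>i\<in>I. u i \<bullet> (v i \<bullet> x)) \<in> ?V" using 2 by (intro finsum_in_submodule[OF V])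
      then have "x \<in> ?V" using expand_left[OF xc] by simp
      then show "mat x \<in> N" by simp
    qed
  qed
qed

text \<open>The element whose matrix is the form \<Phi>; \<open>cogram\<close> will be its inverse,
  so that conjugation by \<Phi> can be carried out in \<open>A\<close>.\<close>

definition gram where "gram = (\<Oplus>\<^bsub>A\<^esub>i\<in>I. u i \<bullet> adj (u i))"
definition cogram where "cogram = (\<Oplus>\<^bsub>A\<^esub>i\<in>I. u i \<bullet> (coef q u i \<bullet> v (partner q i)))"

lemma gram_closed [simp]: "gram \<in> carrier A"
  unfolding gram_def by (intro M.finsum_closed) auto

lemma coef_closed [simp]: "i \<in> I \<Longrightarrow> coef q u i \<in> carrier A"
  using coef_in corner_closed by blast

lemma cogram_closed [simp]: "cogram \<in> carrier A"
  unfolding cogram_def using partner_I by (intro M.finsum_closed) auto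

lemma v_gram: "i \<in> I \<Longrightarrow> v i \<bullet> gram = adj (u i)"
  unfolding gram_def by (subst v_sum) auto

lemma mat_gram: "mat gram = model_form D q s d \<delta>"
  unfolding mat_def model_form_def
proof (intro restrict_pair_eqI)
  fix i j assume ij: "i \<in> I" "j \<in> I"
  have "v i \<bullet> (gram \<bullet> u j) = (v i \<bullet> gram) \<bullet> u j" using ij by (simp add: a_mult_assoc)
  also have "\<dots> = form_entry q d i j" using ij form_eq_entry[OF good] by (simp add: v_gram)
  also have "\<dots> = (if i = j \<and> i \<le> q then d i
        else if (\<exists>m\<in>{1..s}. i = q + 2 * m - 1 \<and> j = q + 2 * m) then \<one>\<^bsub>D\<^esub>
        else if (\<exists>m\<in>{1..s}. i = q + 2 * m \<and> j = q + 2 * m - 1) then \<delta> \<odot>\<^bsub>D\<^esub> \<one>\<^bsub>D\<^esub>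
        else \<zero>\<^bsub>D\<^esub>)"
  proof -
    \<comment> \<open>Block \<open>m\<close> occupies the positions \<open>2m - 1\<close> and
      \<open>2m\<close> after \<open>q\<close>, so \<open>i - q = 2m + 1\<close> belongs to block
      \<open>m + 1\<close>. The bound by \<open>s\<close> comes from \<open>j\<close>.\<close>
    have eq: "(q < i \<and> odd (i - q) \<and> j = i + 1) \<longleftrightarrow> (\<exists>m\<in>{1..s}. i = q + 2 * m - 1 \<and> j = q + 2 * m)"
      if "j \<in> I" for i j
    proof
      assume *: "q < i \<and> odd (i - q) \<and> j = i + 1"
      then obtain m where "i - q = 2 * m + 1" by (elim conjE oddE)
      then have "i = q + 2 * (m + 1) - 1" "j = q + 2 * (m + 1)" "m + 1 \<in> {1..s}" using * that by auto
      then show "\<exists>m\<in>{1..s}. i = q + 2 * m - 1 \<and> j = q + 2 * m" by blast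
    qed auto
    have eq': "(q < j \<and> odd (j - q) \<and> i = j + 1) \<longleftrightarrow> (\<exists>m\<in>{1..s}. i = q + 2 * m \<and> j = q + 2 * m - 1)"
      using eq[OF ij(1), of j] by blast
    show ?thesis
      unfolding form_entry_def eq[OF ij(2), of i] eq' D_simps ..
  qed
  finally show "v i \<bullet> (gram \<bullet> u j) = (if i = j \<and> i \<le> q then d i
        else if (\<exists>m\<in>{1..s}. i = q + 2 * m - 1 \<and> j = q + 2 * m) then \<one>\<^bsub>D\<^esub>
        else if (\<exists>m\<in>{1..s}. i = q + 2 * m \<and> j = q + 2 * m - 1) then \<delta> \<odot>\<^bsub>D\<^esub> \<one>\<^bsub>D\<^esub>
        else \<zero>\<^bsub>D\<^esub>)" .
qed

text \<open>\<open>gram\<close> turns \<open>v\<close> of the partner into the partner's functional,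
  and the coefficient turns that into \<open>v i\<close> by the definition of
  \<open>dual\<close>.\<close>

lemma cogram_gram: "cogram \<bullet> gram = One"
proof -
  have "cogram \<bullet> gram = (\<Oplus>\<^bsub>A\<^esub>i\<in>I. u i \<bullet> (coef q u i \<bullet> v (partner q i)) \<bullet> gram)"
    unfolding cogram_def using partner_I by (intro a_mult_finsum_left) auto
  also have "\<dots> = (\<Oplus>\<^bsub>A\<^esub>i\<in>I. u i \<bullet> v i)"
  proof (intro M.finsum_cong')
    fix i assume i: "i \<in> I"
    show "u i \<bullet> (coef q u i \<bullet> v (partner q i)) \<bullet> gram = u i \<bullet> v i"
      using i partner_I[OF i] v_gram[OF partner_I[OF i]] by (simp add: a_mult_assoc dual_def[of q u i])
  qed auto
  finally show ?thesis by (simp add: One_sum)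
qed

lemma invol_adj: "x \<in> carrier A \<Longrightarrow> \<phi> (adj x) = \<delta> \<odot>\<^bsub>A\<^esub> (x \<bullet> c')"
  by (simp add: adj_def invol_mult a_smult_mult_right)

lemma invol_gram: "\<phi> gram = \<delta> \<odot>\<^bsub>A\<^esub> gram"
proof -
  have "\<phi> gram = (\<Oplus>\<^bsub>A\<^esub>i\<in>I. \<phi> (u i \<bullet> adj (u i)))" unfolding gram_def by (intro invol_finsum) auto
  also have "\<dots> = (\<Oplus>\<^bsub>A\<^esub>i\<in>I. \<delta> \<odot>\<^bsub>A\<^esub> (u i \<bullet> adj (u i)))"
    by (intro M.finsum_cong') (auto simp: invol_mult invol_adj a_smult_mult_left a_smult_mult_right a_mult_assoc adj_def)
  also have "\<dots> = \<delta> \<odot>\<^bsub>A\<^esub> gram"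
    unfolding gram_def by (intro finsum_smult_ldistr[symmetric]) auto
  finally show ?thesis .
qed

text \<open>
  The left inverse of \<open>gram\<close> is two-sided because \<open>\<phi> gram = \<delta> \<odot> gram\<close> turns it into a right inverse.
\<close>

lemma gram_cogram: "gram \<bullet> cogram = One"
proof -
  have "\<phi> One = One"
  proof -
    have "One = \<phi> (\<phi> One \<bullet> One)" by simp
    also have "\<dots> = \<phi> One \<bullet> One" by (subst invol_mult) simp_all
    finally show ?thesis by simp
  qed
  then have "\<phi> gram \<bullet> \<phi> cogram = One" using invol_mult[of cogram gram] by (simp add: cogram_gram)
  then have inverse: "gram \<bullet> (\<delta> \<odot>\<^bsub>A\<^esub> \<phi> cogram) = One" by (simp add: invol_gram a_smult_mult_left a_smult_mult_right)
  have "cogram = (cogram \<bullet> gram) \<bullet> (\<delta> \<odot>\<^bsub>A\<^esub> \<phi> cogram)" unfolding a_mult_assoc[OF cogram_closed gram_closed smult_closed[OF \<delta>_closed invol_closed[OF cogram_closed]]] inverse by simp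
  then have "cogram = \<delta> \<odot>\<^bsub>A\<^esub> \<phi> cogram" by (simp add: cogram_gram)
  then show ?thesis using inverse by simp
qed

text \<open>The definite description behind \<open>inv\<close> is evaluated directly; uniqueness is
  pulled back to \<open>A\<close> by injectivity of \<open>mat\<close>.\<close>

lemma inv_form: "inv\<^bsub>M\<^esub> (model_form D q s d \<delta>) = mat cogram"
  unfolding m_inv_def mat_gram[symmetric]
proof (rule the_equality)
  show "mat cogram \<in> carrier M \<and> mat gram \<otimes>\<^bsub>M\<^esub> mat cogram = \<one>\<^bsub>M\<^esub> \<and> mat cogram \<otimes>\<^bsub>M\<^esub> mat gram = \<one>\<^bsub>M\<^esub>"
    using mat_closed by (simp add: mat_mult[symmetric] gram_cogram cogram_gram mat_one)
  fix Y assume Y: "Y \<in> carrier M \<and> mat gram \<otimes>\<^bsub>M\<^esub> Y = \<one>\<^bsub>M\<^esub> \<and> Y \<otimes>\<^bsub>M\<^esub> mat gram = \<one>\<^bsub>M\<^esub>"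
  then obtain y where y: "y \<in> carrier A" "mat y = Y" using mat_surj by blast
  then have "mat (y \<bullet> gram) = mat One" using Y by (simp add: mat_mult mat_one)
  then have "y \<bullet> gram = One" using y by (intro mat_inj) auto
  then have "y \<bullet> (gram \<bullet> cogram) = cogram" using y by (simp add: a_mult_assoc[symmetric])
  then show "Y = mat cogram" using y by (simp add: gram_cogram)
qed

lemma adj_finsum:
  assumes "f \<in> J \<rightarrow> carrier A"
  shows "adj (\<Oplus>\<^bsub>A\<^esub>i\<in>J. f i) = (\<Oplus>\<^bsub>A\<^esub>i\<in>J. adj (f i))"
  unfolding adj_def using assms by (subst invol_finsum) (auto intro!: a_mult_finsum_right)

text \<open>Both sides have the entries \<open>B(r u_i, u_j)\<close>: on the left by
  conjugate-linearity after expanding \<open>r \<bullet> u i\<close> in the basis, on the right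
  because \<open>\<phi> r\<close> is the adjoint of \<open>r\<close>.\<close>

lemma transpose_form:
  assumes r: "r \<in> carrier A"
  shows "entrywise_transpose k \<phi>\<^sub>0 (mat r) \<otimes>\<^bsub>M\<^esub> mat gram = mat (gram \<bullet> \<phi> r)"
  unfolding matrix_algebra_sel(2) mat_def[of "gram \<bullet> \<phi> r"]
proof (intro restrict_pair_eqI)
  fix i j assume i: "i \<in> I" and j: "j \<in> I"
  let ?x = "\<lambda>l. v l \<bullet> (r \<bullet> u i)"
  have x: "?x l \<in> corner" "?x l \<in> carrier A" if "l \<in> I" for l using entry_corner r i that by auto
  have "(\<Oplus>\<^bsub>D\<^esub>l\<in>I. entrywise_transpose k \<phi>\<^sub>0 (mat r) (i, l) \<otimes>\<^bsub>D\<^esub> mat gram (l, j))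
      = (\<Oplus>\<^bsub>A\<^esub>l\<in>I. \<phi>\<^sub>0 (?x l) \<bullet> (adj (u l) \<bullet> u j))"
  proof (subst finsum_D)
    show *: "(\<lambda>l. entrywise_transpose k \<phi>\<^sub>0 (mat r) (i, l) \<otimes>\<^bsub>D\<^esub> mat gram (l, j)) \<in> I \<rightarrow> corner"
      using i j r x \<phi>\<^sub>0_closed entry_corner[OF gram_closed] by (auto simp: entrywise_transpose_def mat_entry intro!: corner_mult)
    show "(\<Oplus>\<^bsub>A\<^esub>l\<in>I. entrywise_transpose k \<phi>\<^sub>0 (mat r) (i, l) \<otimes>\<^bsub>D\<^esub> mat gram (l, j))
      = (\<Oplus>\<^bsub>A\<^esub>l\<in>I. \<phi>\<^sub>0 (?x l) \<bullet> (adj (u l) \<bullet> u j))"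
    proof (intro M.finsum_cong')
      fix l assume l: "l \<in> I"
      have "mat gram (l, j) = (v l \<bullet> gram) \<bullet> u j" using l j by (simp add: mat_entry a_mult_assoc)
      then show "entrywise_transpose k \<phi>\<^sub>0 (mat r) (i, l) \<otimes>\<^bsub>D\<^esub> mat gram (l, j) = \<phi>\<^sub>0 (?x l) \<bullet> (adj (u l) \<bullet> u j)"
        using i l by (simp add: entrywise_transpose_def mat_entry v_gram)
    qed (use x j \<phi>\<^sub>0_closed corner_closed in auto)
  qed
  also have "\<dots> = (\<Oplus>\<^bsub>A\<^esub>l\<in>I. adj (u l \<bullet> ?x l) \<bullet> u j)"
  proof (intro M.finsum_cong')
    fix l assume l: "l \<in> I"
    show "\<phi>\<^sub>0 (?x l) \<bullet> (adj (u l) \<bullet> u j) = adj (u l \<bullet> ?x l) \<bullet> u j"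
      using adj_mult_corner[OF x(1)[OF l] u_closed[OF l]] l j corner_closed[OF \<phi>\<^sub>0_closed[OF x(1)[OF l]]]
      by (simp add: a_mult_assoc)
  qed (use x j in auto)
  also have "\<dots> = (\<Oplus>\<^bsub>A\<^esub>l\<in>I. adj (u l \<bullet> ?x l)) \<bullet> u j"
    using x j by (intro a_mult_finsum_left[symmetric]) auto
  also have "(\<Oplus>\<^bsub>A\<^esub>l\<in>I. adj (u l \<bullet> ?x l)) = adj (\<Oplus>\<^bsub>A\<^esub>l\<in>I. u l \<bullet> ?x l)"
    using x by (intro adj_finsum[symmetric]) auto
  also have "\<dots> = adj (r \<bullet> u i)" using expand_left[of "r \<bullet> u i"] i r by simp
  \<comment> \<open>Adjointness of \<open>r\<close> and \<open>\<phi> r\<close> for the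
    form.\<close>
  also have "adj (r \<bullet> u i) \<bullet> u j = adj (u i) \<bullet> (\<phi> r \<bullet> u j)"
    using i j r by (simp add: adj_def invol_mult a_mult_assoc)
  also have "\<dots> = v i \<bullet> (gram \<bullet> \<phi> r \<bullet> u j)"
    using i j r v_gram[OF i] by (simp add: a_mult_assoc) (simp add: a_mult_assoc[symmetric])
  finally show "(\<Oplus>\<^bsub>D\<^esub>l\<in>I. entrywise_transpose k \<phi>\<^sub>0 (mat r) (i, l) \<otimes>\<^bsub>D\<^esub> mat gram (l, j)) = v i \<bullet> (gram \<bullet> \<phi> r \<bullet> u j)" .
qed

text \<open>The transposed matrix is itself \<open>mat w\<close> for some \<open>w\<close>, so
  \<open>transpose_form\<close> becomes the equation
  \<open>w \<bullet> gram = gram \<bullet> \<phi> r\<close> in \<open>A\<close>, and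
  \<open>cogram\<close> cancels \<open>gram\<close>.\<close>

lemma mat_invol:
  assumes r: "r \<in> carrier A"
  shows "model_involution D \<phi>\<^sub>0 q s d \<delta> (mat r) = mat (\<phi> r)"
proof -
  have "entrywise_transpose k \<phi>\<^sub>0 (mat r) \<in> carrier M"
    using mat_closed[OF r] \<phi>\<^sub>0_closed by (auto simp: matrix_algebra_sel entrywise_transpose_def)
  then obtain w where w: "w \<in> carrier A" "mat w = entrywise_transpose k \<phi>\<^sub>0 (mat r)" using mat_surj by blast
  have "mat (w \<bullet> gram) = mat (gram \<bullet> \<phi> r)" using transpose_form[OF r] w by (simp add: mat_mult)
  then have wP: "w \<bullet> gram = gram \<bullet> \<phi> r" using w r by (intro mat_inj) auto
  have "model_involution D \<phi>\<^sub>0 q s d \<delta> (mat r) = mat cogram \<otimes>\<^bsub>M\<^esub> mat w \<otimes>\<^bsub>M\<^esub> mat gram"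
    unfolding model_involution_def Let_def inv_form w(2) mat_gram ..
  also have "\<dots> = mat (cogram \<bullet> (w \<bullet> gram))" using w(1) by (simp add: mat_mult[symmetric] a_mult_assoc)
  also have "cogram \<bullet> (w \<bullet> gram) = (cogram \<bullet> gram) \<bullet> \<phi> r" unfolding wP using r by (simp add: a_mult_assoc)
  also have "\<dots> = \<phi> r" using r by (simp add: cogram_gram)
  finally show ?thesis .
qed

text \<open>Without basis vectors the unit would be an empty sum, and \<open>e\<close> would
  vanish.\<close>

lemma size_nonzero: "q \<noteq> 0 \<or> s \<noteq> 0"
proof (rule ccontr)
  assume "\<not> ?thesis"
  then have "One = \<zero>\<^bsub>A\<^esub>" unfolding One_sum by simp
  then have "e = \<zero>\<^bsub>A\<^esub>" using One_unit(1)[OF e_closed] by simp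
  then show False using e_nonzero by simp
qed

lemma iso_inverse:
  assumes grading: "\<And>h. h \<in> carrier G \<Longrightarrow> \<Delta> h = mat ` \<Gamma> h"
  shows "graded_involution_iso F G M \<Delta> (model_involution D \<phi>\<^sub>0 q s d \<delta>) A \<Gamma> \<phi> (inv_into (carrier A) mat)"
proof -
  let ?f = "inv_into (carrier A) mat"
  have inj: "inj_on mat (carrier A)" and im: "mat ` carrier A = carrier M"
    using mat_bij by (auto simp: bij_betw_def)
  have f: "?f (mat r) = r" if "r \<in> carrier A" for r using that inj by simp
  have ex: "\<exists>r\<in>carrier A. Z = mat r" if "Z \<in> carrier M" for Z using that im by blast
  have "?f ` \<Delta> h = \<Gamma> h" if h: "h \<in> carrier G" for h
  proof -
    have "\<Gamma> h \<subseteq> carrier A" using component_closed h by blast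
    then have "(\<lambda>r. ?f (mat r)) ` \<Gamma> h = (\<lambda>r. r) ` \<Gamma> h" using f by (intro image_cong) auto
    then show ?thesis unfolding grading[OF h] by (simp add: image_image)
  qed
  moreover have "?f (Z \<oplus>\<^bsub>M\<^esub> Y) = ?f Z \<oplus>\<^bsub>A\<^esub> ?f Y \<and> ?f (Z \<otimes>\<^bsub>M\<^esub> Y) = ?f Z \<bullet> ?f Y"
    if XY: "Z \<in> carrier M" "Y \<in> carrier M" for Z Y
  proof -
    obtain x y where "x \<in> carrier A" "y \<in> carrier A" "Z = mat x" "Y = mat y" using ex XY by blast
    then show ?thesis by (simp add: mat_add[symmetric] mat_mult[symmetric] f)
  qed
  moreover have "?f (a \<odot>\<^bsub>M\<^esub> Z) = a \<odot>\<^bsub>A\<^esub> ?f Z" if aX: "a \<in> carrier F" "Z \<in> carrier M" for a Z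
  proof -
    obtain x where "x \<in> carrier A" "Z = mat x" using ex aX by blast
    then show ?thesis using aX by (simp add: mat_smult[symmetric] f)
  qed
  moreover have "?f (model_involution D \<phi>\<^sub>0 q s d \<delta> Z) = \<phi> (?f Z)" if Z: "Z \<in> carrier M" for Z
  proof -
    obtain x where "x \<in> carrier A" "Z = mat x" using ex Z by blast
    then show ?thesis by (simp add: mat_invol f)
  qed
  ultimately show ?thesis
    unfolding graded_involution_iso_def using bij_betw_inv_into[OF mat_bij] by blast
qed

end

theorem theorem4p3:
  fixes F :: "'f ring" and G :: "'g monoid"
    and R :: "('f, 'r) module" and \<Gamma> :: "'g \<Rightarrow> 'r set" and \<phi> :: "'r \<Rightarrow> 'r"
  assumes "field F"
    and "comm_group G"
    and "graded_algebra F R G \<Gamma>"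
    and "graded_simple F R G \<Gamma>"
    and "dcc_graded_left_ideals F R G \<Gamma>"
    and "involution F R \<phi>"
    and "degree_preserving G \<Gamma> \<phi>"
  shows "\<exists>(D :: ('f, 'r) module) \<Gamma>\<^sub>D \<phi>\<^sub>0 q s \<delta> d t T \<alpha>.
           graded_division_algebra F D G \<Gamma>\<^sub>D \<and>
           subgroup (grading_support D G \<Gamma>\<^sub>D) G \<and>
           T = G\<lparr>carrier := grading_support D G \<Gamma>\<^sub>D\<rparr> \<and>
           involution F D \<phi>\<^sub>0 \<and> degree_preserving G \<Gamma>\<^sub>D \<phi>\<^sub>0 \<and>
           (q \<noteq> 0 \<or> s \<noteq> 0) \<and>
           \<delta> \<in> {\<one>\<^bsub>F\<^esub>, \<ominus>\<^bsub>F\<^esub> \<one>\<^bsub>F\<^esub>} \<and>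
           (\<forall>i\<in>{1..q}. t i \<in> carrier T \<and> d i \<in> \<Gamma>\<^sub>D (t i) \<and> d i \<noteq> \<zero>\<^bsub>D\<^esub> \<and>
                       \<phi>\<^sub>0 (d i) = \<delta> \<odot>\<^bsub>D\<^esub> d i) \<and>
           \<alpha> \<in> hom (tilde_group T q s t) G \<and>
           (\<forall>u\<in>carrier T. \<alpha> (tilde_emb T q s t u) = u) \<and>
           (\<exists>f. graded_involution_iso F G
                  (matrix_algebra (q + 2 * s) D)
                  (push_grading F (matrix_algebra (q + 2 * s) D) (tilde_group T q s t) \<alpha>
                     (model_grading F D T \<Gamma>\<^sub>D q s t))
                  (model_involution D \<phi>\<^sub>0 q s d \<delta>)
                  R \<Gamma> \<phi> f)"
proof -
  interpret graded_simple_involution F R G \<Gamma> \<phi>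
    using assms
    by (intro graded_simple_involution.intro graded_simple_artinian.intro
        graded_simple_artinian_axioms.intro graded_simple_involution_axioms.intro)
  obtain e c c' \<gamma> \<delta> where form: "graded_form F R G \<Gamma> \<phi> e c c' \<gamma> \<delta>" by (rule exists_graded_form)
  then interpret graded_form F R G \<Gamma> \<phi> e c c' \<gamma> \<delta> .
  obtain q s u g where good: "adapted q s u g" and complete: "complete (q + 2 * s) u"
    by (rule exists_basis)
  interpret graded_form_basis F R G \<Gamma> \<phi> e c c' \<gamma> \<delta> q s u g
    by (rule graded_form_basis.intro[OF form graded_form_basis_axioms.intro[OF good complete]])
  have T: "carrier T = grading_support D G \<Gamma>\<^sub>D" by (simp add: T_def)
  obtain \<alpha> where \<alpha>: "group (tilde_group T q s t)" "\<alpha> \<in> hom (tilde_group T q s t) G"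
    "\<And>i. i \<in> {1..q + 2 * s} \<Longrightarrow> tilde_gen T q s t i \<in> carrier (tilde_group T q s t)"
    "\<And>u. u \<in> grading_support D G \<Gamma>\<^sub>D \<Longrightarrow> tilde_emb T q s t u \<in> carrier (tilde_group T q s t)"
    "\<And>i. i \<in> {1..q + 2 * s} \<Longrightarrow> \<alpha> (tilde_gen T q s t i) = g i"
    "\<And>u. u \<in> grading_support D G \<Gamma>\<^sub>D \<Longrightarrow> \<alpha> (tilde_emb T q s t u) = u"
  proof (rule comm.tilde_group_universal[OF support_D T_def])
    show "t i \<in> grading_support D G \<Gamma>\<^sub>D" if "i \<in> {1..q}" for i using sqdeg_support[OF good that] .
    show "g i \<in> carrier G" if "i \<in> {1..q + 2 * s}" for i using g_closed[OF that] .
    show "g i \<otimes>\<^bsub>G\<^esub> g i \<otimes>\<^bsub>G\<^esub> inv\<^bsub>G\<^esub> (t i) = \<gamma>" if "i \<in> {1..q}" for i using sqdeg_relation[OF good that] .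
    show "g (q + 2 * m - 1) \<otimes>\<^bsub>G\<^esub> g (q + 2 * m) = \<gamma>" if "m \<in> {1..s}" for m using pair_relation[OF good that] .
  qed (rule that)
  have d: "\<forall>i\<in>{1..q}. t i \<in> carrier T \<and> d i \<in> \<Gamma>\<^sub>D (t i) \<and> d i \<noteq> \<zero>\<^bsub>D\<^esub> \<and> \<phi>\<^sub>0 (d i) = \<delta> \<odot>\<^bsub>D\<^esub> d i"
  proof
    fix i assume i: "i \<in> {1..q}"
    \<comment> \<open>The symmetry of \<open>d i\<close> is the diagonal case of the hermitian
      symmetry \<open>\<phi>\<^sub>0_form\<close>.\<close>
    show "t i \<in> carrier T \<and> d i \<in> \<Gamma>\<^sub>D (t i) \<and> d i \<noteq> \<zero>\<^bsub>D\<^esub> \<and> \<phi>\<^sub>0 (d i) = \<delta> \<odot>\<^bsub>D\<^esub> d i"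
      using d_props[OF good i] sqdeg_support[OF good i] i T \<phi>\<^sub>0_form[of "u i" "u i"]
      by (simp add: sqdeg_def[OF good])
  qed
  have iso: "graded_involution_iso F G M
      (push_grading F M (tilde_group T q s t) \<alpha> (model_grading F D T \<Gamma>\<^sub>D q s t))
      (model_involution D \<phi>\<^sub>0 q s d \<delta>) R \<Gamma> \<phi> (inv_into (carrier R) mat)"
    by (rule iso_inverse, rule mat_grading) (use \<alpha> T in simp_all)
  have emb: "\<forall>u\<in>carrier T. \<alpha> (tilde_emb T q s t u) = u" using \<alpha>(6) T by simp
  show ?thesis
    by (rule exI[of _ D], rule exI[of _ \<Gamma>\<^sub>D], rule exI[of _ \<phi>\<^sub>0], rule exI[of _ q], rule exI[of _ s],
        rule exI[of _ \<delta>], rule exI[of _ d], rule exI[of _ t], rule exI[of _ T], rule exI[of _ \<alpha>],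
        intro conjI)
      ((fact graded_division_D support_D T_def involution_D degree_preserving_D size_nonzero
          \<delta>_sign d \<alpha>(2) emb)+, rule exI, fact iso)
qed

end
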